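(* Let $d \ge 1$ and let $\mathbf{u}_0 \in \boldsymbol{\mathcal{S}} = \oplus_{k=1}^d \mathcal{S}(\mathbb{R}^d)$. Then there exists an $\boldsymbol{\mathcal{S}}$-valued local solution $(\mathbf{u}, \tau)$ (in the sense defined in the context) to the viscous Burgers' equation $$\mathbf{u}(t) = \mathbf{u}_0 + \int_0^t \left( \tfrac{1}{2}\Delta \mathbf{u}(s) + \mathbf{u}(s)\cdot\nabla \mathbf{u}(s)\right) ds, \quad t < \tau .$$
   Context: $\mathcal{S}=\mathcal{S}(\mathbb{R}^d)$ is the (real) Schwartz space. For a non-negative integer $p$ and $\phi,\psi\in\mathcal{S}$ put $$\langle \phi,\psi\rangle_p := \sum_{|\alpha|+|\beta|\le 2p}\int_{\mathbb{R}^d} x^\alpha\partial^\beta\phi(x)\, x^\alpha\partial^\beta\psi(x)\,dx$$ (sum over multi-indices $\alpha,\beta\in\mathbb{Z}_+^d$), with norm $\|\cdot\|_p$. The Hermite-Sobolev space $\mathcal{S}_p$ is the completion of $\mathcal{S}$ in $\|\cdot\|_p$, viewed as a subspace of $L^2(\mathbb{R}^d)$. $\boldsymbol{\mathcal{S}}:=\oplus_{k=1}^d\mathcal{S}$ and $\boldsymbol{\mathcal{S}}_p:=\oplus_{k=1}^d\mathcal{S}_p$, with $\langle\mathbf{u},\mathbf{v}\rangle_p:=\sum_{j=1}^d\langle u_j,v_j\rangle_p$ and $\|\mathbf{u}\|_p^2:=\sum_{j=1}^d\|u_j\|_p^2$. For vector fields, $\mathbf{u}\cdot\nabla\mathbf{v}:=\sum_{j=1}^d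 u_j\,\partial_j\mathbf{v}$, and $\Delta$ acts componentwise. Definition. Let $p$ be an integer with $p-1\ge\frac{d+1}{2}$ and $\mathbf{u}_0\in\boldsymbol{\mathcal{S}}_p$. A pair $(\mathbf{u},\tau)$ is an $\boldsymbol{\mathcal{S}}_p$-valued local solution with initial value $\mathbf{u}_0$ if: (1) $\tau>0$; (2) $\mathbf{u}:[0,\tau)\to\boldsymbol{\mathcal{S}}_p$ is continuous; (3) the function $t\mapsto \frac12\Delta\mathbf{u}(t)+\mathbf{u}(t)\cdot\nabla\mathbf{u}(t)$ on $[0,\tau)$ is Bochner integrable in $\boldsymbol{\mathcal{S}}_{p-1}$; (4) the integral equation $\mathbf{u}(t)=\mathbf{u}_0+\int_0^t(\frac12\Delta\mathbf{u}(s)+\mathbf{u}(s)\cdot\nabla\mathbf{u}(s))\,ds$ holds in $\boldsymbol{\mathcal{S}}_{p-1}$ for all $t<\tau$. The pair $(\mathbf{u},\tau)$ is an $\boldsymbol{\mathcal{S}}$-valued local solution if it is an $\boldsymbol{\mathcal{S}}_p$-valued local solution for all integers $p$ with $p-1\ge\frac{d+1}{2}$ (with the same $\mathbf{u}$ and $\tau$). *)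

theory Defs
  imports "HOL-Analysis.Analysis" "HOL-Library.Function_Algebras"
begin

text \<open>
  The space \<open>\<real>\<^sup>d\<close> is \<open>real^'n\<close> with \<open>d = CARD('n)\<close>, so \<open>d \<ge> 1\<close> holds by construction.
  As usual in HOL-Analysis, elements of \<open>L\<^sup>2\<close> and of the Hermite--Sobolev spaces are represented by
  functions, and equality in these spaces is equality almost everywhere.
\<close>

text \<open>Functions form a real vector space under pointwise operations.\<close>

instantiation "fun" :: (type, real_vector) real_vector
begin

definition scaleR_fun :: "real \<Rightarrow> ('a \<Rightarrow> 'b) \<Rightarrow> 'a \<Rightarrow> 'b"
  where "scaleR_fun c f = (\<lambda>x. c *\<^sub>R f x)"

instance
  by standard (simp_all add: scaleR_fun_def fun_eq_iff scaleR_add_right scaleR_add_left)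

end

section \<open>The Schwartz space\<close>

definition partial :: "'n::finite \<Rightarrow> (real^'n \<Rightarrow> real) \<Rightarrow> real^'n \<Rightarrow> real"
  where "partial i f x = frechet_derivative f (at x) (axis i 1)"

text \<open>All iterated partial derivatives exist and are differentiable (hence continuous).\<close>

definition smooth :: "(real^'n::finite \<Rightarrow> real) \<Rightarrow> bool"
  where "smooth f \<longleftrightarrow> (\<forall>js. foldr partial js f differentiable_on UNIV)"

definition mi_order :: "('n::finite \<Rightarrow> nat) \<Rightarrow> nat"
  where "mi_order \<alpha> = (\<Sum>i\<in>UNIV. \<alpha> i)"

definition monomial :: "('n::finite \<Rightarrow> nat) \<Rightarrow> real^'n \<Rightarrow> real"
  where "monomial \<alpha> x = (\<Prod>i\<in>UNIV. (x $ i) ^ \<alpha> i)"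

text \<open>
  An arbitrary but fixed enumeration of the coordinates, used only to fix the order of
  differentiation in \<open>\<partial>\<^sup>\<beta>\<close>; for smooth functions that order is irrelevant.
\<close>

definition coords :: "'n::finite list"
  where "coords = (SOME js. distinct js \<and> set js = UNIV)"

definition mi_deriv :: "('n::finite \<Rightarrow> nat) \<Rightarrow> (real^'n \<Rightarrow> real) \<Rightarrow> real^'n \<Rightarrow> real"
  where "mi_deriv \<beta> f = foldr (\<lambda>i. partial i ^^ \<beta> i) coords f"

definition schwartz :: "(real^'n::finite \<Rightarrow> real) set"
  where "schwartz = {f. smooth f \<and> (\<forall>\<alpha> \<beta>. bounded (range (\<lambda>x. monomial \<alpha> x * mi_deriv \<beta> f x)))}"

definition schwartz_inner :: "nat \<Rightarrow> (real^'n::finite \<Rightarrow> real) \<Rightarrow> (real^'n \<Rightarrow> real) \<Rightarrow> real"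
  where "schwartz_inner p \<phi> \<psi> =
    (\<Sum>(\<alpha>, \<beta>) \<in> {(\<alpha>, \<beta>). mi_order \<alpha> + mi_order \<beta> \<le> 2 * p}.
       LINT x|lborel. (monomial \<alpha> x * mi_deriv \<beta> \<phi> x) * (monomial \<alpha> x * mi_deriv \<beta> \<psi> x))"

definition schwartz_norm :: "nat \<Rightarrow> (real^'n::finite \<Rightarrow> real) \<Rightarrow> real"
  where "schwartz_norm p \<phi> = sqrt (schwartz_inner p \<phi> \<phi>)"

section \<open>Hermite--Sobolev spaces\<close>

definition L2 :: "(real^'n::finite \<Rightarrow> real) set"
  where "L2 = {f \<in> borel_measurable lborel. integrable lborel (\<lambda>x. (f x)\<^sup>2)}"

text \<open>
  The completion of \<open>schwartz\<close> in the \<open>p\<close>-norm, realised inside \<open>L2\<close>: a point of the completion is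
  represented by a Cauchy sequence of Schwartz functions, and it is identified with the \<open>L\<^sup>2\<close>-limit
  of that sequence.
\<close>

definition hs_approx ::
    "nat \<Rightarrow> (real^'n::finite \<Rightarrow> real) \<Rightarrow> (nat \<Rightarrow> real^'n \<Rightarrow> real) \<Rightarrow> bool"
  where "hs_approx p f \<phi> \<longleftrightarrow>
    (\<forall>n. \<phi> n \<in> schwartz) \<and>
    (\<forall>e>0. \<exists>N. \<forall>m\<ge>N. \<forall>n\<ge>N. schwartz_norm p (\<phi> m - \<phi> n) < e) \<and>
    (\<lambda>n. LINT x|lborel. (\<phi> n x - f x)\<^sup>2) \<longlonglongrightarrow> 0"

definition hs_space :: "nat \<Rightarrow> (real^'n::finite \<Rightarrow> real) set"
  where "hs_space p = {f \<in> L2. \<exists>\<phi>. hs_approx p f \<phi>}"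

definition hs_norm :: "nat \<Rightarrow> (real^'n::finite \<Rightarrow> real) \<Rightarrow> real"
  where "hs_norm p f =
    (THE c. \<forall>\<phi>. hs_approx p f \<phi> \<longrightarrow> (\<lambda>n. schwartz_norm p (\<phi> n)) \<longlonglongrightarrow> c)"

text \<open>The direct sums over the \<open>d\<close> components, whose elements are viewed as vector fields.\<close>

definition vschwartz :: "(real^'n \<Rightarrow> real^'n::finite) set"
  where "vschwartz = {u. \<forall>j. (\<lambda>x. u x $ j) \<in> schwartz}"

definition vhs_space :: "nat \<Rightarrow> (real^'n \<Rightarrow> real^'n::finite) set"
  where "vhs_space p = {u. \<forall>j. (\<lambda>x. u x $ j) \<in> hs_space p}"

definition vhs_norm :: "nat \<Rightarrow> (real^'n \<Rightarrow> real^'n::finite) \<Rightarrow> real"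
  where "vhs_norm p u = sqrt (\<Sum>j\<in>UNIV. (hs_norm p (\<lambda>x. u x $ j))\<^sup>2)"

section \<open>The Burgers nonlinearity\<close>

text \<open>
  The distributional partial derivative of an \<open>L\<^sup>2\<close> function with derivative in \<open>L\<^sup>2\<close>; it is
  determined up to a null set, and it exists on \<open>hs_space p\<close> for \<open>p \<ge> 1\<close>, where it coincides with
  the continuous extension of \<^const>\<open>partial\<close>.
\<close>

definition wpartial :: "'n::finite \<Rightarrow> (real^'n \<Rightarrow> real) \<Rightarrow> real^'n \<Rightarrow> real"
  where "wpartial i f = (SOME g. g \<in> L2 \<and>
    (\<forall>\<phi>\<in>schwartz. (LINT x|lborel. f x * partial i \<phi> x) = - (LINT x|lborel. g x * \<phi> x)))"

definition laplacian :: "(real^'n \<Rightarrow> real^'n::finite) \<Rightarrow> real^'n \<Rightarrow> real^'n"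
  where "laplacian v x = (\<chi> k. \<Sum>j\<in>UNIV. wpartial j (wpartial j (\<lambda>y. v y $ k)) x)"

definition advection ::
    "(real^'n \<Rightarrow> real^'n::finite) \<Rightarrow> (real^'n \<Rightarrow> real^'n) \<Rightarrow> real^'n \<Rightarrow> real^'n"
  where "advection u v x = (\<chi> k. \<Sum>j\<in>UNIV. u x $ j * wpartial j (\<lambda>y. v y $ k) x)"

definition burgers :: "(real^'n \<Rightarrow> real^'n::finite) \<Rightarrow> real^'n \<Rightarrow> real^'n"
  where "burgers u = (1/2) *\<^sub>R laplacian u + advection u u"

section \<open>Bochner integration in a (semi)normed space given by a carrier\<close>

text \<open>
  The library's Bochner integral needs the target space to be a type. Since the spaces here depend
  on the number \<open>p\<close>, the textbook definition is repeated for a linear subspace \<open>E\<close> of a real vector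
  space and a seminorm \<open>N\<close> on \<open>E\<close>, vectors at \<open>N\<close>-distance \<open>0\<close> being identified. Simple functions
  and their integrals are those of the library.
\<close>

definition simple_in :: "'v::real_vector set \<Rightarrow> 'a measure \<Rightarrow> ('a \<Rightarrow> 'v) \<Rightarrow> bool"
  where "simple_in E M s \<longleftrightarrow> Bochner_Integration.simple_bochner_integrable M s \<and> s ` space M \<subseteq> E"

definition strongly_measurable_in ::
    "'v::real_vector set \<Rightarrow> ('v \<Rightarrow> real) \<Rightarrow> 'a measure \<Rightarrow> ('a \<Rightarrow> 'v) \<Rightarrow> bool"
  where "strongly_measurable_in E N M f \<longleftrightarrow> f ` space M \<subseteq> E \<and>
    (\<exists>s. (\<forall>i. simple_in E M (s i)) \<and> (AE t in M. (\<lambda>i. N (f t - s i t)) \<longlonglongrightarrow> 0))"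

definition has_bochner_integral_in ::
    "'v::real_vector set \<Rightarrow> ('v \<Rightarrow> real) \<Rightarrow> 'a measure \<Rightarrow> ('a \<Rightarrow> 'v) \<Rightarrow> 'v \<Rightarrow> bool"
  where "has_bochner_integral_in E N M f I \<longleftrightarrow>
    strongly_measurable_in E N M f \<and> I \<in> E \<and>
    (\<exists>s. (\<forall>i. simple_in E M (s i)) \<and>
         (\<lambda>i. \<integral>\<^sup>+t. ennreal (N (f t - s i t)) \<partial>M) \<longlonglongrightarrow> 0 \<and>
         (\<lambda>i. N (Bochner_Integration.simple_bochner_integral M (s i) - I)) \<longlonglongrightarrow> 0)"

definition bochner_integrable_in ::
    "'v::real_vector set \<Rightarrow> ('v \<Rightarrow> real) \<Rightarrow> 'a measure \<Rightarrow> ('a \<Rightarrow> 'v) \<Rightarrow> bool"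
  where "bochner_integrable_in E N M f \<longleftrightarrow> (\<exists>I. has_bochner_integral_in E N M f I)"

section \<open>Local solutions\<close>

text \<open>
  The values of \<open>u\<close> outside \<open>[0, \<tau>)\<close> are irrelevant. The first definition is meant for
  \<open>p - 1 \<ge> (d + 1) / 2\<close>, which forces \<open>p \<ge> 2\<close>.
\<close>

definition hs_local_solution ::
    "nat \<Rightarrow> (real^'n \<Rightarrow> real^'n::finite) \<Rightarrow> (real \<Rightarrow> real^'n \<Rightarrow> real^'n) \<Rightarrow> real \<Rightarrow> bool"
  where "hs_local_solution p u\<^sub>0 u \<tau> \<longleftrightarrow>
    u\<^sub>0 \<in> vhs_space p \<and>
    \<tau> > 0 \<and>
    (\<forall>t\<in>{0..<\<tau>}. u t \<in> vhs_space p) \<and>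
    (\<forall>t\<in>{0..<\<tau>}. ((\<lambda>s. vhs_norm p (u s - u t)) \<longlongrightarrow> 0) (at t within {0..<\<tau>})) \<and>
    bochner_integrable_in (vhs_space (p - 1)) (vhs_norm (p - 1))
      (restrict_space lborel {0..<\<tau>}) (\<lambda>t. burgers (u t)) \<and>
    (\<forall>t\<in>{0..<\<tau>}. \<exists>I.
       has_bochner_integral_in (vhs_space (p - 1)) (vhs_norm (p - 1))
         (restrict_space lborel {0..<t}) (\<lambda>s. burgers (u s)) I \<and>
       (AE x in lborel. u t x = u\<^sub>0 x + I x))"

definition schwartz_local_solution ::
    "(real^'n \<Rightarrow> real^'n::finite) \<Rightarrow> (real \<Rightarrow> real^'n \<Rightarrow> real^'n) \<Rightarrow> real \<Rightarrow> bool"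
  where "schwartz_local_solution u\<^sub>0 u \<tau> \<longleftrightarrow>
    (\<forall>p::nat. real p - 1 \<ge> (real CARD('n) + 1) / 2 \<longrightarrow> hs_local_solution p u\<^sub>0 u \<tau>)"

end

theory Submission
  imports Defs "HOL-Probability.Sinc_Integral" "HOL-Real_Asymp.Real_Asymp"
    "HOL-Computational_Algebra.Polynomial"
begin

text \<open>
  With \<open>u = u\<^sub>0 + v\<close> and \<open>v(0) = 0\<close>, Duhamel's formula turns the equation into
  \<open>v(t) = \<integral>\<^sub>0\<^sup>t e\<^bsup>(t - s) \<Delta> / 2\<^esup> (\<Delta>u\<^sub>0 / 2 + u(s) \<cdot> \<nabla>u(s)) ds\<close>, which is solved by Picard iteration.
  The heat semigroup is an average over Gaussian shifts, so it commutes with derivatives, preserves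
  polynomial decay, and gains one derivative at the price of an integrable singularity in time.
  A time \<open>T\<close> is chosen only once, so small that the iterates stay bounded together with their gradients.
  In the bounds for weighted derivatives of higher order the top order enters linearly, so
  exponential weights in time (with a rate depending on the order) give uniform bounds and geometric
  convergence at every order on the same interval \<open>[0, T]\<close>. The limit takes values in the Schwartz
  space, is continuous in every seminorm, and solves the equation pointwise; Riemann sums then turn the
  pointwise integrals into Bochner integrals.
\<close>

subsection \<open>Iterated partial derivatives\<close>

text \<open>A single \<tau> has to serve for every p, whereas a contraction argument run separately
  in each norm would give a time that shrinks with p. Hence only one estimate, the quadratic one for
  values and gradients, is allowed to restrict the time. The advection term costs one derivative,
  exactly the one that the Duhamel operator returns, so the bounds close at each fixed order. All
  estimates are made in weighted sup norms: they survive averaging over shifts because the weight is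
  submultiplicative, they behave well under products, and finitely many of them dominate each
  Hermite-Sobolev norm, so that no Sobolev embedding enters. Two notions in the definitions are
  given by description operators and have to be pinned down on Schwartz functions:
  \<open>wpartial\<close> by \<open>SOME\<close>, which calls for uniqueness of weak derivatives
  almost everywhere, and \<open>hs_norm\<close> by \<open>THE\<close>, which calls for closability
  of the p-norm in L2.\<close>

text \<open>
  Derivatives are indexed by lists of coordinates rather than multi-indices: peeling off the outermost
  or the innermost derivative replaces the general Leibniz rule by inductions on the list.
\<close>

abbreviation pd :: "'n::finite list \<Rightarrow> (real^'n \<Rightarrow> real) \<Rightarrow> real^'n \<Rightarrow> real"
  where "pd js f \<equiv> foldr partial js f"

lemma partialI: "(f has_derivative f') (at x) \<Longrightarrow> partial i f x = f' (axis i 1)"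
  unfolding partial_def using frechet_derivative_at by metis

lemma has_derivative_partial:
  fixes f :: "real^'n::finite \<Rightarrow> real"
  assumes "f differentiable (at x)"
  shows "(f has_derivative (\<lambda>h. \<Sum>i\<in>UNIV. h $ i * partial i f x)) (at x)"
proof -
  have d: "(f has_derivative frechet_derivative f (at x)) (at x)"
    using assms frechet_derivative_works by blast
  then interpret bounded_linear "frechet_derivative f (at x)"
    by (rule has_derivative_bounded_linear)
  have "frechet_derivative f (at x) = (\<lambda>h. \<Sum>i\<in>UNIV. h $ i * partial i f x)"
  proof
    fix h
    have "frechet_derivative f (at x) h = frechet_derivative f (at x) (\<Sum>i\<in>UNIV. (h$i) *\<^sub>R axis i 1)"
      using basis_expansion[of h] by (simp add: scalar_mult_eq_scaleR)
    then show "frechet_derivative f (at x) h = (\<Sum>i\<in>UNIV. h $ i * partial i f x)"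
      by (simp add: sum scaleR partial_def)
  qed
  with d show ?thesis by simp
qed

lemma partial_line:
  fixes f :: "real^'n::finite \<Rightarrow> real"
  assumes "f differentiable (at (x + s *\<^sub>R axis i 1))"
  shows "((\<lambda>s. f (x + s *\<^sub>R axis i 1)) has_real_derivative partial i f (x + s *\<^sub>R axis i 1)) (at s)"
proof -
  have d: "(f has_derivative frechet_derivative f (at (x + s *\<^sub>R axis i 1))) (at (x + s *\<^sub>R axis i 1))"
    using assms frechet_derivative_works by blast
  have "((\<lambda>s. x + s *\<^sub>R axis i 1) has_derivative (\<lambda>h. h *\<^sub>R axis i 1)) (at s)"
    by (auto intro!: derivative_eq_intros)
  from has_derivative_compose[OF this d] show ?thesis
    using linear_cmul[OF has_derivative_linear[OF d]]
    by (simp add: has_field_derivative_def partial_def mult_commute_abs)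
qed

lemma smooth_pd: "smooth f \<Longrightarrow> smooth (pd js f)"
  unfolding smooth_def by (metis foldr_append o_apply)

lemma smooth_partial: "smooth f \<Longrightarrow> smooth (partial i f)"
  using smooth_pd[of f "[i]"] by simp

lemma smooth_differentiable: "smooth f \<Longrightarrow> f differentiable (at x)"
  unfolding smooth_def differentiable_on_def using foldr.simps(1)[of partial] by (metis UNIV_I id_apply)

lemma smooth_continuous: "smooth f \<Longrightarrow> continuous_on S f"
  by (meson continuous_at_imp_continuous_on differentiable_imp_continuous_within smooth_differentiable)

lemma smooth_has_derivative:
  "smooth f \<Longrightarrow> (f has_derivative (\<lambda>h. \<Sum>i\<in>UNIV. h $ i * partial i f x)) (at x)"
  by (intro has_derivative_partial smooth_differentiable)

lemma smooth_measurable [measurable_dest]: "smooth f \<Longrightarrow> f \<in> borel_measurable borel"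
  by (intro borel_measurable_continuous_onI smooth_continuous)

section \<open>Closure of smooth functions under sums and products\<close>

lemma smooth_iff_upto:
  "smooth f \<longleftrightarrow> (\<forall>k js. length js \<le> k \<longrightarrow> pd js f differentiable_on UNIV)"
  unfolding smooth_def by auto

text \<open>The derivative peeled off is the innermost one, the last entry of the list. The product
  rule turns \<open>partial i\<close> of a product into a sum of products of smooth functions, so an
  induction on k over all pairs f, g can close.\<close>

lemma diff_upto_Suc:
  "(\<forall>js. length js \<le> Suc k \<longrightarrow> pd js f differentiable_on UNIV) \<longleftrightarrow>
   f differentiable_on UNIV \<and> (\<forall>i js. length js \<le> k \<longrightarrow> pd js (partial i f) differentiable_on UNIV)"
  (is "?L \<longleftrightarrow> ?R")
proof
  assume L: ?L
  have "pd js (partial i f) differentiable_on UNIV" if "length js \<le> k" for i js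
    using L[rule_format, of "js @ [i]"] that by simp
  then show ?R using L[rule_format, of "[]"] by simp
next
  assume R: ?R
  show ?L
  proof (intro allI impI)
    fix js :: "'a list" assume "length js \<le> Suc k"
    then show "pd js f differentiable_on UNIV"
      using R by (cases js rule: rev_cases) auto
  qed
qed

lemma partial_add:
  assumes "f differentiable (at x)" "g differentiable (at x)"
  shows "partial i (\<lambda>x. f x + g x) x = partial i f x + partial i g x"
  using has_derivative_add[OF has_derivative_partial[OF assms(1)] has_derivative_partial[OF assms(2)]]
  by (simp add: partialI axis_def if_distrib if_distribR sum.delta cong: if_cong)

lemma partial_mult:
  assumes "f differentiable (at x)" "g differentiable (at x)"
  shows "partial i (\<lambda>x. f x * g x) x = partial i f x * g x + f x * partial i g x"
  using has_derivative_mult[OF has_derivative_partial[OF assms(1)] has_derivative_partial[OF assms(2)]]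
  by (simp add: partialI axis_def if_distrib if_distribR sum.delta cong: if_cong)

lemma partial_const [simp]: "partial i (\<lambda>x. c) = (\<lambda>x. 0)"
  by (auto simp: fun_eq_iff intro!: partialI[where f'="\<lambda>h. 0"])

lemma partial_cmult: "f differentiable (at x) \<Longrightarrow> partial i (\<lambda>x. c * f x) x = c * partial i f x"
  using partial_mult[of "\<lambda>x. c" x f i] by simp

lemma pd_const: "pd js (\<lambda>x. c) = (\<lambda>x. if js = [] then c else 0)"
  by (induction js) (auto split: if_splits)

lemma smooth_const [simp]: "smooth (\<lambda>x. c)"
  unfolding smooth_def pd_const by simp

lemma smooth_add:
  fixes f g :: "real^'n::finite \<Rightarrow> real"
  assumes "smooth f" "smooth g" shows "smooth (\<lambda>x. f x + g x)"
proof -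
  have "\<forall>f g::real^'n \<Rightarrow> real. smooth f \<longrightarrow> smooth g \<longrightarrow> (\<forall>js. length js \<le> k \<longrightarrow> pd js (\<lambda>x. f x + g x) differentiable_on UNIV)" for k
  proof (induction k)
    case 0
    then show ?case by (auto intro!: differentiable_at_imp_differentiable_on differentiable_add[OF smooth_differentiable smooth_differentiable])
  next
    case (Suc k)
    have "partial i (\<lambda>x. f x + g x) = (\<lambda>x. partial i f x + partial i g x)"
      if "smooth f" "smooth g" for f g :: "real^'n \<Rightarrow> real" and i
      using that by (auto simp: fun_eq_iff partial_add smooth_differentiable)
    with Suc show ?case unfolding diff_upto_Suc
      by (simp add: smooth_partial differentiable_at_imp_differentiable_on differentiable_add[OF smooth_differentiable smooth_differentiable])
  qed
  then show ?thesis using assms unfolding smooth_iff_upto by blast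
qed

lemma smooth_mult:
  fixes f g :: "real^'n::finite \<Rightarrow> real"
  assumes "smooth f" "smooth g" shows "smooth (\<lambda>x. f x * g x)"
proof -
  have pm: "partial i (\<lambda>x. f x * g x) = (\<lambda>x. partial i f x * g x + f x * partial i g x)"
    if "smooth f" "smooth g" for f g :: "real^'n \<Rightarrow> real" and i
    using that by (auto simp: fun_eq_iff partial_mult smooth_differentiable)
  \<comment> \<open>The two summands of the product rule are not yet known to be smooth. The
    induction hypothesis only makes them differentiable up to order k, so additivity of
    \<open>pd\<close> is derived from that much.\<close>
  have padd: "pd js (\<lambda>x. f x + g x) = (\<lambda>x. pd js f x + pd js g x)"
    if "\<And>ks. length ks \<le> length js \<Longrightarrow> pd ks f differentiable_on UNIV"
       "\<And>ks. length ks \<le> length js \<Longrightarrow> pd ks g differentiable_on UNIV" for js :: "'n list" and f g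
    using that
  proof (induction js)
    case (Cons j js)
    then have "pd js (\<lambda>x. f x + g x) = (\<lambda>x. pd js f x + pd js g x)" by simp
    moreover have "pd js f differentiable (at x)" "pd js g differentiable (at x)" for x
      using Cons(2)[of js] Cons(3)[of js] by (auto simp: differentiable_on_def)
    ultimately show ?case by (auto simp: partial_add)
  qed simp
  have "\<forall>f g::real^'n \<Rightarrow> real. smooth f \<longrightarrow> smooth g \<longrightarrow> (\<forall>js. length js \<le> k \<longrightarrow> pd js (\<lambda>x. f x * g x) differentiable_on UNIV)" for k
  proof (induction k)
    case 0
    then show ?case by (auto intro!: differentiable_at_imp_differentiable_on differentiable_mult[OF smooth_differentiable smooth_differentiable])
  next
    case (Suc k)
    have "pd js (partial i (\<lambda>x. f x * g x)) differentiable_on UNIV"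
      if s: "smooth f" "smooth g" and js: "length js \<le> k" for f g :: "real^'n \<Rightarrow> real" and i js
    proof -
      have "pd ks (\<lambda>x. partial i f x * g x) differentiable_on UNIV"
           "pd ks (\<lambda>x. f x * partial i g x) differentiable_on UNIV" if "length ks \<le> length js" for ks
        using Suc[rule_format, OF smooth_partial[OF s(1)] s(2)] Suc[rule_format, OF s(1) smooth_partial[OF s(2)]]
          js that by auto
      then show ?thesis unfolding pm[OF s] by (subst padd) auto
    qed
    then show ?case unfolding diff_upto_Suc using Suc
      by (auto intro!: differentiable_at_imp_differentiable_on differentiable_mult[OF smooth_differentiable smooth_differentiable])
  qed
  then show ?thesis using assms unfolding smooth_iff_upto by blast
qed

lemma pd_add:
  assumes "smooth f" "smooth g" shows "pd js (\<lambda>x. f x + g x) = (\<lambda>x. pd js f x + pd js g x)"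
  by (induction js) (auto simp: partial_add smooth_differentiable smooth_pd assms)

lemma smooth_cmult: "smooth f \<Longrightarrow> smooth (\<lambda>x. c * f x)"
  using smooth_mult[of "\<lambda>x. c" f] by simp

lemma pd_cmult:
  assumes "smooth f" shows "pd js (\<lambda>x. c * f x) = (\<lambda>x. c * pd js f x)"
  by (induction js) (auto simp: partial_cmult smooth_differentiable smooth_pd assms)

lemma smooth_minus: "smooth f \<Longrightarrow> smooth (\<lambda>x. - f x)"
  using smooth_cmult[of f "-1"] by simp

lemma pd_minus: "smooth f \<Longrightarrow> pd js (\<lambda>x. - f x) = (\<lambda>x. - pd js f x)"
  using pd_cmult[of f js "-1"] by simp

lemma pd_diff:
  "smooth f \<Longrightarrow> smooth g \<Longrightarrow> pd js (\<lambda>x. f x - g x) = (\<lambda>x. pd js f x - pd js g x)"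
  using pd_add[of f "\<lambda>x. - g x" js] pd_minus[of g js] smooth_minus[of g] by simp

lemma smooth_sum: "(\<And>i. i \<in> A \<Longrightarrow> smooth (f i)) \<Longrightarrow> smooth (\<lambda>x. \<Sum>i\<in>A. f i x)"
  by (induction A rule: infinite_finite_induct) (auto intro!: smooth_add)

lemma pd_sum:
  "(\<And>i. i \<in> A \<Longrightarrow> smooth (f i)) \<Longrightarrow> pd js (\<lambda>x. \<Sum>i\<in>A. f i x) = (\<lambda>x. \<Sum>i\<in>A. pd js (f i) x)"
proof (induction A rule: infinite_finite_induct)
  case (insert a A)
  then show ?case by (simp add: pd_add smooth_sum)
qed (auto simp: pd_const)

lemma pd_mult_snoc:
  assumes "smooth f" "smooth g"
  shows "pd (js @ [i]) (\<lambda>x. f x * g x) =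
    (\<lambda>x. pd js (\<lambda>x. partial i f x * g x) x + pd js (\<lambda>x. f x * partial i g x) x)"
proof -
  have "partial i (\<lambda>x. f x * g x) = (\<lambda>x. partial i f x * g x + f x * partial i g x)"
    using assms by (auto simp: fun_eq_iff partial_mult smooth_differentiable)
  then show ?thesis using assms by (simp add: pd_add smooth_mult smooth_partial)
qed

lemma partial_component: "partial i (\<lambda>x. x $ j) = (\<lambda>x. if i = j then 1 else 0)"
  by (rule ext, subst partialI[where f'="\<lambda>h. h $ j"])
     (auto simp: axis_def bounded_linear_vec_nth intro!: bounded_linear_imp_has_derivative)

lemma smooth_component: "smooth (\<lambda>x. x $ j)"
proof -
  have "pd js (\<lambda>x. x $ j) differentiable_on UNIV" for js
  proof (cases js rule: rev_cases)
    case Nil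
    have "(\<lambda>x. x $ j) differentiable (at x)" for x :: "real^'a"
      using bounded_linear_imp_has_derivative[OF bounded_linear_vec_nth] differentiable_def by blast
    then show ?thesis using Nil by (simp add: differentiable_at_imp_differentiable_on)
  qed (auto simp: partial_component pd_const)
  then show ?thesis by (simp add: smooth_def)
qed

lemma smooth_prod: "(\<And>i. i \<in> A \<Longrightarrow> smooth (f i)) \<Longrightarrow> smooth (\<lambda>x. \<Prod>i\<in>A. f i x)"
  by (induction A rule: infinite_finite_induct) (auto intro!: smooth_mult)

lemma smooth_power: "smooth f \<Longrightarrow> smooth (\<lambda>x. f x ^ n)"
  by (induction n) (auto intro!: smooth_mult)

subsection \<open>Symmetry of mixed partial derivatives\<close>

text \<open>Two mean value theorems: one in direction i, for the difference of two translates in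
  direction j, and one in direction j for the derivative so obtained.\<close>

lemma second_difference:
  fixes f :: "real^'n::finite \<Rightarrow> real"
  assumes "smooth f" "h > 0"
  obtains s t where "0 < s" "s < h" "0 < t" "t < h"
    "f (x + h *\<^sub>R axis i 1 + h *\<^sub>R axis j 1) - f (x + h *\<^sub>R axis i 1) - f (x + h *\<^sub>R axis j 1) + f x
      = h\<^sup>2 * partial j (partial i f) (x + s *\<^sub>R axis i 1 + t *\<^sub>R axis j 1)"
proof -
  let ?e = "axis i 1 :: real^'n" and ?d = "axis j 1 :: real^'n"
  let ?p = "\<lambda>s. f ((x + h *\<^sub>R ?d) + s *\<^sub>R ?e) - f (x + s *\<^sub>R ?e)"
  have dp: "DERIV ?p s :> partial i f ((x + h *\<^sub>R ?d) + s *\<^sub>R ?e) - partial i f (x + s *\<^sub>R ?e)" for s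
    by (intro DERIV_diff partial_line smooth_differentiable assms)
  then obtain s where s: "0 < s" "s < h"
    "?p h - ?p 0 = (h - 0) * (partial i f ((x + h *\<^sub>R ?d) + s *\<^sub>R ?e) - partial i f (x + s *\<^sub>R ?e))"
    using MVT2[OF assms(2) dp] by auto
  let ?q = "\<lambda>t. partial i f ((x + s *\<^sub>R ?e) + t *\<^sub>R ?d)"
  have dq: "DERIV ?q t :> partial j (partial i f) ((x + s *\<^sub>R ?e) + t *\<^sub>R ?d)" for t
    by (intro partial_line smooth_differentiable smooth_partial assms)
  then obtain t where t: "0 < t" "t < h"
    "?q h - ?q 0 = (h - 0) * partial j (partial i f) ((x + s *\<^sub>R ?e) + t *\<^sub>R ?d)"
    using MVT2[OF assms(2) dq] by auto
  show ?thesis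
    by (rule that[OF s(1,2) t(1,2)]) (use s(3) t(3) in \<open>simp add: algebra_simps power2_eq_square\<close>)
qed

text \<open>The second difference is symmetric in the two directions. Along h = 1 / (n + 1) its two
  mean value representations therefore agree, and by continuity they tend to the two mixed
  derivatives at x.\<close>

lemma partial_commute:
  fixes f :: "real^'n::finite \<Rightarrow> real"
  assumes "smooth f"
  shows "partial i (partial j f) = partial j (partial i f)"
proof
  fix x
  let ?h = "\<lambda>n::nat. 1 / (real n + 1)"
  let ?X = "\<lambda>(i::'n) (j::'n) n s t. 0 < s \<and> s < ?h n \<and> 0 < t \<and> t < ?h n \<and> 
    f (x + ?h n *\<^sub>R axis i 1 + ?h n *\<^sub>R axis j 1) - f (x + ?h n *\<^sub>R axis i 1) - f (x + ?h n *\<^sub>R axis j 1) + f x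
      = (?h n)\<^sup>2 * partial j (partial i f) (x + s *\<^sub>R axis i 1 + t *\<^sub>R axis j 1)"
  have ex: "\<exists>s t. ?X i j n s t" for i j n
    by (rule second_difference[OF assms, of "?h n" x i j]) auto
  obtain s t where st: "\<And>n. ?X i j n (s n) (t n)" using ex[where i=i and j=j] by metis
  obtain s' t' where st': "\<And>n. ?X j i n (s' n) (t' n)" using ex[where i=j and j=i] by metis
  have h0: "?h \<longlonglongrightarrow> 0" using LIMSEQ_inverse_real_of_nat by (simp add: inverse_eq_divide add.commute)
  have lim0: "r \<longlonglongrightarrow> 0" if "\<And>n. 0 < r n \<and> r n < ?h n" for r :: "nat \<Rightarrow> real"
    by (rule tendsto_sandwich[OF _ _ tendsto_const h0]) (auto intro!: always_eventually less_imp_le simp: that)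
  have lim: "(\<lambda>n. partial j (partial i f) (x + s n *\<^sub>R axis i 1 + t n *\<^sub>R axis j 1)) \<longlonglongrightarrow> partial j (partial i f) x"
    if "s \<longlonglongrightarrow> 0" "t \<longlonglongrightarrow> 0" for i j :: 'n and s t :: "nat \<Rightarrow> real"
  proof -
    have "(\<lambda>n. x + s n *\<^sub>R axis i 1 + t n *\<^sub>R axis j 1) \<longlonglongrightarrow> x + 0 *\<^sub>R axis i 1 + 0 *\<^sub>R axis j 1"
      by (intro tendsto_intros that)
    moreover have "isCont (partial j (partial i f)) x"
      by (meson assms differentiable_imp_continuous_within smooth_differentiable smooth_partial)
    ultimately show ?thesis by (auto intro: isCont_tendsto_compose)
  qed
  have eq: "partial j (partial i f) (x + s n *\<^sub>R axis i 1 + t n *\<^sub>R axis j 1) =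
        partial i (partial j f) (x + s' n *\<^sub>R axis j 1 + t' n *\<^sub>R axis i 1)" for n
  proof -
    have "(?h n)\<^sup>2 * partial j (partial i f) (x + s n *\<^sub>R axis i 1 + t n *\<^sub>R axis j 1) =
        (?h n)\<^sup>2 * partial i (partial j f) (x + s' n *\<^sub>R axis j 1 + t' n *\<^sub>R axis i 1)"
      using st[of n] st'[of n] by (simp add: algebra_simps)
    then show ?thesis by (subst (asm) mult_left_cancel) auto
  qed
  show "partial i (partial j f) x = partial j (partial i f) x"
    using lim[where s=s and t=t and i=i and j=j] lim[where s=s' and t=t' and i=j and j=i] lim0[of s] lim0[of t] lim0[of s'] lim0[of t'] st st' eq
    by (metis (no_types, lifting) LIMSEQ_unique ext)
qed

lemma pd_partial_commute: "smooth f \<Longrightarrow> pd js (partial i f) = partial i (pd js f)"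
  by (induction js) (auto simp: partial_commute smooth_pd)

lemma pd_permute:
  assumes "smooth f" "mset js = mset ks" shows "pd js f = pd ks f"
  using assms(2)
proof (induction js arbitrary: ks)
  case (Cons j js)
  then have "j \<in> set ks" by (metis list.set_intros(1) set_mset_mset)
  then obtain as bs where ks: "ks = as @ j # bs" by (meson split_list)
  then have "mset js = mset (as @ bs)" using Cons.prems by simp
  then have "pd js f = pd (as @ bs) f" by (rule Cons.IH)
  then show ?case using assms(1) by (simp add: ks pd_partial_commute smooth_pd)
qed simp

section \<open>Multi-indices as lists of coordinates\<close>

lemma coords: "distinct (coords :: 'n::finite list)" "set (coords :: 'n list) = UNIV"
proof -
  have "\<exists>js::'n list. distinct js \<and> set js = UNIV"
    using finite_distinct_list[OF finite[of UNIV]] by blast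
  then have "distinct (coords :: 'n list) \<and> set (coords :: 'n list) = UNIV"
    unfolding coords_def by (rule someI_ex)
  then show "distinct (coords :: 'n list)" "set (coords :: 'n list) = UNIV" by auto
qed

definition mi_list :: "('n::finite \<Rightarrow> nat) \<Rightarrow> 'n list"
  where "mi_list \<beta> = concat (map (\<lambda>i. replicate (\<beta> i) i) coords)"

lemma mi_deriv_eq_pd: "mi_deriv \<beta> f = pd (mi_list \<beta>) f"
proof -
  have "foldr (\<lambda>i. partial i ^^ \<beta> i) cs f = pd (concat (map (\<lambda>i. replicate (\<beta> i) i) cs)) f" for cs
  proof (induction cs)
    case (Cons c cs)
    have "pd (replicate n c) h = (partial c ^^ n) h" for n h
      by (induction n) auto
    then show ?case using Cons by simp
  qed simp
  then show ?thesis by (simp add: mi_deriv_def mi_list_def)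
qed

lemma count_mi_list: "count (mset (mi_list \<beta>)) i = \<beta> i"
proof -
  have "count (mset (concat (map (\<lambda>i. replicate (\<beta> i) i) cs))) i = (if i \<in> set cs then \<beta> i else 0)"
    if "distinct cs" for cs
    using that by (induction cs) auto
  then show ?thesis by (simp add: mi_list_def coords)
qed

lemma length_mi_list: "length (mi_list \<beta>) = mi_order \<beta>"
proof -
  have "length (mi_list \<beta>) = sum_list (map \<beta> coords)"
    by (simp add: mi_list_def length_concat o_def)
  also have "\<dots> = mi_order \<beta>" using sum_list_distinct_conv_sum_set[OF coords(1)[where 'n='a], of \<beta>] by (simp add: mi_order_def coords)
  finally show ?thesis .
qed

lemma pd_eq_mi_deriv:
  assumes "smooth f" obtains \<beta> where "pd js f = mi_deriv \<beta> f" "mi_order \<beta> = length js"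
proof
  have *: "mset js = mset (mi_list (count (mset js)))"
    by (simp add: multiset_eq_iff count_mi_list)
  show "pd js f = mi_deriv (count (mset js)) f" unfolding mi_deriv_eq_pd
    by (rule pd_permute[OF assms *])
  show "mi_order (count (mset js)) = length js"
    using * length_mi_list size_mset by metis
qed

subsection \<open>Polynomial weights\<close>

text \<open>A weight bounded below by 1 replaces the monomials: it is positive, monotone and
  multiplicative in m, and submultiplicative under translations.\<close>

definition wt :: "nat \<Rightarrow> 'a::real_normed_vector \<Rightarrow> real"
  where "wt m x = (1 + norm x) ^ m"

lemma wt_0 [simp]: "wt 0 x = 1" by (simp add: wt_def)

lemma wt_ge1: "1 \<le> wt m x" by (simp add: wt_def one_le_power)

lemma wt_pos [simp]: "0 < wt m x" "0 \<le> wt m x"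
  using wt_ge1[of m x] by linarith+

lemma wt_add: "wt (m + k) x = wt m x * wt k x" by (simp add: wt_def power_add)

lemma wt_mono: "m \<le> k \<Longrightarrow> wt m x \<le> wt k x"
  by (simp add: wt_def power_increasing)

text \<open>Rests on 1 + |x| \<le> (1 + |x + z|) (1 + |z|). A weight at x is moved to the shifted
  point at the price of a weight in the shift, which the Gaussian moments absorb.\<close>

lemma wt_shift: "wt m x \<le> wt m (x + z) * wt m z"
proof -
  have "norm x \<le> norm (x + z) + norm z"
    using norm_triangle_ineq4[of "x + z" z] by simp
  moreover have "0 \<le> norm (x + z) * norm z" by simp
  moreover have "(1 + norm (x + z)) * (1 + norm z) = 1 + norm (x + z) + norm z + norm (x + z) * norm z"
    by (simp add: algebra_simps)
  ultimately have "1 + norm x \<le> (1 + norm (x + z)) * (1 + norm z)" by linarith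
  then show ?thesis
    unfolding wt_def power_mult_distrib[symmetric] by (intro power_mono) auto
qed

lemma wt_scale: "\<bar>c\<bar> \<le> 1 \<Longrightarrow> wt m (c *\<^sub>R z) \<le> wt m z"
  unfolding wt_def by (intro power_mono add_left_mono) (auto intro: mult_left_le_one_le)

lemma continuous_wt [continuous_intros]: "continuous_on S f \<Longrightarrow> continuous_on S (\<lambda>x. wt m (f x))"
  unfolding wt_def by (intro continuous_intros)

lemma wt_measurable [measurable]: "wt m \<in> borel_measurable borel"
  by (intro borel_measurable_continuous_onI continuous_wt continuous_on_id)

text \<open>Each of the d factors 1 + (x \<bullet> b)^2 is at most (1 + |x|)^2, which explains the
  exponent 2 d. The product of their inverses integrates coordinate by coordinate.\<close>

lemma integrable_inverse_wt: "integrable lborel (\<lambda>x::real^'n::finite. 1 / wt (2 * CARD('n)) x)"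
proof (rule integrableI_bounded)
  have 1: "integrable lborel (\<lambda>x::real. inverse (1 + x^2))"
    using integrable_inverse_1_plus_square by (simp add: set_integrable_def)
  have "(\<integral>\<^sup>+x. ennreal (norm (1 / wt (2 * CARD('n)) (x::real^'n))) \<partial>lborel)
      \<le> (\<integral>\<^sup>+x. (\<Prod>b\<in>Basis. ennreal (inverse (1 + ((x::real^'n) \<bullet> b)^2))) \<partial>lborel)"
  proof (rule nn_integral_mono)
    fix x :: "real^'n"
    have "(\<Prod>b\<in>(Basis::(real^'n) set). 1 + (x \<bullet> b)^2) \<le> (\<Prod>b\<in>(Basis::(real^'n) set). (1 + norm x)^2)"
    proof (intro prod_mono conjI)
      fix b :: "real^'n" assume "b \<in> Basis"
      then have "\<bar>x \<bullet> b\<bar> \<le> norm x" using Basis_le_norm by blast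
      then have "(x \<bullet> b)^2 \<le> (norm x)^2" by (simp add: abs_le_square_iff[symmetric])
      moreover have "(1 + norm x)^2 = 1 + 2 * norm x + (norm x)^2" by (simp add: power2_sum)
      ultimately show "1 + (x \<bullet> b)^2 \<le> (1 + norm x)^2"
        using norm_ge_zero[of x] by linarith
    qed auto
    also have "\<dots> = wt (2 * CARD('n)) x" by (simp add: wt_def power_mult)
    finally have "1 / wt (2 * CARD('n)) x \<le> 1 / (\<Prod>b\<in>(Basis::(real^'n) set). 1 + (x \<bullet> b)^2)"
      by (intro divide_left_mono mult_pos_pos wt_pos prod_pos) (auto intro: add_pos_nonneg)
    also have "\<dots> = (\<Prod>b\<in>(Basis::(real^'n) set). inverse (1 + (x \<bullet> b)^2))"
      by (simp add: prod_inversef inverse_eq_divide prod_dividef)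
    finally show "ennreal (norm (1 / wt (2 * CARD('n)) x)) \<le> (\<Prod>b\<in>(Basis::(real^'n) set). ennreal (inverse (1 + (x \<bullet> b)^2)))"
      by (subst prod_ennreal) (auto intro!: ennreal_leI simp: less_imp_le)
  qed
  also have "\<dots> = (\<Prod>b\<in>(Basis::(real^'n) set). (\<integral>\<^sup>+x. ennreal (inverse (1 + x^2)) \<partial>lborel))"
    by (subst nn_integral_lborel_prod[where f="\<lambda>b x. ennreal (inverse (1 + x^2))"]) auto
  also have "\<dots> < \<infinity>"
    using 1 by (auto simp: integrable_iff_bounded less_top[symmetric] power_eq_top_ennreal)
  finally show "(\<integral>\<^sup>+x. ennreal (norm (1 / wt (2 * CARD('n)) (x::real^'n))) \<partial>lborel) < \<infinity>" .
qed simp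

lemma integrable_wt_bound:
  fixes f :: "real^'n::finite \<Rightarrow> real"
  assumes [measurable]: "f \<in> borel_measurable borel"
    and "\<And>x. wt (2 * CARD('n)) x * \<bar>f x\<bar> \<le> C"
  shows "integrable lborel f"
proof (rule Bochner_Integration.integrable_bound)
  show "integrable lborel (\<lambda>x::real^'n. C * (1 / wt (2 * CARD('n)) x))"
    by (intro integrable_mult_right integrable_inverse_wt)
  show "AE x in lborel. norm (f x) \<le> norm (C * (1 / wt (2 * CARD('n)) x))"
  proof (rule AE_I2)
    fix x
    have "\<bar>f x\<bar> \<le> C * (1 / wt (2 * CARD('n)) x)"
      using assms(2)[of x] by (simp add: field_simps)
    then show "norm (f x) \<le> norm (C * (1 / wt (2 * CARD('n)) x))"
      using abs_ge_self[of "C * (1 / wt (2 * CARD('n)) x)"] by (simp only: real_norm_def)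
  qed
qed simp

subsection \<open>Schwartz functions\<close>

lemma monomial_le_wt: "\<bar>monomial \<alpha> x\<bar> \<le> wt (mi_order \<alpha>) x"
proof -
  have "\<bar>monomial \<alpha> x\<bar> = (\<Prod>i\<in>UNIV. \<bar>x $ i\<bar> ^ \<alpha> i)"
    by (simp add: monomial_def abs_prod power_abs)
  also have "\<dots> \<le> (\<Prod>i\<in>UNIV. (1 + norm x) ^ \<alpha> i)"
    by (intro prod_mono conjI power_mono) (auto intro: order_trans[OF component_le_norm_cart])
  finally show ?thesis by (simp add: wt_def mi_order_def power_sum)
qed

text \<open>If M is the largest |x $ i|, then |x| \<le> d M, and M^m is one of the pure powers in
  the sum. The constant 1 takes care of points with M < 1.\<close>

lemma wt_le_monomials:
  "wt m (x::real^'n::finite) \<le> (1 + real CARD('n)) ^ m * (1 + (\<Sum>i\<in>UNIV. \<bar>monomial (\<lambda>j. if j = i then m else 0) x\<bar>))"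
proof -
  have mono: "monomial (\<lambda>j. if j = i then m else 0) x = (x $ i) ^ m" for i
    by (simp add: monomial_def if_distrib prod.delta cong: if_cong)
  define M where "M = Max (range (\<lambda>i. \<bar>x $ i\<bar>))"
  have M: "\<bar>x $ i\<bar> \<le> M" for i unfolding M_def by (intro Max_ge) auto
  have "M \<in> range (\<lambda>i. \<bar>x $ i\<bar>)" unfolding M_def by (intro Max_in) auto
  then obtain i0 where i0: "M = \<bar>x $ i0\<bar>" by blast
  have M0: "0 \<le> M" using i0 by simp
  have "norm x \<le> (\<Sum>i\<in>UNIV. \<bar>x $ i\<bar>)" by (rule norm_le_l1_cart)
  also have "\<dots> \<le> (\<Sum>i\<in>(UNIV::'n set). M)" by (intro sum_mono M)
  finally have "norm x \<le> real CARD('n) * M" by simp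
  also have "\<dots> \<le> real CARD('n) * max 1 M" by (simp add: mult_left_mono)
  finally have "1 + norm x \<le> (1 + real CARD('n)) * max 1 M" by (simp add: algebra_simps)
  then have "wt m x \<le> ((1 + real CARD('n)) * max 1 M) ^ m"
    unfolding wt_def by (intro power_mono) auto
  also have "\<dots> = (1 + real CARD('n)) ^ m * max 1 M ^ m" by (simp add: power_mult_distrib)
  also have "\<dots> \<le> (1 + real CARD('n)) ^ m * (1 + (\<Sum>i\<in>UNIV. \<bar>x $ i\<bar> ^ m))"
  proof (intro mult_left_mono)
    have "\<bar>x $ i0\<bar> ^ m \<le> (\<Sum>i\<in>UNIV. \<bar>x $ i\<bar> ^ m)"
      by (rule member_le_sum) auto
    moreover have "0 \<le> (\<Sum>i\<in>UNIV. \<bar>x $ i\<bar> ^ m)" by (auto intro: sum_nonneg)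
    ultimately show "max 1 M ^ m \<le> 1 + (\<Sum>i\<in>UNIV. \<bar>x $ i\<bar> ^ m)"
      using i0 by (auto simp: max_def)
  qed auto
  finally show ?thesis by (simp add: mono power_abs)
qed

text \<open>Weights and monomials dominate each other up to constants, and derivatives along lists
  are multi-index derivatives by symmetry. The right-hand side is the working form of the Schwartz
  class from here on.\<close>

lemma schwartz_iff:
  "f \<in> schwartz \<longleftrightarrow> smooth f \<and> (\<forall>js m. \<exists>C. \<forall>x. wt m x * \<bar>pd js f x\<bar> \<le> C)" (is "_ \<longleftrightarrow> ?R")
proof
  assume f: "f \<in> schwartz"
  then have s: "smooth f" by (simp add: schwartz_def)
  have "\<exists>C. \<forall>x. wt m x * \<bar>pd js f x\<bar> \<le> C" for m js
  proof -
    obtain \<beta> where \<beta>: "pd js f = mi_deriv \<beta> f" using pd_eq_mi_deriv[OF s] by metis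
    have "\<exists>B. \<forall>x. \<bar>monomial \<alpha> x * mi_deriv \<beta> f x\<bar> \<le> B" for \<alpha>
      using f unfolding schwartz_def bounded_iff by auto
    then obtain B where B: "\<And>\<alpha> x. \<bar>monomial \<alpha> x * mi_deriv \<beta> f x\<bar> \<le> B \<alpha>" by metis
    let ?a = "\<lambda>i j. if j = i then m else 0"
    have "wt m x * \<bar>pd js f x\<bar> \<le> (1 + real CARD('a)) ^ m * (B (\<lambda>_. 0) + (\<Sum>i\<in>UNIV. B (?a i)))" for x
    proof -
      have "wt m x * \<bar>pd js f x\<bar> \<le> (1 + real CARD('a)) ^ m * (1 + (\<Sum>i\<in>UNIV. \<bar>monomial (?a i) x\<bar>)) * \<bar>pd js f x\<bar>"
        by (intro mult_right_mono wt_le_monomials) auto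
      also have "\<dots> = (1 + real CARD('a)) ^ m * (\<bar>monomial (\<lambda>_. 0) x * mi_deriv \<beta> f x\<bar> +
          (\<Sum>i\<in>UNIV. \<bar>monomial (?a i) x * mi_deriv \<beta> f x\<bar>))"
        by (simp add: \<beta> abs_mult algebra_simps sum_distrib_left sum_distrib_right) (simp add: monomial_def)
      also have "\<dots> \<le> (1 + real CARD('a)) ^ m * (B (\<lambda>_. 0) + (\<Sum>i\<in>UNIV. B (?a i)))"
        by (intro mult_left_mono add_mono sum_mono B) auto
      finally show ?thesis .
    qed
    then show ?thesis by blast
  qed
  with s show ?R by blast
next
  assume R: ?R
  have "bounded (range (\<lambda>x. monomial \<alpha> x * mi_deriv \<beta> f x))" for \<alpha> \<beta>
  proof -
    obtain C where C: "\<And>x. wt (mi_order \<alpha>) x * \<bar>mi_deriv \<beta> f x\<bar> \<le> C"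
      using R unfolding mi_deriv_eq_pd by blast
    have "norm (monomial \<alpha> x * mi_deriv \<beta> f x) \<le> C" for x
      using mult_right_mono[OF monomial_le_wt[of \<alpha> x], of "\<bar>mi_deriv \<beta> f x\<bar>"] C[of x] by (simp add: abs_mult)
    then show ?thesis by (auto simp: bounded_iff)
  qed
  with R show "f \<in> schwartz" by (simp add: schwartz_def)
qed

lemma schwartz_smooth: "f \<in> schwartz \<Longrightarrow> smooth f" by (simp add: schwartz_iff)

lemma schwartz_bound:
  assumes "f \<in> schwartz" obtains C where "\<And>x. wt m x * \<bar>pd js f x\<bar> \<le> C" "C \<ge> 0"
proof -
  obtain C where "\<And>x. wt m x * \<bar>pd js f x\<bar> \<le> C" using assms unfolding schwartz_iff by blast
  moreover from this[of 0] have "C \<ge> 0" by (meson abs_ge_zero mult_nonneg_nonneg order_trans wt_pos(2))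
  ultimately show ?thesis using that by blast
qed

lemma schwartz_pd: assumes "f \<in> schwartz" shows "pd js f \<in> schwartz"
proof -
  have "\<exists>C. \<forall>x. wt m x * \<bar>pd ks (pd js f) x\<bar> \<le> C" for ks m
    using assms[unfolded schwartz_iff] by (metis foldr_append o_apply)
  then show ?thesis using smooth_pd assms by (auto simp: schwartz_iff)
qed

lemma schwartz_partial: "f \<in> schwartz \<Longrightarrow> partial i f \<in> schwartz"
  using schwartz_pd[of f "[i]"] by simp

lemma schwartz_add:
  assumes "f \<in> schwartz" "g \<in> schwartz" shows "(\<lambda>x. f x + g x) \<in> schwartz"
proof -
  note s = assms[THEN schwartz_smooth]
  have "\<exists>C. \<forall>x. wt m x * \<bar>pd js f x + pd js g x\<bar> \<le> C" for js m
  proof -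
    obtain C D where C: "\<And>x. wt m x * \<bar>pd js f x\<bar> \<le> C" and D: "\<And>x. wt m x * \<bar>pd js g x\<bar> \<le> D"
      using assms schwartz_bound by metis
    have "wt m x * \<bar>pd js f x + pd js g x\<bar> \<le> C + D" for x
      using mult_left_mono[OF abs_triangle_ineq, of "wt m x" "pd js f x" "pd js g x"] C[of x] D[of x]
      by (simp add: distrib_left)
    then show ?thesis by blast
  qed
  then show ?thesis using s by (simp add: schwartz_iff smooth_add pd_add)
qed

lemma schwartz_cmult:
  assumes "f \<in> schwartz" shows "(\<lambda>x. c * f x) \<in> schwartz"
proof -
  have "\<exists>C. \<forall>x. wt m x * \<bar>c * pd js f x\<bar> \<le> C" for js m
  proof -
    obtain C where C: "\<And>x. wt m x * \<bar>pd js f x\<bar> \<le> C" using assms schwartz_bound by metis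
    have "wt m x * \<bar>c * pd js f x\<bar> \<le> \<bar>c\<bar> * C" for x
      using mult_left_mono[OF C[of x], of "\<bar>c\<bar>"] by (simp add: abs_mult algebra_simps)
    then show ?thesis by blast
  qed
  then show ?thesis using assms schwartz_smooth by (auto simp add: schwartz_iff smooth_cmult pd_cmult)
qed

lemma schwartz_diff: "f \<in> schwartz \<Longrightarrow> g \<in> schwartz \<Longrightarrow> (\<lambda>x. f x - g x) \<in> schwartz"
  using schwartz_add[of f "\<lambda>x. (-1) * g x"] schwartz_cmult[of g "-1"] by simp

lemma schwartz_const_0: "(\<lambda>x. 0) \<in> schwartz"
  by (auto simp: schwartz_iff pd_const)

lemma schwartz_sum: "(\<And>i. i \<in> A \<Longrightarrow> f i \<in> schwartz) \<Longrightarrow> (\<lambda>x. \<Sum>i\<in>A. f i x) \<in> schwartz"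
  by (induction A rule: infinite_finite_induct) (auto intro: schwartz_add schwartz_const_0)

text \<open>The slowly increasing smooth functions, which multiply Schwartz functions into Schwartz
  functions. Monomials, the polynomial factors in the derivatives of the Gaussian and the logistic
  cutoffs are of this kind.\<close>

definition moderate :: "(real^'n::finite \<Rightarrow> real) \<Rightarrow> bool"
  where "moderate f \<longleftrightarrow> smooth f \<and> (\<forall>js. \<exists>m C. \<forall>x. \<bar>pd js f x\<bar> \<le> C * wt m x)"

lemma moderate_pd: assumes "moderate f" shows "moderate (pd js f)"
proof -
  have "\<exists>m C. \<forall>x. \<bar>pd ks (pd js f) x\<bar> \<le> C * wt m x" for ks
    using assms[unfolded moderate_def] by (metis foldr_append o_apply)
  then show ?thesis using smooth_pd assms by (auto simp: moderate_def)
qed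

lemma moderate_schwartz: assumes "f \<in> schwartz" shows "moderate f"
proof -
  have "\<exists>m C. \<forall>x. \<bar>pd js f x\<bar> \<le> C * wt m x" for js
  proof -
    obtain C where "\<And>x. wt 0 x * \<bar>pd js f x\<bar> \<le> C" using schwartz_bound[OF assms] by blast
    then have "\<forall>x. \<bar>pd js f x\<bar> \<le> C * wt 0 x" by simp
    then show ?thesis by blast
  qed
  then show ?thesis using assms by (simp add: moderate_def schwartz_smooth)
qed

lemma moderate_const: "moderate (\<lambda>x. c)"
proof -
  have "\<forall>x::real^'a. \<bar>pd js (\<lambda>x. c) x\<bar> \<le> \<bar>c\<bar> * wt 0 x" for js by (simp add: pd_const)
  then show ?thesis unfolding moderate_def using smooth_const by blast
qed

lemma moderate_component: "moderate (\<lambda>x. x $ j)"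
proof -
  have "\<exists>m C. \<forall>x::real^'a. \<bar>pd js (\<lambda>x. x $ j) x\<bar> \<le> C * wt m x" for js
  proof (cases js rule: rev_cases)
    case Nil
    have "\<bar>x $ j\<bar> \<le> 1 * wt 1 x" for x :: "real^'a"
      using component_le_norm_cart[of x j] by (simp add: wt_def)
    with Nil show ?thesis by (metis foldr.simps(1) id_apply)
  next
    case (snoc ks k)
    have "\<forall>x::real^'a. \<bar>pd js (\<lambda>x. x $ j) x\<bar> \<le> 1 * wt 0 x" using snoc by (simp add: partial_component pd_const)
    then show ?thesis by blast
  qed
  then show ?thesis unfolding moderate_def using smooth_component by blast
qed

text \<open>Each use of the product rule doubles the number of terms, whence the power of 2. The two
  factors carry separate weights u and v, so that growth of one (u = 1 / \<open>wt m\<close>) can be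
  paid for by decay of the other.\<close>

lemma pd_mult_bound:
  assumes "smooth f" "smooth g"
    and "\<And>as x. length as \<le> length js \<Longrightarrow> u x * \<bar>pd as f x\<bar> \<le> A"
    and "\<And>bs x. length bs \<le> length js \<Longrightarrow> v x * \<bar>pd bs g x\<bar> \<le> B"
    and "\<And>x. 0 \<le> u x" "\<And>x. 0 \<le> v x" "0 \<le> A"
  shows "u x * v x * \<bar>pd js (\<lambda>x. f x * g x) x\<bar> \<le> 2 ^ length js * (A * B)"
  using assms
proof (induction js arbitrary: f g rule: rev_induct)
  case Nil
  from Nil(3)[of "[]" x] Nil(4)[of "[]" x] have "(u x * \<bar>f x\<bar>) * (v x * \<bar>g x\<bar>) \<le> A * B"
    using Nil by (intro mult_mono) auto
  then show ?case by (simp add: abs_mult algebra_simps)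
next
  case (snoc i js)
  have pf: "u x * \<bar>pd as (partial i f) x\<bar> \<le> A" if "length as \<le> length js" for as x
    using snoc.prems(3)[of "as @ [i]" x] that by simp
  have pg: "v x * \<bar>pd as (partial i g) x\<bar> \<le> B" if "length as \<le> length js" for as x
    using snoc.prems(4)[of "as @ [i]" x] that by simp
  have "u x * v x * \<bar>pd js (\<lambda>x. partial i f x * g x) x\<bar> \<le> 2 ^ length js * (A * B)"
    by (rule snoc.IH) (use snoc.prems pf in \<open>auto intro: smooth_partial\<close>)
  moreover have "u x * v x * \<bar>pd js (\<lambda>x. f x * partial i g x) x\<bar> \<le> 2 ^ length js * (A * B)"
    by (rule snoc.IH) (use snoc.prems pg in \<open>auto intro: smooth_partial\<close>)
  moreover have "u x * v x * \<bar>pd (js @ [i]) (\<lambda>x. f x * g x) x\<bar> \<le>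
      u x * v x * (\<bar>pd js (\<lambda>x. partial i f x * g x) x\<bar> + \<bar>pd js (\<lambda>x. f x * partial i g x) x\<bar>)"
    unfolding pd_mult_snoc[OF snoc.prems(1,2)]
    by (intro mult_left_mono abs_triangle_ineq mult_nonneg_nonneg snoc.prems)
  ultimately show ?case by (simp add: distrib_left)
qed

text \<open>There are only finitely many lists of length at most k over a finite type, so constants
  found list by list merge into one.\<close>

lemma bounds_upto:
  fixes h :: "'n::finite list \<Rightarrow> 'x \<Rightarrow> real"
  assumes "\<And>js. \<exists>C. \<forall>x. h js x \<le> C"
  shows "\<exists>C\<ge>0. \<forall>js x. length js \<le> k \<longrightarrow> h js x \<le> C"
proof -
  obtain C where C: "\<And>js x. h js x \<le> C js" using assms by metis
  have fin: "finite {js::'n list. length js \<le> k}"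
    using finite_lists_length_le[of "UNIV::'n set" k] by simp
  have "h js x \<le> (\<Sum>js\<in>{js. length js \<le> k}. \<bar>C js\<bar>)" if "length js \<le> k" for js x
    using C[of js x] member_le_sum[of js "{js. length js \<le> k}" "\<lambda>js. \<bar>C js\<bar>"] fin that by force
  then show ?thesis by (intro exI[of _ "\<Sum>js\<in>{js. length js \<le> k}. \<bar>C js\<bar>"]) (auto intro: sum_nonneg)
qed

lemma schwartz_bound_upto:
  assumes "f \<in> schwartz" obtains C where "C \<ge> 0" "\<And>js x. length js \<le> k \<Longrightarrow> wt m x * \<bar>pd js f x\<bar> \<le> C"
  using bounds_upto[where h="\<lambda>js x. wt m x * \<bar>pd js f x\<bar>" and k=k] assms unfolding schwartz_iff by metis

lemma moderate_bound_upto: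
  assumes "moderate f"
  obtains m C where "C \<ge> 0" "\<And>js x. length js \<le> k \<Longrightarrow> (1 / wt m x) * \<bar>pd js f x\<bar> \<le> C"
proof -
  obtain m C where mC: "\<And>js x. \<bar>pd js f x\<bar> \<le> C js * wt (m js) x" using assms unfolding moderate_def by metis
  have fin: "finite {js::'a list. length js \<le> k}"
    using finite_lists_length_le[of "UNIV::'a set" k] by simp
  define M where "M = (\<Sum>js\<in>{js. length js \<le> k}. m js)"
  have "(1 / wt M x) * \<bar>pd js f x\<bar> \<le> (\<Sum>js\<in>{js. length js \<le> k}. \<bar>C js\<bar>)" if "length js \<le> k" for js x
  proof -
    have "m js \<le> M" unfolding M_def using fin that by (intro member_le_sum) auto
    then have "\<bar>C js\<bar> * wt (m js) x \<le> \<bar>C js\<bar> * wt M x" by (intro mult_left_mono wt_mono) auto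
    moreover have "C js * wt (m js) x \<le> \<bar>C js\<bar> * wt (m js) x" by (intro mult_right_mono) auto
    ultimately have "\<bar>pd js f x\<bar> \<le> \<bar>C js\<bar> * wt M x" using mC[of js x] by linarith
    then have "(1 / wt M x) * \<bar>pd js f x\<bar> \<le> \<bar>C js\<bar>" by (simp add: field_simps)
    also have "\<dots> \<le> (\<Sum>js\<in>{js. length js \<le> k}. \<bar>C js\<bar>)" using fin that by (intro member_le_sum) auto
    finally show ?thesis .
  qed
  then show ?thesis by (intro that[of "\<Sum>js\<in>{js. length js \<le> k}. \<bar>C js\<bar>" M]) (auto intro: sum_nonneg)
qed

lemma moderate_mult:
  assumes "moderate f" "moderate g" shows "moderate (\<lambda>x. f x * g x)"
proof -
  have s: "smooth f" "smooth g" using assms by (auto simp: moderate_def)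
  have "\<exists>m C. \<forall>x. \<bar>pd js (\<lambda>x. f x * g x) x\<bar> \<le> C * wt m x" for js
  proof -
    obtain m C where 1: "C \<ge> 0" "\<And>as x. length as \<le> length js \<Longrightarrow> (1 / wt m x) * \<bar>pd as f x\<bar> \<le> C"
      using moderate_bound_upto[OF assms(1)] by metis
    obtain k D where 2: "D \<ge> 0" "\<And>as x. length as \<le> length js \<Longrightarrow> (1 / wt k x) * \<bar>pd as g x\<bar> \<le> D"
      using moderate_bound_upto[OF assms(2)] by metis
    have "(1 / wt m x) * (1 / wt k x) * \<bar>pd js (\<lambda>x. f x * g x) x\<bar> \<le> 2 ^ length js * (C * D)" for x
      by (rule pd_mult_bound[OF s 1(2) 2(2) _ _ 1(1)]) auto
    then have "\<bar>pd js (\<lambda>x. f x * g x) x\<bar> \<le> (2 ^ length js * (C * D)) * wt (m + k) x" for x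
      by (simp add: wt_add field_simps)
    then show ?thesis by blast
  qed
  then show ?thesis using s by (simp add: moderate_def smooth_mult)
qed

lemma moderate_monomial: "moderate (monomial \<alpha>)"
proof -
  have p: "moderate (\<lambda>x. f x ^ n)" if "moderate f" for f :: "real^'a \<Rightarrow> real" and n
    by (induction n) (auto intro: moderate_const moderate_mult that)
  have "moderate (\<lambda>x. \<Prod>i\<in>A. (x $ i) ^ \<alpha> i)" for A
    by (induction A rule: infinite_finite_induct) (auto intro!: moderate_const moderate_mult p moderate_component)
  then show ?thesis unfolding monomial_def[abs_def] .
qed

text \<open>Taking the weight \<open>m + n\<close> on g leaves weight n after the growth
  \<open>wt m\<close> of f has been cancelled.\<close>

lemma schwartz_mult_moderate:
  assumes "moderate f" "g \<in> schwartz" shows "(\<lambda>x. f x * g x) \<in> schwartz"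
proof -
  have s: "smooth f" "smooth g" using assms by (auto simp: moderate_def schwartz_smooth)
  have "\<exists>C. \<forall>x. wt n x * \<bar>pd js (\<lambda>x. f x * g x) x\<bar> \<le> C" for js n
  proof -
    obtain m C where 1: "C \<ge> 0" "\<And>as x. length as \<le> length js \<Longrightarrow> (1 / wt m x) * \<bar>pd as f x\<bar> \<le> C"
      using moderate_bound_upto[OF assms(1)] by metis
    obtain D where 2: "D \<ge> 0" "\<And>as x. length as \<le> length js \<Longrightarrow> wt (m + n) x * \<bar>pd as g x\<bar> \<le> D"
      using schwartz_bound_upto[OF assms(2)] by metis
    have b: "(1 / wt m x) * wt (m + n) x * \<bar>pd js (\<lambda>x. f x * g x) x\<bar> \<le> 2 ^ length js * (C * D)" for x
      by (rule pd_mult_bound[OF s 1(2) 2(2) _ _ 1(1)]) auto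
    have w: "(1 / wt m x) * wt (m + n) x = wt n x" for x
      using less_imp_neq[OF wt_pos(1)[of m x]] by (simp add: wt_add)
    have "wt n x * \<bar>pd js (\<lambda>x. f x * g x) x\<bar> \<le> 2 ^ length js * (C * D)" for x
      using b[of x] unfolding w .
    then show ?thesis by blast
  qed
  then show ?thesis using s by (simp add: schwartz_iff smooth_mult)
qed

lemma schwartz_mult: "f \<in> schwartz \<Longrightarrow> g \<in> schwartz \<Longrightarrow> (\<lambda>x. f x * g x) \<in> schwartz"
  by (intro schwartz_mult_moderate moderate_schwartz)

lemma schwartz_integrable:
  assumes "f \<in> schwartz" shows "integrable lborel f"
proof -
  obtain C where "\<And>x. wt (2 * CARD('a)) x * \<bar>f x\<bar> \<le> C"
    using schwartz_bound[OF assms, of "2 * CARD('a)" "[]"] by auto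
  then show ?thesis using schwartz_smooth[OF assms]
    by (intro integrable_wt_bound) (auto intro: smooth_measurable)
qed

subsection \<open>Differentiation under the integral sign\<close>

text \<open>Dominated convergence for the remainder divided by |h|. The derivative bound, being
  uniform in x, makes each \<open>f \<omega>\<close> Lipschitz with constant
  \<open>W \<omega>\<close>, so the quotient is at most 2 W.\<close>

lemma has_derivative_integral:
  fixes f :: "'w \<Rightarrow> 'a::euclidean_space \<Rightarrow> real"
  assumes int: "\<And>x. integrable M (\<lambda>\<omega>. f \<omega> x)"
    and der: "\<And>\<omega> x. \<omega> \<in> space M \<Longrightarrow> (f \<omega> has_derivative f' \<omega> x) (at x)"
    and meas: "\<And>h. (\<lambda>\<omega>. f' \<omega> x0 h) \<in> borel_measurable M"
    and bound: "\<And>\<omega> x h. \<omega> \<in> space M \<Longrightarrow> \<bar>f' \<omega> x h\<bar> \<le> W \<omega> * norm h"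
    and W: "integrable M W"
  shows "((\<lambda>x. \<integral>\<omega>. f \<omega> x \<partial>M) has_derivative (\<lambda>h. \<integral>\<omega>. f' \<omega> x0 h \<partial>M)) (at x0)"
proof -
  have lin: "bounded_linear (f' \<omega> x)" if "\<omega> \<in> space M" for \<omega> x
    using der[OF that] by (rule has_derivative_bounded_linear)
  have int': "integrable M (\<lambda>\<omega>. f' \<omega> x0 h)" for h
  proof (rule Bochner_Integration.integrable_bound[OF integrable_mult_left[OF W, of "norm h"] meas], rule AE_I2)
    fix \<omega> assume "\<omega> \<in> space M"
    then show "norm (f' \<omega> x0 h) \<le> norm (W \<omega> * norm h)"
      using bound[of \<omega> x0 h] abs_ge_self[of "W \<omega> * norm h"] by simp
  qed
  have bl: "bounded_linear (\<lambda>h. \<integral>\<omega>. f' \<omega> x0 h \<partial>M)"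
  proof (rule bounded_linear_intro)
    fix h k and r :: real
    have "(\<integral>\<omega>. f' \<omega> x0 (h + k) \<partial>M) = (\<integral>\<omega>. f' \<omega> x0 h + f' \<omega> x0 k \<partial>M)"
      by (intro Bochner_Integration.integral_cong refl) (use lin in \<open>simp add: linear_simps(1)\<close>)
    then show "(\<integral>\<omega>. f' \<omega> x0 (h + k) \<partial>M) = (\<integral>\<omega>. f' \<omega> x0 h \<partial>M) + (\<integral>\<omega>. f' \<omega> x0 k \<partial>M)"
      by (simp add: int')
    have "(\<integral>\<omega>. f' \<omega> x0 (r *\<^sub>R h) \<partial>M) = (\<integral>\<omega>. r * f' \<omega> x0 h \<partial>M)"
      by (intro Bochner_Integration.integral_cong refl) (use lin in \<open>simp add: linear_simps(5)\<close>)
    then show "(\<integral>\<omega>. f' \<omega> x0 (r *\<^sub>R h) \<partial>M) = r *\<^sub>R (\<integral>\<omega>. f' \<omega> x0 h \<partial>M)" by simp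
    have "norm (\<integral>\<omega>. f' \<omega> x0 h \<partial>M) \<le> (\<integral>\<omega>. norm (f' \<omega> x0 h) \<partial>M)" by (rule integral_norm_bound)
    also have "\<dots> \<le> (\<integral>\<omega>. W \<omega> * norm h \<partial>M)"
      by (intro integral_mono integrable_norm int' integrable_mult_left W) (use bound in simp)
    finally show "norm (\<integral>\<omega>. f' \<omega> x0 h \<partial>M) \<le> norm h * (\<integral>\<omega>. W \<omega> \<partial>M)" by (simp add: mult.commute)
  qed
  have lip: "\<bar>f \<omega> x - f \<omega> y\<bar> \<le> W \<omega> * norm (x - y)" if "\<omega> \<in> space M" for \<omega> x y
  proof -
    have "onorm (f' \<omega> z) \<le> W \<omega>" for z by (rule onorm_le) (use bound[OF that] in simp)
    then show ?thesis
      using differentiable_bound[of UNIV "f \<omega>" "f' \<omega>" "W \<omega>" x y] der[OF that] by simp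
  qed
  define R where "R h \<omega> = norm (f \<omega> (x0 + h) - f \<omega> x0 - f' \<omega> x0 h) / norm h" for h \<omega>
  have "(\<lambda>h. norm ((\<integral>\<omega>. f \<omega> (x0 + h) \<partial>M) - (\<integral>\<omega>. f \<omega> x0 \<partial>M) - (\<integral>\<omega>. f' \<omega> x0 h \<partial>M)) / norm h) \<midarrow>0\<rightarrow> 0"
    unfolding tendsto_at_iff_sequentially
  proof (intro allI impI)
    fix X :: "nat \<Rightarrow> 'a" assume X: "\<forall>i. X i \<in> UNIV - {0}" "X \<longlonglongrightarrow> 0"
    have intR: "integrable M (R h)" for h
      unfolding R_def by (intro integrable_divide integrable_norm Bochner_Integration.integrable_diff int int')
    have lim: "(\<lambda>i. \<integral>\<omega>. R (X i) \<omega> \<partial>M) \<longlonglongrightarrow> (\<integral>\<omega>. 0 \<partial>M)"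
    proof (rule integral_dominated_convergence[where w="\<lambda>\<omega>. 2 * W \<omega>"])
      show "AE \<omega> in M. (\<lambda>i. R (X i) \<omega>) \<longlonglongrightarrow> 0"
      proof (rule AE_I2)
        fix \<omega> assume \<omega>: "\<omega> \<in> space M"
        have "(\<lambda>h. R h \<omega>) \<midarrow>0\<rightarrow> 0"
          using der[OF \<omega>, of x0] unfolding has_derivative_at R_def by blast
        then show "(\<lambda>i. R (X i) \<omega>) \<longlonglongrightarrow> 0"
          unfolding tendsto_at_iff_sequentially using X by (simp add: o_def)
      qed
      show "AE \<omega> in M. norm (R (X i) \<omega>) \<le> 2 * W \<omega>" for i
      proof (rule AE_I2)
        fix \<omega> assume \<omega>: "\<omega> \<in> space M"
        have "norm (f \<omega> (x0 + X i) - f \<omega> x0 - f' \<omega> x0 (X i)) \<le> 2 * W \<omega> * norm (X i)"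
          using lip[OF \<omega>, of "x0 + X i" x0] bound[OF \<omega>, of x0 "X i"] by simp
        moreover have "norm (X i) > 0" using X by simp
        ultimately show "norm (R (X i) \<omega>) \<le> 2 * W \<omega>" by (simp add: R_def field_simps)
      qed
    qed (use W intR in auto)
    have le: "norm ((\<integral>\<omega>. f \<omega> (x0 + h) \<partial>M) - (\<integral>\<omega>. f \<omega> x0 \<partial>M) - (\<integral>\<omega>. f' \<omega> x0 h \<partial>M)) / norm h \<le> (\<integral>\<omega>. R h \<omega> \<partial>M)" for h
    proof -
      have "(\<integral>\<omega>. f \<omega> (x0 + h) \<partial>M) - (\<integral>\<omega>. f \<omega> x0 \<partial>M) - (\<integral>\<omega>. f' \<omega> x0 h \<partial>M) = (\<integral>\<omega>. f \<omega> (x0 + h) - f \<omega> x0 - f' \<omega> x0 h \<partial>M)"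
        by (simp add: int int')
      moreover have "norm (\<integral>\<omega>. f \<omega> (x0 + h) - f \<omega> x0 - f' \<omega> x0 h \<partial>M) \<le> (\<integral>\<omega>. norm (f \<omega> (x0 + h) - f \<omega> x0 - f' \<omega> x0 h) \<partial>M)"
        by (rule integral_norm_bound)
      ultimately show ?thesis unfolding R_def by (simp add: divide_right_mono)
    qed
    from lim[simplified] show "((\<lambda>h. norm ((\<integral>\<omega>. f \<omega> (x0 + h) \<partial>M) - (\<integral>\<omega>. f \<omega> x0 \<partial>M) - (\<integral>\<omega>. f' \<omega> x0 h \<partial>M)) / norm h) \<circ> X) \<longlonglongrightarrow> 0"
      unfolding o_def
    proof (rule tendsto_sandwich[rotated 3])
      show "\<forall>\<^sub>F i in sequentially. norm ((\<integral>\<omega>. f \<omega> (x0 + X i) \<partial>M) - (\<integral>\<omega>. f \<omega> x0 \<partial>M) - (\<integral>\<omega>. f' \<omega> x0 (X i) \<partial>M)) / norm (X i) \<le> (\<integral>\<omega>. R (X i) \<omega> \<partial>M)"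
        by (rule always_eventually) (rule allI, rule le)
    qed auto
  qed
  with bl show ?thesis unfolding has_derivative_at by blast
qed

lemma abs_sum_component_le:
  fixes h :: "real^'n::finite"
  assumes "\<And>i. \<bar>c i\<bar> \<le> B"
  shows "\<bar>\<Sum>i\<in>UNIV. h $ i * c i\<bar> \<le> (real CARD('n) * B) * norm h"
proof -
  have "\<bar>\<Sum>i\<in>UNIV. h $ i * c i\<bar> \<le> (\<Sum>i\<in>UNIV. \<bar>h $ i * c i\<bar>)" by (rule sum_abs)
  also have "\<dots> \<le> (\<Sum>i\<in>(UNIV::'n set). norm h * B)"
    unfolding abs_mult by (intro sum_mono mult_mono component_le_norm_cart assms) auto
  finally show ?thesis by (simp add: mult_ac)
qed

lemma smooth_integral_step:
  fixes f :: "'w \<Rightarrow> real^'n::finite \<Rightarrow> real"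
  assumes s: "\<And>\<omega>. \<omega> \<in> space M \<Longrightarrow> smooth (f \<omega>)"
    and m: "\<And>js x. (\<lambda>\<omega>. pd js (f \<omega>) x) \<in> borel_measurable M"
    and b: "\<And>js. \<exists>W. integrable M W \<and> (\<forall>\<omega>\<in>space M. \<forall>x. \<bar>pd js (f \<omega>) x\<bar> \<le> W \<omega>)"
  shows "((\<lambda>x. \<integral>\<omega>. f \<omega> x \<partial>M) has_derivative (\<lambda>h. \<Sum>i\<in>UNIV. h $ i * (\<integral>\<omega>. partial i (f \<omega>) x \<partial>M))) (at x)"
proof -
  obtain W where W: "\<And>js. integrable M (W js)" "\<And>js \<omega> x. \<omega> \<in> space M \<Longrightarrow> \<bar>pd js (f \<omega>) x\<bar> \<le> W js \<omega>"
    using b by metis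
  have ip: "integrable M (\<lambda>\<omega>. pd js (f \<omega>) x)" for js x
    by (rule Bochner_Integration.integrable_bound[OF W(1)[of js] m])
       (use W(2)[of _ js x] in \<open>force intro!: AE_I2\<close>)
  have "((\<lambda>x. \<integral>\<omega>. f \<omega> x \<partial>M) has_derivative (\<lambda>h. \<integral>\<omega>. (\<Sum>i\<in>UNIV. h $ i * partial i (f \<omega>) x) \<partial>M)) (at x)"
  proof (rule has_derivative_integral[where W="\<lambda>\<omega>. real CARD('n) * (\<Sum>i\<in>UNIV. W [i] \<omega>)"])
    show "integrable M (\<lambda>\<omega>. f \<omega> x)" for x using ip[of "[]"] by simp
    show "(f \<omega> has_derivative (\<lambda>h. \<Sum>i\<in>UNIV. h $ i * partial i (f \<omega>) x)) (at x)" if "\<omega> \<in> space M" for \<omega> x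
      by (intro smooth_has_derivative s that)
    show "(\<lambda>\<omega>. \<Sum>i\<in>UNIV. h $ i * partial i (f \<omega>) x) \<in> borel_measurable M" for h
      using m[of "[_]"] by (intro borel_measurable_sum borel_measurable_times) auto
    show "integrable M (\<lambda>\<omega>. real CARD('n) * (\<Sum>i\<in>UNIV. W [i] \<omega>))"
      by (intro integrable_mult_right Bochner_Integration.integrable_sum W)
    fix \<omega> x and h :: "real^'n" assume \<omega>: "\<omega> \<in> space M"
    have "\<bar>partial i (f \<omega>) x\<bar> \<le> (\<Sum>i\<in>UNIV. W [i] \<omega>)" for i
    proof -
      have "\<bar>partial i (f \<omega>) x\<bar> \<le> W [i] \<omega>" using W(2)[OF \<omega>, of "[i]" x] by simp
      also have "\<dots> \<le> (\<Sum>i\<in>UNIV. W [i] \<omega>)"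
        using W(2)[OF \<omega>, of "[_]" x] by (intro member_le_sum) (auto intro: order_trans[OF abs_ge_zero])
      finally show ?thesis .
    qed
    then show "\<bar>\<Sum>i\<in>UNIV. h $ i * partial i (f \<omega>) x\<bar> \<le> real CARD('n) * (\<Sum>i\<in>UNIV. W [i] \<omega>) * norm h"
      by (rule abs_sum_component_le)
  qed
  moreover have "(\<integral>\<omega>. (\<Sum>i\<in>UNIV. h $ i * partial i (f \<omega>) x) \<partial>M) = (\<Sum>i\<in>UNIV. h $ i * (\<integral>\<omega>. partial i (f \<omega>) x \<partial>M))" for h
    using ip[of "[_]" x] by (simp add: Bochner_Integration.integral_sum)
  ultimately show ?thesis by simp
qed

lemma
  fixes f :: "'w \<Rightarrow> real^'n::finite \<Rightarrow> real"
  assumes s: "\<And>\<omega>. \<omega> \<in> space M \<Longrightarrow> smooth (f \<omega>)"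
    and m: "\<And>js x. (\<lambda>\<omega>. pd js (f \<omega>) x) \<in> borel_measurable M"
    and b: "\<And>js. \<exists>W. integrable M W \<and> (\<forall>\<omega>\<in>space M. \<forall>x. \<bar>pd js (f \<omega>) x\<bar> \<le> W \<omega>)"
  shows smooth_integral: "smooth (\<lambda>x. \<integral>\<omega>. f \<omega> x \<partial>M)"
    and pd_integral: "pd js (\<lambda>x. \<integral>\<omega>. f \<omega> x \<partial>M) = (\<lambda>x. \<integral>\<omega>. pd js (f \<omega>) x \<partial>M)"
proof -
  have step: "((\<lambda>x. \<integral>\<omega>. pd js (f \<omega>) x \<partial>M) has_derivative
      (\<lambda>h. \<Sum>i\<in>UNIV. h $ i * (\<integral>\<omega>. partial i (pd js (f \<omega>)) x \<partial>M))) (at x)" for js x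
  proof (rule smooth_integral_step)
    show "(\<lambda>\<omega>. pd ks (pd js (f \<omega>)) x) \<in> borel_measurable M" for ks x
      using m[of "ks @ js"] by simp
    show "\<exists>W. integrable M W \<and> (\<forall>\<omega>\<in>space M. \<forall>x. \<bar>pd ks (pd js (f \<omega>)) x\<bar> \<le> W \<omega>)" for ks
      using b[of "ks @ js"] by simp
  qed (auto intro: smooth_pd s)
  have eq: "pd js (\<lambda>x. \<integral>\<omega>. f \<omega> x \<partial>M) = (\<lambda>x. \<integral>\<omega>. pd js (f \<omega>) x \<partial>M)" for js
  proof (induction js)
    case (Cons j js)
    have "partial j (\<lambda>x. \<integral>\<omega>. pd js (f \<omega>) x \<partial>M) x = (\<integral>\<omega>. partial j (pd js (f \<omega>)) x \<partial>M)" for x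
      by (subst partialI[OF step]) (simp add: axis_def if_distrib if_distribR sum.delta cong: if_cong)
    with Cons show ?case by simp
  qed simp
  show "smooth (\<lambda>x. \<integral>\<omega>. f \<omega> x \<partial>M)"
    unfolding smooth_def eq differentiable_on_def
    using step by (auto simp: differentiable_def intro: has_derivative_at_withinI)
  show "pd js (\<lambda>x. \<integral>\<omega>. f \<omega> x \<partial>M) = (\<lambda>x. \<integral>\<omega>. pd js (f \<omega>) x \<partial>M)" by (rule eq)
qed

subsection \<open>Integration by parts\<close>

lemma lborel_integral_translate:
  fixes f :: "'a::euclidean_space \<Rightarrow> real"
  assumes [measurable]: "f \<in> borel_measurable borel"
  shows "(LBINT x. f (x + c)) = (LBINT x. f x)"
proof -
  have "(LBINT x. f x) = (\<integral>x. f x \<partial>distr lborel borel ((+) c))" by (simp only: lborel_distr_plus)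
  also have "\<dots> = (LBINT x. f (c + x))" by (rule integral_distr) auto
  finally show ?thesis by (simp add: add.commute)
qed

lemma lborel_integrable_translate:
  fixes f :: "'a::euclidean_space \<Rightarrow> real"
  assumes [measurable]: "f \<in> borel_measurable borel"
  shows "integrable lborel (\<lambda>x. f (x + c)) \<longleftrightarrow> integrable lborel f"
proof -
  have "integrable lborel f \<longleftrightarrow> integrable (distr lborel borel ((+) c)) f" by (simp only: lborel_distr_plus)
  also have "\<dots> \<longleftrightarrow> integrable lborel (\<lambda>x. f (c + x))" by (rule integrable_distr_eq) auto
  finally show ?thesis by (simp add: add.commute)
qed

text \<open>
  The integral of the translate \<open>f (x + s e\<^sub>i)\<close> does not depend on \<open>s\<close>; differentiate at \<open>s = 0\<close>.
  Substituting \<open>s = sin \<theta>\<close> keeps the translations bounded, so that the decay of the derivative of \<open>f\<close>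
  gives a dominating function for all \<open>\<theta>\<close>.
\<close>

lemma integral_partial_eq_0:
  fixes f :: "real^'n::finite \<Rightarrow> real"
  assumes f: "smooth f"
    and b0: "\<And>x. wt (2 * CARD('n)) x * \<bar>f x\<bar> \<le> C"
    and b1: "\<And>x. wt (2 * CARD('n)) x * \<bar>partial i f x\<bar> \<le> C"
  shows "(LBINT x. partial i f x) = 0"
proof -
  let ?e = "axis i 1 :: real^'n" and ?N = "2 * CARD('n)"
  have [measurable]: "f \<in> borel_measurable borel" "partial i f \<in> borel_measurable borel"
    using f by (auto intro: smooth_measurable smooth_partial)
  have int: "integrable lborel f" by (rule integrable_wt_bound[OF _ b0]) simp
  have b1': "\<bar>partial i f (x + sin \<theta> *\<^sub>R ?e)\<bar> \<le> (C * 2 ^ ?N) * (1 / wt ?N x)" for x \<theta>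
  proof -
    let ?p = "\<bar>partial i f (x + sin \<theta> *\<^sub>R ?e)\<bar>"
    have C: "0 \<le> C" using b1[of 0] by (meson abs_ge_zero mult_nonneg_nonneg order_trans wt_pos(2))
    have "wt ?N (sin \<theta> *\<^sub>R ?e) \<le> wt ?N ?e" by (intro wt_scale) simp
    then have w: "wt ?N (sin \<theta> *\<^sub>R ?e) \<le> 2 ^ ?N" by (simp add: wt_def norm_axis_1)
    have "wt ?N x * ?p \<le> wt ?N (x + sin \<theta> *\<^sub>R ?e) * wt ?N (sin \<theta> *\<^sub>R ?e) * ?p"
      by (intro mult_right_mono wt_shift) auto
    also have "\<dots> = (wt ?N (x + sin \<theta> *\<^sub>R ?e) * ?p) * wt ?N (sin \<theta> *\<^sub>R ?e)" by simp
    also have "\<dots> \<le> C * 2 ^ ?N" by (intro mult_mono b1 w C) auto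
    finally show ?thesis by (simp add: field_simps)
  qed
  have der: "((\<lambda>\<theta>. f (x + sin \<theta> *\<^sub>R ?e)) has_derivative (\<lambda>h. h * (cos \<theta> * partial i f (x + sin \<theta> *\<^sub>R ?e)))) (at \<theta>)" for x \<theta>
  proof -
    have "((\<lambda>s. f (x + s *\<^sub>R ?e)) has_real_derivative partial i f (x + sin \<theta> *\<^sub>R ?e)) (at (sin \<theta>))"
      by (intro partial_line smooth_differentiable f)
    from DERIV_chain2[OF this DERIV_sin] show ?thesis
      by (simp add: has_field_derivative_def mult_ac mult_commute_abs)
  qed
  have "((\<lambda>\<theta>. LBINT x. f (x + sin \<theta> *\<^sub>R ?e)) has_derivative
      (\<lambda>h. LBINT x. h * (cos 0 * partial i f (x + sin 0 *\<^sub>R ?e)))) (at 0)"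
  proof (rule has_derivative_integral[where W="\<lambda>x. (C * 2 ^ ?N) * (1 / wt ?N x)"
        and f'="\<lambda>x \<theta> h. h * (cos \<theta> * partial i f (x + sin \<theta> *\<^sub>R ?e))"])
    show "integrable lborel (\<lambda>x. f (x + sin \<theta> *\<^sub>R ?e))" for \<theta>
      using int by (subst lborel_integrable_translate) auto
    show "integrable lborel (\<lambda>x::real^'n. (C * 2 ^ ?N) * (1 / wt ?N x))"
      by (intro integrable_mult_right integrable_inverse_wt)
    fix x \<theta> and h :: real
    have "\<bar>h * (cos \<theta> * partial i f (x + sin \<theta> *\<^sub>R ?e))\<bar> = \<bar>h\<bar> * (\<bar>cos \<theta>\<bar> * \<bar>partial i f (x + sin \<theta> *\<^sub>R ?e)\<bar>)"
      by (simp add: abs_mult)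
    also have "\<dots> \<le> \<bar>h\<bar> * (1 * ((C * 2 ^ ?N) * (1 / wt ?N x)))"
      by (intro mult_left_mono mult_mono b1') auto
    finally show "\<bar>h * (cos \<theta> * partial i f (x + sin \<theta> *\<^sub>R ?e))\<bar> \<le> (C * 2 ^ ?N) * (1 / wt ?N x) * norm h"
      by (simp add: mult_ac)
  qed (auto intro: der)
  then have "((\<lambda>\<theta>::real. LBINT x. f x) has_derivative (\<lambda>h. h * (LBINT x. partial i f x))) (at 0)"
    by (simp add: lborel_integral_translate)
  moreover have "((\<lambda>\<theta>::real. LBINT x. f x) has_derivative (\<lambda>h. 0)) (at 0)" by simp
  ultimately have "(\<lambda>h. h * (LBINT x. partial i f x)) = (\<lambda>h. 0)"
    by (rule has_derivative_unique)
  from fun_cong[OF this, of 1] show ?thesis by simp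
qed

text \<open>The total derivative of f g integrates to 0. All decay comes from g, while f is only
  bounded with bounded derivative; f may thus be a shifted and rescaled function and g the Gaussian
  density, or g a test function.\<close>

lemma integral_by_parts:
  fixes f g :: "real^'n::finite \<Rightarrow> real"
  assumes f: "smooth f" "\<And>x. \<bar>f x\<bar> \<le> A" "\<And>x. \<bar>partial i f x\<bar> \<le> A" and g: "g \<in> schwartz"
  shows "(LBINT x. f x * partial i g x) = - (LBINT x. partial i f x * g x)"
proof -
  let ?N = "2 * CARD('n)"
  have A: "A \<ge> 0" using f(2)[of 0] by simp
  have sg: "smooth g" "smooth (partial i g)" using g by (auto intro: schwartz_smooth smooth_partial)
  obtain B where B: "B \<ge> 0" "\<And>js x. length js \<le> 1 \<Longrightarrow> wt ?N x * \<bar>pd js g x\<bar> \<le> B"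
    using schwartz_bound_upto[OF g, of 1 ?N] by metis
  note B0 = B(2)[of "[]", simplified] and B1 = B(2)[of "[i]", simplified]
  have p: "wt ?N x * \<bar>u * v\<bar> \<le> A * B" if "\<bar>u\<bar> \<le> A" "wt ?N x * \<bar>v\<bar> \<le> B" for u v and x :: "real^'n"
    using mult_mono[OF that A] by (simp add: abs_mult mult_ac)
  have [measurable]: "f \<in> borel_measurable borel" "partial i f \<in> borel_measurable borel"
      "g \<in> borel_measurable borel" "partial i g \<in> borel_measurable borel"
    using f sg by (auto intro: smooth_measurable smooth_partial)
  have d: "partial i (\<lambda>x. f x * g x) x = partial i f x * g x + f x * partial i g x" for x
    by (intro partial_mult smooth_differentiable f sg)
  have i1: "integrable lborel (\<lambda>x. f x * partial i g x)"
    by (rule integrable_wt_bound[where C="A * B"]) (auto intro!: p f B1)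
  have i2: "integrable lborel (\<lambda>x. partial i f x * g x)"
    by (rule integrable_wt_bound[where C="A * B"]) (auto intro!: p f B0)
  have "(LBINT x. partial i (\<lambda>x. f x * g x) x) = 0"
  proof (rule integral_partial_eq_0[where C="2 * (A * B)"])
    show "smooth (\<lambda>x. f x * g x)" by (intro smooth_mult f sg)
    show "wt ?N x * \<bar>f x * g x\<bar> \<le> 2 * (A * B)" for x
      using p[OF f(2) B0, of x] A B(1) by (smt (verit) mult_nonneg_nonneg)
    show "wt ?N x * \<bar>partial i (\<lambda>x. f x * g x) x\<bar> \<le> 2 * (A * B)" for x
      unfolding d using p[OF f(2) B1, of x x] p[OF f(3) B0, of x x]
        mult_left_mono[OF abs_triangle_ineq, of "wt ?N x" "partial i f x * g x" "f x * partial i g x"]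
      by (simp add: distrib_left)
  qed
  then show ?thesis unfolding d using i1 i2 by simp
qed

subsection \<open>The Gaussian\<close>

definition gauss :: "real^'n::finite \<Rightarrow> real"
  where "gauss x = exp (- (x \<bullet> x) / 2)"

lemma gauss_pos [simp]: "0 < gauss x" "0 \<le> gauss x" by (simp_all add: gauss_def)

lemma gauss_has_derivative: "(gauss has_derivative (\<lambda>h. - (x \<bullet> h) * gauss x)) (at x)"
  unfolding gauss_def[abs_def] by (auto intro!: derivative_eq_intros simp: inner_commute)

lemma partial_gauss: "partial i gauss = (\<lambda>x. - (x $ i) * gauss x)"
  by (rule ext, subst partialI[OF gauss_has_derivative]) (simp add: inner_axis)

lemma pow_exp_le: "0 \<le> s \<Longrightarrow> s ^ m * exp (- s) \<le> fact m" for s :: real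
proof -
  assume s: "0 \<le> s"
  have "s ^ m /\<^sub>R fact m \<le> (\<Sum>n. s ^ n /\<^sub>R fact n)"
    using sum_le_suminf[OF summable_exp_generic[of s], of "{m}"] s by auto
  then have "s ^ m \<le> fact m * exp s" by (simp add: exp_def field_simps)
  then show ?thesis by (simp add: exp_minus field_simps)
qed

text \<open>(|x| - 1)^2 \<ge> 0 gives -|x|^2 / 2 \<le> 3/2 - (1 + |x|), the source of
  \<open>exp (3/2)\<close>. A single term of the exponential series then beats the power of 1 +
  |x|.\<close>

lemma wt_gauss: "wt m x * gauss x \<le> exp (3/2) * fact m"
proof -
  have "0 \<le> (norm x - 1)^2" by simp
  then have "- (x \<bullet> x) / 2 \<le> 3/2 - (1 + norm x)"
    unfolding power2_diff by (simp add: power2_norm_eq_inner)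
  then have "gauss x \<le> exp (3/2) * exp (- (1 + norm x))"
    unfolding gauss_def exp_add[symmetric] by simp
  then have "wt m x * gauss x \<le> wt m x * (exp (3/2) * exp (- (1 + norm x)))"
    by (intro mult_left_mono) auto
  also have "\<dots> \<le> exp (3/2) * fact m"
    using mult_left_mono[OF pow_exp_le[of "1 + norm x" m], of "exp (3/2)"] by (simp add: wt_def mult_ac)
  finally show ?thesis .
qed

lemma gauss_schwartz: "gauss \<in> schwartz"
proof -
  \<comment> \<open>The factors p are, up to sign, products of Hermite polynomials. Recording only
    their moderate growth replaces the explicit formula by an induction with p' = partial i p - x_i
    p.\<close>
  have ex: "\<exists>p. moderate p \<and> pd js gauss = (\<lambda>x. p x * gauss x)" for js :: "'a list"
  proof (induction js)
    case Nil
    show ?case by (intro exI[of _ "\<lambda>x. 1"]) (auto simp: moderate_const)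
  next
    case (Cons i js)
    then obtain p where p: "moderate p" "pd js gauss = (\<lambda>x. p x * gauss x)" by blast
    let ?q = "\<lambda>x. partial i p x + (- 1) * (x $ i * p x)"
    have add: "moderate (\<lambda>x. f x + g x)" if fg: "moderate f" "moderate g" for f g :: "real^'a \<Rightarrow> real"
    proof -
      have "\<exists>m C. \<forall>x. \<bar>pd js f x + pd js g x\<bar> \<le> C * wt m x" for js
      proof -
        obtain m C where 1: "C \<ge> 0" "\<And>as x. length as \<le> length js \<Longrightarrow> (1 / wt m x) * \<bar>pd as f x\<bar> \<le> C"
          using moderate_bound_upto[OF fg(1)] by metis
        obtain k D where 2: "D \<ge> 0" "\<And>as x. length as \<le> length js \<Longrightarrow> (1 / wt k x) * \<bar>pd as g x\<bar> \<le> D"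
          using moderate_bound_upto[OF fg(2)] by metis
        have "\<bar>pd js f x + pd js g x\<bar> \<le> (C + D) * wt (m + k) x" for x
        proof -
          have "\<bar>pd js f x\<bar> \<le> C * wt m x" "\<bar>pd js g x\<bar> \<le> D * wt k x"
            using 1(2)[of js x] 2(2)[of js x] by (auto simp: field_simps)
          moreover have "C * wt m x \<le> C * wt (m + k) x" "D * wt k x \<le> D * wt (m + k) x"
            by (auto intro!: mult_left_mono wt_mono 1 2)
          ultimately show ?thesis by (simp add: distrib_right)
        qed
        then show ?thesis by blast
      qed
      then show ?thesis using fg by (simp add: moderate_def smooth_add pd_add)
    qed
    have "moderate ?q"
      by (intro add moderate_mult moderate_const moderate_component p moderate_pd[of p "[i]", simplified])
    moreover have "partial i (\<lambda>x. p x * gauss x) x = ?q x * gauss x" for x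
    proof -
      have "p differentiable (at x)" "gauss differentiable (at x)"
        using p(1) gauss_has_derivative by (auto simp: moderate_def smooth_differentiable intro: differentiableI)
      then show ?thesis by (subst partial_mult) (auto simp: partial_gauss algebra_simps)
    qed
    ultimately show ?case using p(2) by (intro exI[of _ ?q]) auto
  qed
  have "smooth (gauss :: real^'a \<Rightarrow> real)"
    unfolding smooth_def
  proof
    fix js :: "'a list"
    obtain p where p: "moderate p" "pd js gauss = (\<lambda>x. p x * gauss x)" using ex by blast
    then show "pd js gauss differentiable_on UNIV"
      by (auto simp: moderate_def intro!: differentiable_at_imp_differentiable_on
          differentiable_mult[OF smooth_differentiable] differentiableI[OF gauss_has_derivative])
  qed
  moreover have "\<exists>C. \<forall>x. wt m x * \<bar>pd js gauss x\<bar> \<le> C" for js :: "'a list" and m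
  proof -
    obtain p where p: "moderate p" "pd js gauss = (\<lambda>x. p x * gauss x)" using ex by blast
    obtain k C where C: "\<And>x. \<bar>p x\<bar> \<le> C * wt k x"
      using p(1) unfolding moderate_def by (metis foldr.simps(1) id_apply)
    have C0: "0 \<le> C" using C[of 0] by (simp add: wt_def)
    have "wt m x * \<bar>pd js gauss x\<bar> \<le> C * (exp (3/2) * fact (m + k))" for x
    proof -
      have "wt m x * \<bar>pd js gauss x\<bar> = wt m x * \<bar>p x\<bar> * gauss x" by (simp add: p abs_mult)
      also have "\<dots> \<le> wt m x * (C * wt k x) * gauss x" by (intro mult_right_mono mult_left_mono C) auto
      also have "\<dots> = C * (wt (m + k) x * gauss x)" by (simp add: wt_add)
      also have "\<dots> \<le> C * (exp (3/2) * fact (m + k))" by (intro mult_left_mono wt_gauss C0)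
      finally show ?thesis .
    qed
    then show ?thesis by blast
  qed
  ultimately show ?thesis by (simp add: schwartz_iff)
qed

lemma gauss_measurable [measurable]: "gauss \<in> borel_measurable borel"
  by (rule smooth_measurable[OF schwartz_smooth[OF gauss_schwartz]])

lemma integrable_wt_gauss: "integrable lborel (\<lambda>y::real^'n::finite. wt m y * gauss y)"
proof (rule integrable_wt_bound)
  show "wt (2 * CARD('n)) x * \<bar>wt m x * gauss x\<bar> \<le> exp (3/2) * fact (2 * CARD('n) + m)" for x :: "real^'n"
    using wt_gauss[of "2 * CARD('n) + m" x] by (simp add: wt_add abs_mult)
qed simp

text \<open>A vanishing integral would make a positive function zero almost everywhere. The
  normalising constant stays abstract, since positivity is all that dividing by it requires.\<close>

lemma integral_gauss_pos: "0 < (LBINT x. gauss (x::real^'n::finite))"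
proof -
  have i: "integrable lborel (gauss :: real^'n \<Rightarrow> real)" using integrable_wt_gauss[of 0] by simp
  have "(LBINT x. gauss (x::real^'n)) \<noteq> 0"
  proof
    assume "(LBINT x. gauss (x::real^'n)) = 0"
    then have "AE x in lborel. gauss (x::real^'n) = 0"
      using integral_nonneg_eq_0_iff_AE[OF i] by simp
    then have "AE x in (lborel :: (real^'n) measure). False" by eventually_elim (simp add: less_imp_neq[symmetric])
    then show False by (simp add: AE_iff_null null_sets_def emeasure_lborel_UNIV)
  qed
  moreover have "0 \<le> (LBINT x. gauss (x::real^'n))" by (intro Bochner_Integration.integral_nonneg) simp
  ultimately show ?thesis by linarith
qed

subsection \<open>Integrals over products\<close>

lemma
  fixes a :: "'a::euclidean_space \<Rightarrow> real" and b :: "'b::euclidean_space \<Rightarrow> real"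
  assumes a: "integrable lborel a" and b: "integrable lborel b"
  shows integrable_lborel_prod_mult: "integrable lborel (\<lambda>z. a (fst z) * b (snd z))"
    and integral_lborel_prod_mult: "(LBINT z. a (fst z) * b (snd z)) = (LBINT x. a x) * (LBINT y. b y)"
proof -
  have m: "a \<in> borel_measurable borel" "b \<in> borel_measurable borel"
    using a b by (auto dest: borel_measurable_integrable)
  have i: "integrable (lborel \<Otimes>\<^sub>M lborel) (\<lambda>z. a (fst z) * b (snd z))"
  proof (rule lborel_pair.Fubini_integrable)
    show "(\<lambda>z. a (fst z) * b (snd z)) \<in> borel_measurable (lborel \<Otimes>\<^sub>M lborel)"
      using m by measurable
    show "integrable lborel (\<lambda>x. LBINT y. norm (a (fst (x, y)) * b (snd (x, y))))"
      using a by (simp add: abs_mult integrable_abs)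
    show "AE x in lborel. integrable lborel (\<lambda>y. a (fst (x, y)) * b (snd (x, y)))"
      using b by simp
  qed
  then show "integrable lborel (\<lambda>z. a (fst z) * b (snd z))" by (simp add: lborel_prod)
  show "(LBINT z. a (fst z) * b (snd z)) = (LBINT x. a x) * (LBINT y. b y)"
    using lborel_pair.integral_fst'[OF i] by (simp add: lborel_prod)
qed

lemma integral_lborel_pair:
  fixes f :: "'a::euclidean_space \<times> 'b::euclidean_space \<Rightarrow> real"
  assumes "integrable lborel f"
  shows "(LBINT z. f z) = (LBINT x. (LBINT y. f (x, y)))"
  using lborel_pair.integral_fst'[of f] assms by (simp add: lborel_prod)

text \<open>Time profiles of the kernels in rescaled time: a = 0 is the uniform average, a = -1/2
  the singularity created by one derivative, and a = -3/4 what remains integrable after trading some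
  of the exponential weight.\<close>

definition rho :: "real \<Rightarrow> real \<Rightarrow> real"
  where "rho a s = indicator {0<..1} s * s powr a"

lemma rho_measurable [measurable]: "rho a \<in> borel_measurable borel"
  unfolding rho_def[abs_def] by measurable

lemma rho_nonneg [simp]: "0 \<le> rho a s" by (simp add: rho_def)

lemma
  assumes "a > -1"
  shows integrable_rho: "integrable lborel (rho a)" and integral_rho: "(LBINT s. rho a s) = 1 / (a + 1)"
proof -
  have "((\<lambda>s. s powr a) has_integral 1 / (a + 1)) {0..1}"
    using has_integral_powr_from_0[OF assms, of 1] by simp
  then have "((\<lambda>s. if s \<in> {0..1} then s powr a else 0) has_integral 1 / (a + 1)) UNIV"
    by (subst has_integral_restrict_UNIV)
  also have "(\<lambda>s. if s \<in> {0..1} then s powr a else 0) = rho a"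
    by (auto simp: rho_def fun_eq_iff indicator_def)
  finally have n: "(\<integral>\<^sup>+s. rho a s \<partial>lborel) = ennreal (1 / (a + 1))"
    by (intro nn_integral_has_integral_lborel) auto
  then show "integrable lborel (rho a)" by (intro integrableI_bounded) auto
  show "(LBINT s. rho a s) = 1 / (a + 1)"
    using n assms by (intro integral_eq_nn_integral[THEN trans]) auto
qed

subsection \<open>Regular space-time functions\<close>

text \<open>
  Functions on \<open>[0, T]\<close> are extended to all real times by clamping, so that continuity and
  measurability in time never refer to a domain.
\<close>

definition clamp_time :: "real \<Rightarrow> real \<Rightarrow> real"
  where "clamp_time T t = max 0 (min T t)"

lemma clamp_time_id [simp]: "t \<in> {0..T} \<Longrightarrow> clamp_time T t = t" by (simp add: clamp_time_def)

lemma clamp_time_mem: "0 \<le> T \<Longrightarrow> clamp_time T t \<in> {0..T}" by (simp add: clamp_time_def)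

lemma continuous_clamp_time [continuous_intros]:
  "continuous_on S f \<Longrightarrow> continuous_on S (\<lambda>x. clamp_time T (f x))"
  unfolding clamp_time_def by (intro continuous_intros)

text \<open>Bounded continuous curves in the Schwartz space, encoded pointwise: every derivative is
  jointly continuous and every weighted bound is uniform in time. Continuity in the weighted
  seminorms is recovered in \<open>reg_uniformly_continuous\<close>.\<close>

definition reg :: "(real \<Rightarrow> real^'n::finite \<Rightarrow> real) \<Rightarrow> bool"
  where "reg F \<longleftrightarrow> (\<forall>t. smooth (F t)) \<and>
    (\<forall>js. continuous_on UNIV (\<lambda>p. pd js (F (fst p)) (snd p))) \<and>
    (\<forall>js m. \<exists>C. \<forall>t x. wt m x * \<bar>pd js (F t) x\<bar> \<le> C)"

lemma reg_smooth: "reg F \<Longrightarrow> smooth (F t)" by (simp add: reg_def)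

lemma reg_continuous: "reg F \<Longrightarrow> continuous_on UNIV (\<lambda>p. pd js (F (fst p)) (snd p))"
  by (simp add: reg_def)

lemma reg_bound:
  assumes "reg F" obtains C where "C \<ge> 0" "\<And>t x. wt m x * \<bar>pd js (F t) x\<bar> \<le> C"
proof -
  obtain C where C: "\<And>t x. wt m x * \<bar>pd js (F t) x\<bar> \<le> C" using assms unfolding reg_def by blast
  have "0 \<le> C" using C[of 0] by (meson abs_ge_zero mult_nonneg_nonneg order_trans wt_pos(2))
  with C show ?thesis using that by blast
qed

lemma reg_bound_upto:
  assumes "reg F" obtains C where "C \<ge> 0" "\<And>js t x. length js \<le> k \<Longrightarrow> wt m x * \<bar>pd js (F t) x\<bar> \<le> C"
proof -
  have "\<exists>C\<ge>0. \<forall>js p. length js \<le> k \<longrightarrow> wt m (snd p) * \<bar>pd js (F (fst p)) (snd p)\<bar> \<le> C"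
    by (rule bounds_upto) (use assms in \<open>auto simp: reg_def\<close>)
  then show ?thesis using that by auto
qed

lemma reg_schwartz: "reg F \<Longrightarrow> F t \<in> schwartz"
  unfolding reg_def schwartz_iff by blast

lemma reg_const:
  assumes "f \<in> schwartz" shows "reg (\<lambda>t. f)"
  using assms unfolding reg_def schwartz_iff
  by (auto intro!: continuous_on_compose2[OF smooth_continuous[OF smooth_pd] continuous_on_snd[OF continuous_on_id]])

lemma reg_pd:
  assumes "reg F" shows "reg (\<lambda>t. pd js (F t))"
  using assms smooth_pd unfolding reg_def foldr_append[symmetric, THEN fun_cong, simplified o_def]
  by (metis (no_types, lifting) foldr_append o_apply ext)

lemma reg_partial: "reg F \<Longrightarrow> reg (\<lambda>t. partial i (F t))"
  using reg_pd[of F "[i]"] by simp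

lemma reg_add:
  assumes "reg F" "reg G" shows "reg (\<lambda>t x. F t x + G t x)"
proof -
  have e: "pd js (\<lambda>x. F t x + G t x) = (\<lambda>x. pd js (F t) x + pd js (G t) x)" for js t
    by (intro pd_add reg_smooth assms)
  have "\<exists>C. \<forall>t x. wt m x * \<bar>pd js (F t) x + pd js (G t) x\<bar> \<le> C" for js m
  proof -
    obtain C where C: "\<And>t x. wt m x * \<bar>pd js (F t) x\<bar> \<le> C" using reg_bound[OF assms(1)] by metis
    obtain D where D: "\<And>t x. wt m x * \<bar>pd js (G t) x\<bar> \<le> D" using reg_bound[OF assms(2)] by metis
    have "wt m x * \<bar>pd js (F t) x + pd js (G t) x\<bar> \<le> C + D" for t x
      using mult_left_mono[OF abs_triangle_ineq, of "wt m x" "pd js (F t) x" "pd js (G t) x"] C[of x t] D[of x t]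
      by (simp add: distrib_left)
    then show ?thesis by blast
  qed
  then show ?thesis using assms unfolding reg_def e
    by (auto intro!: smooth_add continuous_on_add)
qed

lemma reg_mult:
  assumes "reg F" "reg G" shows "reg (\<lambda>t x. F t x * G t x)"
proof -
  have c: "continuous_on UNIV (\<lambda>p. pd js (\<lambda>x. F (fst p) x * G (fst p) x) (snd p))"
    if "reg F" "reg G" for js and F G :: "real \<Rightarrow> real^'a \<Rightarrow> real"
    using that
  proof (induction js arbitrary: F G rule: rev_induct)
    case Nil
    then show ?case using reg_continuous[of F "[]"] reg_continuous[of G "[]"] by (auto intro: continuous_on_mult)
  next
    case (snoc i js)
    have "pd (js @ [i]) (\<lambda>x. F t x * G t x) =
      (\<lambda>x. pd js (\<lambda>x. partial i (F t) x * G t x) x + pd js (\<lambda>x. F t x * partial i (G t) x) x)" for t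
      by (intro pd_mult_snoc reg_smooth snoc)
    then show ?case
      using snoc.IH[OF reg_partial[OF snoc.prems(1), of i] snoc.prems(2)]
        snoc.IH[OF snoc.prems(1) reg_partial[OF snoc.prems(2), of i]]
      by (simp only:) (rule continuous_on_add)
  qed
  have "\<exists>C. \<forall>t x. wt m x * \<bar>pd js (\<lambda>x. F t x * G t x) x\<bar> \<le> C" for js m
  proof -
    obtain C where C: "C \<ge> 0" "\<And>as t x. length as \<le> length js \<Longrightarrow> wt m x * \<bar>pd as (F t) x\<bar> \<le> C"
      using reg_bound_upto[OF assms(1)] by metis
    obtain D where D: "D \<ge> 0" "\<And>as t x. length as \<le> length js \<Longrightarrow> wt 0 x * \<bar>pd as (G t) x\<bar> \<le> D"
      using reg_bound_upto[OF assms(2)] by metis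
    have "wt m x * wt 0 x * \<bar>pd js (\<lambda>x. F t x * G t x) x\<bar> \<le> 2 ^ length js * (C * D)" for t x
      by (rule pd_mult_bound[OF reg_smooth[OF assms(1)] reg_smooth[OF assms(2)] C(2) D(2) _ _ C(1)]) auto
    then show ?thesis by auto
  qed
  then show ?thesis using c[OF assms] assms unfolding reg_def by (auto intro: smooth_mult)
qed

lemma reg_time_mult:
  assumes "reg F" and c: "continuous_on UNIV c" "\<And>t. \<bar>c t\<bar> \<le> B"
  shows "reg (\<lambda>t x. c t * F t x)"
proof -
  have e: "pd js (\<lambda>x. c t * F t x) = (\<lambda>x. c t * pd js (F t) x)" for js t
    by (intro pd_cmult reg_smooth assms)
  have "\<exists>C. \<forall>t x. wt m x * \<bar>c t * pd js (F t) x\<bar> \<le> C" for js m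
  proof -
    obtain C where C: "C \<ge> 0" "\<And>t x. wt m x * \<bar>pd js (F t) x\<bar> \<le> C" using reg_bound[OF assms(1)] by metis
    have "wt m x * \<bar>c t * pd js (F t) x\<bar> \<le> B * C" for t x
      using mult_mono[OF c(2)[of t] C(2)[of x t]] C(1) order_trans[OF abs_ge_zero c(2)]
      by (simp add: abs_mult algebra_simps)
    then show ?thesis by blast
  qed
  moreover have "continuous_on UNIV (\<lambda>p. c (fst p) * pd js (F (fst p)) (snd p))" for js
    by (intro continuous_on_mult reg_continuous assms continuous_on_compose2[OF c(1)] continuous_intros) auto
  ultimately show ?thesis using assms unfolding reg_def e
    by (auto intro!: smooth_cmult)
qed

lemma reg_cmult: "reg F \<Longrightarrow> reg (\<lambda>t x. c * F t x)"
  by (rule reg_time_mult[where B="\<bar>c\<bar>"]) auto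

lemma reg_diff: "reg F \<Longrightarrow> reg G \<Longrightarrow> reg (\<lambda>t x. F t x - G t x)"
  using reg_add[of F "\<lambda>t x. (-1) * G t x"] reg_cmult[of G "-1"] by simp

lemma reg_sum: "(\<And>i. i \<in> A \<Longrightarrow> reg (F i)) \<Longrightarrow> reg (\<lambda>t x. \<Sum>i\<in>A. F i t x)"
  by (induction A rule: infinite_finite_induct) (auto intro: reg_add reg_const schwartz_const_0)

subsection \<open>Parabolic integral operators\<close>

lemma
  fst_borel_measurable [measurable]: "(fst :: 'a::euclidean_space \<times> 'b::euclidean_space \<Rightarrow> 'a) \<in> borel_measurable borel" and
  snd_borel_measurable [measurable]: "(snd :: 'a::euclidean_space \<times> 'b::euclidean_space \<Rightarrow> 'b) \<in> borel_measurable borel"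
  by (auto intro!: borel_measurable_continuous_onI continuous_intros)

definition kernel :: "(real \<times> (real^'n::finite) \<Rightarrow> real) \<Rightarrow> bool"
  where "kernel \<kappa> \<longleftrightarrow> \<kappa> \<in> borel_measurable borel \<and> (\<forall>z. \<kappa> z \<noteq> 0 \<longrightarrow> 0 < fst z \<and> fst z \<le> 1) \<and>
    (\<forall>m. integrable lborel (\<lambda>z. \<kappa> z * wt m (snd z)))"

text \<open>In z = (\<sigma>, y) the first component is elapsed time as a fraction of t, the second
  a displacement in units of the square root of elapsed time. After this rescaling t and x occur
  only in the argument of F and the kernel is fixed, so continuity and derivatives pass to F by
  dominated convergence.\<close>

definition kop :: "real \<Rightarrow> (real \<times> (real^'n::finite) \<Rightarrow> real) \<Rightarrow> (real \<Rightarrow> real^'n \<Rightarrow> real) \<Rightarrow> real \<Rightarrow> real^'n \<Rightarrow> real"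
  where "kop T \<kappa> F t x = (LBINT z. \<kappa> z * F (clamp_time T t * (1 - fst z)) (x + sqrt (clamp_time T t * fst z) *\<^sub>R snd z))"

lemma kernel_integrable: "kernel \<kappa> \<Longrightarrow> integrable lborel \<kappa>"
  unfolding kernel_def by (metis (no_types, lifting) Bochner_Integration.integrable_cong mult.right_neutral wt_0)

lemma kernelD:
  assumes "kernel \<kappa>"
  shows "\<kappa> \<in> borel_measurable borel" "\<And>z. \<kappa> z \<noteq> 0 \<Longrightarrow> 0 < fst z" "\<And>z. \<kappa> z \<noteq> 0 \<Longrightarrow> fst z \<le> 1"
    "\<And>m. integrable lborel (\<lambda>z. \<kappa> z * wt m (snd z))"
  using assms unfolding kernel_def by blast+

lemma continuous_shift:
  fixes F :: "real \<Rightarrow> real^'n::finite \<Rightarrow> real"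
  assumes "continuous_on UNIV (\<lambda>p. F (fst p) (snd p))"
  shows "continuous_on UNIV (\<lambda>q. F (clamp_time T (fst (fst q)) * (1 - fst (snd q)))
    (snd (fst q) + sqrt (clamp_time T (fst (fst q)) * fst (snd q)) *\<^sub>R snd (snd q)))"
proof -
  have "continuous_on UNIV (\<lambda>q. (clamp_time T (fst (fst q)) * (1 - fst (snd q)),
    (snd (fst q) :: real^'n) + sqrt (clamp_time T (fst (fst q)) * fst (snd q)) *\<^sub>R snd (snd q)))"
    by (intro continuous_intros)
  from continuous_on_compose2[OF assms this] show ?thesis by simp
qed

lemma shift_measurable:
  fixes F :: "real \<Rightarrow> real^'n::finite \<Rightarrow> real"
  assumes "continuous_on UNIV (\<lambda>p. F (fst p) (snd p))"
  shows "(\<lambda>z. F (clamp_time T t * (1 - fst z)) (x + sqrt (clamp_time T t * fst z) *\<^sub>R snd z)) \<in> borel_measurable borel"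
proof -
  have "continuous_on UNIV (\<lambda>z :: real \<times> (real^'n). ((t, x), z))" by (intro continuous_intros)
  from continuous_on_compose2[OF continuous_shift[OF assms, of T] this] show ?thesis
    by (intro borel_measurable_continuous_onI) simp
qed

lemma kop_integrable:
  assumes k: "kernel \<kappa>" and c: "continuous_on UNIV (\<lambda>p. F (fst p) (snd p))" and b: "\<And>t x. \<bar>F t x\<bar> \<le> B"
  shows "integrable lborel (\<lambda>z. \<kappa> z * F (clamp_time T t * (1 - fst z)) (x + sqrt (clamp_time T t * fst z) *\<^sub>R snd z))"
proof (rule Bochner_Integration.integrable_bound[OF integrable_mult_left[OF integrable_abs[OF kernel_integrable[OF k]], of B]])
  show "(\<lambda>z. \<kappa> z * F (clamp_time T t * (1 - fst z)) (x + sqrt (clamp_time T t * fst z) *\<^sub>R snd z)) \<in> borel_measurable lborel"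
    using k shift_measurable[OF c] by (auto simp: kernel_def)
qed (auto intro!: AE_I2 mult_left_mono simp: abs_mult intro: order_trans[OF b abs_ge_self])

lemma kop_continuous:
  fixes F :: "real \<Rightarrow> real^'n::finite \<Rightarrow> real"
  assumes k: "kernel \<kappa>" and c: "continuous_on UNIV (\<lambda>p. F (fst p) (snd p))" and b: "\<And>t x. \<bar>F t x\<bar> \<le> B"
  shows "continuous_on UNIV (\<lambda>p. kop T \<kappa> F (fst p) (snd p))"
proof (rule continuous_on_sequentiallyI)
  fix u :: "nat \<Rightarrow> real \<times> (real^'n)" and a assume u: "u \<longlonglongrightarrow> a"
  let ?f = "\<lambda>p z. \<kappa> z * F (clamp_time T (fst p) * (1 - fst z)) (snd p + sqrt (clamp_time T (fst p) * fst z) *\<^sub>R snd z)"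
  show "(\<lambda>n. kop T \<kappa> F (fst (u n)) (snd (u n))) \<longlonglongrightarrow> kop T \<kappa> F (fst a) (snd a)"
    unfolding kop_def
  proof (rule integral_dominated_convergence[where w="\<lambda>z. \<bar>\<kappa> z\<bar> * B"])
    show "integrable lborel (\<lambda>z. \<bar>\<kappa> z\<bar> * B)"
      by (intro integrable_mult_left integrable_abs kernel_integrable k)
    show "AE z in lborel. (\<lambda>n. ?f (u n) z) \<longlonglongrightarrow> ?f a z"
    proof (intro AE_I2 tendsto_mult_left)
      fix z
      have "continuous_on UNIV (\<lambda>p. F (clamp_time T (fst p) * (1 - fst z)) (snd p + sqrt (clamp_time T (fst p) * fst z) *\<^sub>R snd z))"
        using continuous_on_compose2[OF continuous_shift[OF c, of T], OF continuous_on_Pair[OF continuous_on_id continuous_on_const]]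
        by simp
      then show "(\<lambda>n. F (clamp_time T (fst (u n)) * (1 - fst z)) (snd (u n) + sqrt (clamp_time T (fst (u n)) * fst z) *\<^sub>R snd z))
          \<longlonglongrightarrow> F (clamp_time T (fst a) * (1 - fst z)) (snd a + sqrt (clamp_time T (fst a) * fst z) *\<^sub>R snd z)"
        using u by (rule continuous_on_tendsto_compose) auto
    qed
    show "AE z in lborel. norm (?f (u n) z) \<le> \<bar>\<kappa> z\<bar> * B" for n
      by (auto intro!: AE_I2 mult_left_mono b simp: abs_mult)
  qed (use k shift_measurable[OF c] in \<open>auto simp: kernel_def\<close>)
qed

text \<open>At time t (1 - \<sigma>) the weight exp (l s) equals exp (l t) exp (-l t \<sigma>); the
  second factor stays in the integral and is the source of the gain for large l. Since T \<le> 1,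
  the displacement is at most |y|, so \<open>wt_shift\<close> costs no more than \<open>wt m\<close>
  of y.\<close>

lemma kop_bound:
  assumes k: "kernel \<kappa>" and c: "continuous_on UNIV (\<lambda>p. F (fst p) (snd p))" and T: "0 < T" "T \<le> 1"
    and b: "\<And>s x. s \<in> {0..T} \<Longrightarrow> wt m x * \<bar>F s x\<bar> \<le> M * exp (l * s)" and M: "0 \<le> M" and l: "0 \<le> l"
    and t: "t \<in> {0..T}"
  shows "wt m x * \<bar>kop T \<kappa> F t x\<bar> \<le> M * exp (l * t) * (LBINT z. wt m (snd z) * \<bar>\<kappa> z\<bar> * exp (- l * t * fst z))"
    and "integrable lborel (\<lambda>z. wt m (snd z) * \<bar>\<kappa> z\<bar> * exp (- l * t * fst z))"
proof -
  let ?f = "\<lambda>z. \<kappa> z * F (t * (1 - fst z)) (x + sqrt (t * fst z) *\<^sub>R snd z)"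
  let ?g = "\<lambda>z. wt m (snd z) * \<bar>\<kappa> z\<bar> * exp (- l * t * fst z)"
  have [measurable]: "\<kappa> \<in> borel_measurable borel" using k by (simp add: kernel_def)
  have ig: "integrable lborel (\<lambda>z. \<bar>\<kappa> z * wt m (snd z)\<bar>)"
    using k unfolding kernel_def by (intro integrable_abs) blast
  show i: "integrable lborel ?g"
  proof (rule Bochner_Integration.integrable_bound[OF ig])
    show "AE z in lborel. norm (?g z) \<le> norm \<bar>\<kappa> z * wt m (snd z)\<bar>"
    proof (rule AE_I2)
      fix z
      show "norm (?g z) \<le> norm \<bar>\<kappa> z * wt m (snd z)\<bar>"
      proof (cases "\<kappa> z = 0")
        case False
        then have "0 < fst z" using kernelD(2)[OF k] by blast
        then have "exp (- l * t * fst z) \<le> 1" using l t by simp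
        then have "\<bar>\<kappa> z\<bar> * wt m (snd z) * exp (- l * t * fst z) \<le> \<bar>\<kappa> z\<bar> * wt m (snd z) * 1"
          by (intro mult_left_mono) auto
        then show ?thesis by (simp add: abs_mult mult_ac)
      qed simp
    qed
  qed measurable
  have p: "\<bar>?f z\<bar> \<le> M * exp (l * t) / wt m x * ?g z" for z
  proof (cases "\<kappa> z = 0")
    case False
    then have z: "0 < fst z" "fst z \<le> 1" using kernelD(2,3)[OF k] by blast+
    let ?s = "t * (1 - fst z)" and ?w = "sqrt (t * fst z) *\<^sub>R snd z"
    have s: "?s \<in> {0..T}" using z t by (auto intro: order_trans[OF mult_left_le])
    have "t * fst z \<le> 1" using z t T mult_mono[of t 1 "fst z" 1] by auto
    then have "\<bar>sqrt (t * fst z)\<bar> \<le> 1" using z t by simp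
    then have w: "wt m ?w \<le> wt m (snd z)" by (rule wt_scale)
    have "wt m x * \<bar>F ?s (x + ?w)\<bar> \<le> wt m (x + ?w) * wt m ?w * \<bar>F ?s (x + ?w)\<bar>"
      by (intro mult_right_mono wt_shift) auto
    also have "\<dots> = (wt m (x + ?w) * \<bar>F ?s (x + ?w)\<bar>) * wt m ?w" by simp
    also have "\<dots> \<le> (M * exp (l * ?s)) * wt m (snd z)"
      by (intro mult_mono b s w) (use M in auto)
    also have "exp (l * ?s) = exp (l * t) * exp (- l * t * fst z)"
      by (simp add: exp_add[symmetric] algebra_simps)
    finally have "wt m x * \<bar>F ?s (x + ?w)\<bar> * \<bar>\<kappa> z\<bar> \<le> (M * (exp (l * t) * exp (- l * t * fst z))) * wt m (snd z) * \<bar>\<kappa> z\<bar>"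
      by (intro mult_right_mono) auto
    then show ?thesis by (simp add: abs_mult field_simps)
  qed simp
  have "\<bar>kop T \<kappa> F t x\<bar> \<le> (LBINT z. M * exp (l * t) / wt m x * ?g z)"
  proof -
    have ig: "integrable lborel (\<lambda>z. M * exp (l * t) / wt m x * ?g z)" using i by (rule integrable_mult_right)
    have i_f: "integrable lborel ?f"
    proof (rule Bochner_Integration.integrable_bound[OF ig])
      show "?f \<in> borel_measurable lborel" using shift_measurable[OF c, of T t x] t by simp
      show "AE z in lborel. norm (?f z) \<le> norm (M * exp (l * t) / wt m x * ?g z)"
        using order_trans[OF p abs_ge_self] by (intro AE_I2) (simp only: real_norm_def)
    qed
    have "norm (LBINT z. ?f z) \<le> (LBINT z. M * exp (l * t) / wt m x * ?g z)"
      by (intro order_trans[OF integral_norm_bound] integral_mono integrable_norm ig i_f) (unfold real_norm_def, rule p)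
    then show ?thesis using t by (simp add: kop_def)
  qed
  also have "\<dots> = M * exp (l * t) / wt m x * (LBINT z. ?g z)" by simp
  finally show "wt m x * \<bar>kop T \<kappa> F t x\<bar> \<le> M * exp (l * t) * (LBINT z. ?g z)"
    by (simp add: field_simps)
qed

section \<open>Spatial derivatives of the integral operators\<close>

lemma partial_affine:
  assumes "smooth f" shows "partial i (\<lambda>x. f (c *\<^sub>R x + b)) = (\<lambda>x. c * partial i f (c *\<^sub>R x + b))"
proof
  fix x
  have "((\<lambda>x. c *\<^sub>R x + b) has_derivative (\<lambda>h. c *\<^sub>R h)) (at x)"
    by (auto intro!: derivative_eq_intros)
  from partialI[OF has_derivative_compose[OF this smooth_has_derivative[OF assms]]]
  show "partial i (\<lambda>x. f (c *\<^sub>R x + b)) x = c * partial i f (c *\<^sub>R x + b)"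
    by (simp add: axis_def if_distrib if_distribR sum.delta cong: if_cong)
qed

lemma pd_affine:
  assumes "smooth f"
  shows "smooth (\<lambda>x. f (c *\<^sub>R x + b)) \<and> pd js (\<lambda>x. f (c *\<^sub>R x + b)) = (\<lambda>x. c ^ length js * pd js f (c *\<^sub>R x + b))"
proof -
  have "((\<lambda>x. c *\<^sub>R x + b) has_derivative (\<lambda>h. c *\<^sub>R h)) (at x)" for x
    by (auto intro!: derivative_eq_intros)
  from differentiableI[OF has_derivative_compose[OF this smooth_has_derivative[OF smooth_pd[OF assms]]]]
  have d: "(\<lambda>x. k * pd js f (c *\<^sub>R x + b)) differentiable (at x)" for js k x
    by (intro differentiable_mult differentiable_const)
  have e: "pd js (\<lambda>x. f (c *\<^sub>R x + b)) = (\<lambda>x. c ^ length js * pd js f (c *\<^sub>R x + b))" for js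
  proof (induction js)
    case (Cons j js)
    have "partial j (\<lambda>x. c ^ length js * pd js f (c *\<^sub>R x + b)) x = c ^ length js * (c * partial j (pd js f) (c *\<^sub>R x + b))" for x
      using d[of 1 js x] partial_affine[OF smooth_pd[OF assms, of js], of j c b] by (subst partial_cmult) auto
    with Cons show ?case by (auto simp: mult_ac)
  qed simp
  moreover have "smooth (\<lambda>x. f (c *\<^sub>R x + b))"
    unfolding smooth_def e by (intro allI differentiable_at_imp_differentiable_on d)
  ultimately show ?thesis by blast
qed

lemma smooth_affine: "smooth f \<Longrightarrow> smooth (\<lambda>x. f (c *\<^sub>R x + b))"
  using pd_affine by blast

lemma
  assumes k: "kernel \<kappa>" and F: "reg F"
  shows kop_smooth: "smooth (kop T \<kappa> F t)"
    and kop_pd: "pd js (kop T \<kappa> F t) = kop T \<kappa> (\<lambda>s. pd js (F s)) t"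
proof -
  let ?f = "\<lambda>z x. \<kappa> z * F (clamp_time T t * (1 - fst z)) (x + sqrt (clamp_time T t * fst z) *\<^sub>R snd z)"
  have tr: "smooth (\<lambda>x. f (x + b))" "pd js (\<lambda>x. f (x + b)) = (\<lambda>x. pd js f (x + b))"
    if "smooth f" for f :: "real^'a \<Rightarrow> real" and b js
    using pd_affine[OF that, of 1 b js] by auto
  have s: "smooth (?f z)" for z by (intro smooth_cmult tr reg_smooth F)
  have p: "pd js (?f z) = (\<lambda>x. \<kappa> z * pd js (F (clamp_time T t * (1 - fst z))) (x + sqrt (clamp_time T t * fst z) *\<^sub>R snd z))" for z js
    by (simp add: pd_cmult tr reg_smooth F)
  have m: "(\<lambda>z. pd js (?f z) x) \<in> borel_measurable lborel" for js x
    unfolding p using k shift_measurable[OF reg_continuous[OF F]] by (auto simp: kernel_def)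
  have b: "\<exists>W. integrable lborel W \<and> (\<forall>z\<in>space lborel. \<forall>x. \<bar>pd js (?f z) x\<bar> \<le> W z)" for js
  proof -
    obtain C where C: "\<And>t x. wt 0 x * \<bar>pd js (F t) x\<bar> \<le> C" using reg_bound[OF F] by metis
    have "integrable lborel (\<lambda>z. \<bar>\<kappa> z\<bar> * C)"
      by (intro integrable_mult_left integrable_abs kernel_integrable k)
    moreover have "\<bar>pd js (?f z) x\<bar> \<le> \<bar>\<kappa> z\<bar> * C" for z x
      unfolding p abs_mult using C by (intro mult_left_mono) auto
    ultimately show ?thesis by blast
  qed
  show "smooth (kop T \<kappa> F t)" using smooth_integral[OF s m b] by (simp add: kop_def[abs_def])
  show "pd js (kop T \<kappa> F t) = kop T \<kappa> (\<lambda>s. pd js (F s)) t"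
    using pd_integral[OF s m b, of js] unfolding p by (simp add: kop_def[abs_def])
qed

lemma reg_kop:
  assumes k: "kernel \<kappa>" and F: "reg F" and T: "0 < T" "T \<le> 1"
  shows "reg (kop T \<kappa> F)"
proof -
  have b0: "\<exists>B. \<forall>t x. \<bar>pd js (F t) x\<bar> \<le> B" for js
    using reg_bound[OF F, of 0 js] by (metis mult_1 wt_0)
  have c: "continuous_on UNIV (\<lambda>p. pd js (kop T \<kappa> F (fst p)) (snd p))" for js
    unfolding kop_pd[OF k F] using b0[of js] kop_continuous[OF k reg_continuous[OF F, of js]] by blast
  have "\<exists>C. \<forall>t x. wt m x * \<bar>pd js (kop T \<kappa> F t) x\<bar> \<le> C" for js m
  proof -
    obtain C where C: "C \<ge> 0" "\<And>t x. wt m x * \<bar>pd js (F t) x\<bar> \<le> C" using reg_bound[OF F] by metis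
    have "wt m x * \<bar>kop T \<kappa> (\<lambda>s. pd js (F s)) t x\<bar> \<le> C * exp (0 * clamp_time T t) * (LBINT z. wt m (snd z) * \<bar>\<kappa> z\<bar> * exp (- 0 * clamp_time T t * fst z))" for t x
    proof -
      have "kop T \<kappa> (\<lambda>s. pd js (F s)) t = kop T \<kappa> (\<lambda>s. pd js (F s)) (clamp_time T t)"
        using clamp_time_mem[of T t] T by (auto simp: kop_def fun_eq_iff)
      then show ?thesis
        using kop_bound(1)[OF k reg_continuous[OF F, of js] T, of m C 0 "clamp_time T t" x] C clamp_time_mem[of T t] T by simp
    qed
    then show ?thesis unfolding kop_pd[OF k F] by auto
  qed
  with c show ?thesis unfolding reg_def using kop_smooth[OF k F] by blast
qed

subsection \<open>The Duhamel operator of the heat equation\<close>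

text \<open>The standard normal density. Its averages over displacements sqrt r y form the semigroup
  generated by half the Laplacian.\<close>

definition heat :: "real^'n::finite \<Rightarrow> real"
  where "heat y = gauss y / (LBINT x. gauss (x::real^'n))"

lemma heat_nonneg [simp]: "0 \<le> heat y"
  using integral_gauss_pos[where 'n='a] by (simp add: heat_def)

lemma heat_schwartz: "heat \<in> schwartz"
  using schwartz_cmult[OF gauss_schwartz, of "1 / (LBINT x. gauss (x::real^'a))"] by (simp add: heat_def[abs_def])

lemma heat_measurable [measurable]: "heat \<in> borel_measurable borel"
  by (rule smooth_measurable[OF schwartz_smooth[OF heat_schwartz]])

lemma integrable_wt_heat: "integrable lborel (\<lambda>y. wt m y * heat y)"
  using integrable_mult_left[OF integrable_wt_gauss[of m], of "1 / (LBINT x. gauss (x::real^'a))"]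
  by (simp add: heat_def[abs_def])

lemma integrable_heat: "integrable lborel heat"
  using integrable_wt_heat[of 0] by simp

lemma integral_heat: "(LBINT y. heat (y::real^'n::finite)) = 1"
  using integral_gauss_pos[where 'n='n] by (simp add: heat_def[abs_def])

lemma partial_heat: "partial i heat = (\<lambda>y. - (y $ i * heat y))"
proof -
  have "partial i (\<lambda>y. (1 / (LBINT x. gauss (x::real^'a))) * gauss y) y = - (y $ i * heat y)" for y
    by (subst partial_cmult) (auto simp: partial_gauss heat_def intro: smooth_differentiable schwartz_smooth gauss_schwartz)
  then show ?thesis by (simp add: heat_def[abs_def] fun_eq_iff)
qed

lemma abs_component_heat: "\<bar>y $ i * heat y\<bar> \<le> wt 1 y * heat y"
  using component_le_norm_cart[of y i] by (auto simp: abs_mult wt_def intro!: mult_right_mono)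

lemma integrable_wt_component_heat: "integrable lborel (\<lambda>y. y $ i * heat y * wt m y)"
proof (rule Bochner_Integration.integrable_bound[OF integrable_wt_heat[of "1 + m"]])
  show "AE y in lborel. norm (y $ i * heat y * wt m y) \<le> norm (wt (1 + m) y * heat y)"
  proof (rule AE_I2)
    fix y :: "real^'a"
    have "norm (y $ i * heat y * wt m y) = \<bar>y $ i * heat y\<bar> * wt m y" by (simp add: abs_mult)
    also have "\<dots> \<le> wt 1 y * heat y * wt m y" by (intro mult_right_mono abs_component_heat) auto
    also have "\<dots> = norm (wt (1 + m) y * heat y)" unfolding wt_add by (simp add: abs_mult)
    finally show "norm (y $ i * heat y * wt m y) \<le> norm (wt (1 + m) y * heat y)" .
  qed
qed simp

definition duh_ker :: "real \<times> (real^'n::finite) \<Rightarrow> real"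
  where "duh_ker z = rho 0 (fst z) * heat (snd z)"

text \<open>What remains of \<open>duh_ker\<close> once a derivative has been moved from F onto the
  Gaussian: the factor y_i appears, and the profile becomes \<sigma>^(-1/2).\<close>

definition duh_ker' :: "'n::finite \<Rightarrow> real \<times> (real^'n) \<Rightarrow> real"
  where "duh_ker' i z = rho (-1/2) (fst z) * (snd z $ i * heat (snd z))"

lemma kernel_prod:
  assumes a: "a > -1" and b: "\<And>m. integrable lborel (\<lambda>y. b y * wt m y)"
  shows "kernel (\<lambda>z. rho a (fst z) * b (snd z))"
  unfolding kernel_def
proof (intro conjI allI impI)
  have [measurable]: "b \<in> borel_measurable borel" using borel_measurable_integrable[OF b[of 0]] by simp
  show "(\<lambda>z. rho a (fst z) * b (snd z)) \<in> borel_measurable borel" by measurable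
  show "integrable lborel (\<lambda>z. rho a (fst z) * b (snd z) * wt m (snd z))" for m
    using integrable_lborel_prod_mult[OF integrable_rho[OF a] b[of m]] by (simp add: mult.assoc)
qed (auto simp: rho_def indicator_def split: if_splits)

lemma kernel_duh_ker: "kernel duh_ker"
  unfolding duh_ker_def[abs_def] by (rule kernel_prod) (use integrable_wt_heat in \<open>simp_all add: mult.commute\<close>)

lemma kernel_duh_ker': "kernel (duh_ker' i)"
  unfolding duh_ker'_def[abs_def] by (rule kernel_prod) (use integrable_wt_component_heat in simp_all)

text \<open>
  On \<open>[0, T]\<close> this is \<open>\<integral>\<^sub>0\<^sup>t e\<^bsup>(t - s) \<Delta> / 2\<^esup> F(s) ds\<close>, with \<open>s = t (1 - \<sigma>)\<close> and the heat semigroup written as an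
  average over \<open>x + \<surd>(t - s) y\<close> with respect to the standard Gaussian.
\<close>

definition duh :: "real \<Rightarrow> (real \<Rightarrow> real^'n::finite \<Rightarrow> real) \<Rightarrow> real \<Rightarrow> real^'n \<Rightarrow> real"
  where "duh T F t x = clamp_time T t * kop T duh_ker F t x"

lemma abs_clamp_time: "0 \<le> T \<Longrightarrow> \<bar>clamp_time T t\<bar> \<le> T" by (simp add: clamp_time_def)

lemma reg_duh: "reg F \<Longrightarrow> 0 < T \<Longrightarrow> T \<le> 1 \<Longrightarrow> reg (duh T F)"
  unfolding duh_def[abs_def]
  by (rule reg_time_mult[where B=T]) (auto intro!: reg_kop kernel_duh_ker continuous_intros abs_clamp_time)

lemma duh_pd: "reg F \<Longrightarrow> pd js (duh T F t) = duh T (\<lambda>s. pd js (F s)) t"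
  unfolding duh_def[abs_def] by (subst pd_cmult) (auto simp: kop_smooth kop_pd kernel_duh_ker)

text \<open>Gaussian integration by parts in y for each fixed \<sigma>, followed by Fubini. With c
  the clamped time and A = sqrt (c \<sigma>), the y-derivative of F at x + A y is A times the
  derivative of F, and c = sqrt c \<sigma>^(-1/2) A accounts for the remaining factors. If c = 0 or
  \<sigma> lies outside (0, 1], both sides vanish.\<close>

lemma duh_partial:
  assumes F: "reg F"
  shows "partial i (duh T F t) x = sqrt (clamp_time T t) * kop T (duh_ker' i) F t x"
proof -
  let ?c = "clamp_time T t"
  obtain C where C: "\<And>t x. \<bar>F t x\<bar> \<le> C" using reg_bound[OF F, of 0 "[]", simplified] by metis
  obtain C' where C': "\<And>t x. \<bar>partial i (F t) x\<bar> \<le> C'" using reg_bound[OF F, of 0 "[i]", simplified] by metis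
  have c0: "0 \<le> ?c" by (simp add: clamp_time_def)
  have i1: "integrable lborel (\<lambda>z. duh_ker z * partial i (F (?c * (1 - fst z))) (x + sqrt (?c * fst z) *\<^sub>R snd z))"
    by (rule kop_integrable[OF kernel_duh_ker, where F="\<lambda>t. partial i (F t)" and B=C'])
      (use reg_continuous[OF F, of "[i]"] C' in auto)
  have i2: "integrable lborel (\<lambda>z. duh_ker' i z * F (?c * (1 - fst z)) (x + sqrt (?c * fst z) *\<^sub>R snd z))"
    by (rule kop_integrable[OF kernel_duh_ker', where F=F and B=C])
      (use reg_continuous[OF F, of "[]"] C in auto)
  have eq: "?c * (LBINT y. duh_ker (s, y) * partial i (F (?c * (1 - s))) (x + sqrt (?c * s) *\<^sub>R y))
      = sqrt ?c * (LBINT y. duh_ker' i (s, y) * F (?c * (1 - s)) (x + sqrt (?c * s) *\<^sub>R y))" for s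
  proof (cases "?c = 0 \<or> \<not> (0 < s \<and> s \<le> 1)")
    case True
    then show ?thesis by (auto simp: duh_ker_def duh_ker'_def rho_def)
  next
    case False
    then have s: "0 < s" "s \<le> 1" and c: "0 < ?c" using c0 by auto
    let ?a = "sqrt (?c * s)" and ?f = "F (?c * (1 - s))"
    have pf: "partial i (\<lambda>y. ?f (x + ?a *\<^sub>R y)) = (\<lambda>y. ?a * partial i ?f (x + ?a *\<^sub>R y))"
      using partial_affine[OF reg_smooth[OF F], of i "?c * (1 - s)" ?a x] by (simp add: add.commute)
    have "(LBINT y. ?f (x + ?a *\<^sub>R y) * partial i heat y) = - (LBINT y. partial i (\<lambda>y. ?f (x + ?a *\<^sub>R y)) y * heat y)"
    proof (rule integral_by_parts[where A="C + ?a * C'"])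
      show "smooth (\<lambda>y. ?f (x + ?a *\<^sub>R y))"
        using smooth_affine[OF reg_smooth[OF F], of "?c * (1 - s)" ?a x] by (simp add: add.commute)
      have C0: "0 \<le> C" "0 \<le> C'" using order_trans[OF abs_ge_zero C] order_trans[OF abs_ge_zero C'] by auto
      have a0: "0 \<le> ?a" using s c by simp
      show "\<bar>?f (x + ?a *\<^sub>R y)\<bar> \<le> C + ?a * C'" for y
        using C[of "?c * (1 - s)" "x + ?a *\<^sub>R y"] mult_nonneg_nonneg[OF a0 C0(2)] by linarith
      show "\<bar>partial i (\<lambda>y. ?f (x + ?a *\<^sub>R y)) y\<bar> \<le> C + ?a * C'" for y
        unfolding pf abs_mult using mult_left_mono[OF C'[of "?c * (1 - s)" "x + ?a *\<^sub>R y"] a0] C0(1) a0 by simp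
    qed (rule heat_schwartz)
    then have ibp: "(LBINT y. ?f (x + ?a *\<^sub>R y) * (y $ i * heat y)) = ?a * (LBINT y. partial i ?f (x + ?a *\<^sub>R y) * heat y)"
      unfolding pf partial_heat by (simp add: mult.assoc)
    have "?c * (LBINT y. duh_ker (s, y) * partial i ?f (x + ?a *\<^sub>R y)) = ?c * (LBINT y. partial i ?f (x + ?a *\<^sub>R y) * heat y)"
      using s by (simp add: duh_ker_def rho_def mult.commute)
    also have "\<dots> = (sqrt ?c * s powr (-1/2) * ?a) * (LBINT y. partial i ?f (x + ?a *\<^sub>R y) * heat y)"
    proof -
      have "sqrt ?c * s powr (-1/2) * ?a = ?c"
        using s c by (simp add: real_sqrt_mult powr_minus powr_half_sqrt field_simps)
      then show ?thesis by (simp only:)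
    qed
    also have "\<dots> = sqrt ?c * (s powr (-1/2) * (LBINT y. ?f (x + ?a *\<^sub>R y) * (y $ i * heat y)))"
      by (simp only: ibp mult.assoc)
    also have "\<dots> = sqrt ?c * (LBINT y. duh_ker' i (s, y) * ?f (x + ?a *\<^sub>R y))"
      using s by (subst integral_mult_right_zero[symmetric]) (auto simp: duh_ker'_def rho_def mult_ac intro!: Bochner_Integration.integral_cong)
    finally show ?thesis .
  qed
  have "partial i (duh T F t) x = ?c * kop T duh_ker (\<lambda>t. partial i (F t)) t x"
    using duh_pd[OF F, of "[i]" T t] by (simp add: duh_def)
  also have "\<dots> = (LBINT s. ?c * (LBINT y. duh_ker (s, y) * partial i (F (?c * (1 - s))) (x + sqrt (?c * s) *\<^sub>R y)))"
    unfolding kop_def using integral_lborel_pair[OF i1] by simp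
  also have "\<dots> = sqrt ?c * kop T (duh_ker' i) F t x"
    unfolding kop_def eq using integral_lborel_pair[OF i2] by simp
  finally show ?thesis .
qed

text \<open>The order is 1 + m rather than m because the factor y_i in \<open>duh_ker'\<close> costs
  one more power of the weight.\<close>

definition heat_moment :: "'n::finite itself \<Rightarrow> nat \<Rightarrow> real"
  where "heat_moment _ m = (LBINT y. wt (1 + m) (y::real^'n) * heat y)"

lemma heat_moment_nonneg: "0 \<le> heat_moment TYPE('n::finite) m"
  unfolding heat_moment_def by (intro Bochner_Integration.integral_nonneg) simp

text \<open>
  The factor \<open>q\<close> is what the operator gains: it is small for small \<open>T\<close> (with \<open>l = 0\<close>) and, on a fixed
  time interval, in the exponentially weighted norms with large \<open>l\<close>.
\<close>

definition gain :: "real \<Rightarrow> real \<Rightarrow> real \<Rightarrow> bool"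
  where "gain T l q \<longleftrightarrow> 0 \<le> l \<and> 0 \<le> q \<and>
    (\<forall>t\<in>{0..T}. sqrt t * (LBINT s. rho (-1/2) s * exp (- l * t * s)) \<le> q)"

lemma gain_small_time: "0 \<le> T \<Longrightarrow> gain T 0 (2 * sqrt T)"
  by (auto simp: gain_def integral_rho)

lemma integrable_rho_exp:
  assumes "0 \<le> l" "0 \<le> t" shows "integrable lborel (\<lambda>s. rho (-1/2) s * exp (- l * t * s))"
proof (rule Bochner_Integration.integrable_bound[OF integrable_rho[of "-1/2"]])
  show "AE s in lborel. norm (rho (-1/2) s * exp (- l * t * s)) \<le> norm (rho (-1/2) s)"
  proof (rule AE_I2)
    fix s
    have "exp (- l * t * s) \<le> 1" if "0 < s" using assms that by simp
    then show "norm (rho (-1/2) s * exp (- l * t * s)) \<le> norm (rho (-1/2) s)"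
      by (auto simp: rho_def indicator_def intro!: mult_left_le)
  qed
qed auto

text \<open>Uses exp (-a) \<le> a^(-1/4) at a = l t s. The exponent 1/4 extracts a negative power of
  l, leaves t^(1/4) \<le> 1, and worsens the singularity only to s^(-3/4), whose integral over (0,
  1] is 4.\<close>

lemma gain_exponential:
  assumes T: "0 < T" "T \<le> 1" and l: "l > 0" shows "gain T l (4 * l powr (-1/4))"
  unfolding gain_def
proof (intro conjI ballI)
  fix t assume t: "t \<in> {0..T}"
  show "sqrt t * (LBINT s. rho (-1/2) s * exp (- l * t * s)) \<le> 4 * l powr (-1/4)"
  proof (cases "t = 0")
    case False
    then have t0: "0 < t" "t \<le> 1" using t T by auto
    have p: "sqrt t * (rho (-1/2) s * exp (- l * t * s)) \<le> l powr (-1/4) * rho (-3/4) s" for s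
    proof (cases "0 < s \<and> s \<le> 1")
      case True
      let ?a = "l * t * s"
      have a: "0 < ?a" using True l t0 by simp
      have "?a powr (1/4) \<le> exp ?a"
      proof -
        have "?a powr (1/4) \<le> (exp ?a) powr (1/4)"
          using exp_ge_add_one_self[of ?a] a by (intro powr_mono2) linarith+
        also have "\<dots> = exp (?a / 4)" by (simp add: powr_def)
        also have "\<dots> \<le> exp ?a" unfolding exp_le_cancel_iff using a by linarith
        finally show ?thesis .
      qed
      then have "inverse (exp ?a) \<le> inverse (?a powr (1/4))"
        using a by (intro le_imp_inverse_le) auto
      then have "exp (- ?a) \<le> ?a powr (-1/4)"
        using powr_minus[of ?a "1/4"] exp_minus[of ?a] by simp
      also have "\<dots> = l powr (-1/4) * t powr (-1/4) * s powr (-1/4)"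
        using True l t0 by (simp add: powr_mult)
      finally have "sqrt t * (s powr (-1/2) * exp (- l * t * s)) \<le> sqrt t * (s powr (-1/2) * (l powr (-1/4) * t powr (-1/4) * s powr (-1/4)))"
        using t0 by (intro mult_left_mono) auto
      also have "\<dots> = l powr (-1/4) * (t powr (1/2) * t powr (-1/4)) * (s powr (-1/2) * s powr (-1/4))"
        using t0 by (simp add: powr_half_sqrt)
      also have "\<dots> = l powr (-1/4) * t powr (1/4) * s powr (-3/4)"
        by (simp add: powr_add[symmetric])
      also have "\<dots> \<le> l powr (-1/4) * 1 * s powr (-3/4)"
        using t0 by (intro mult_right_mono mult_left_mono) (auto intro: powr_le1)
      finally show ?thesis using True by (simp add: rho_def)
    qed (auto simp: rho_def)
    have "sqrt t * (LBINT s. rho (-1/2) s * exp (- l * t * s)) = (LBINT s. sqrt t * (rho (-1/2) s * exp (- l * t * s)))"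
      by simp
    also have "\<dots> \<le> (LBINT s. l powr (-1/4) * rho (-3/4) s)"
      using l t0 p by (intro integral_mono integrable_mult_right integrable_rho_exp integrable_rho) auto
    also have "\<dots> = 4 * l powr (-1/4)" by (simp add: integral_rho)
    finally show ?thesis .
  qed simp
qed (use l in auto)

lemma gain_arbitrarily_small:
  assumes "0 < T" "T \<le> 1" "e > 0" obtains l q where "gain T l q" "q \<le> e"
proof
  let ?l = "(e / 4) powr (-4)"
  show "gain T ?l (4 * ?l powr (-1/4))" using assms by (intro gain_exponential) auto
  show "4 * ?l powr (-1/4) \<le> e" using assms by (simp add: powr_powr)
qed

text \<open>Both kernels are at most \<open>rho (-1/2)\<close> times \<open>wt 1\<close> times
  \<open>heat\<close>; for the undifferentiated one this is 1 \<le> \<sigma>^(-1/2). So one estimate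
  serves for the function and its gradient. For the function itself the prefactor is t = sqrt t sqrt
  t, and one root is bounded by 1.\<close>

lemma duh_estimate:
  fixes F :: "real \<Rightarrow> real^'n::finite \<Rightarrow> real"
  assumes F: "reg F" and T: "0 < T" "T \<le> 1" and q: "gain T l q"
    and b: "\<And>s x. s \<in> {0..T} \<Longrightarrow> wt m x * \<bar>F s x\<bar> \<le> M * exp (l * s)" and t: "t \<in> {0..T}"
  shows "wt m x * \<bar>duh T F t x\<bar> \<le> heat_moment TYPE('n) m * q * M * exp (l * t)"
    and "wt m x * \<bar>partial i (duh T F t) x\<bar> \<le> heat_moment TYPE('n) m * q * M * exp (l * t)"
proof -
  have l: "0 \<le> l" using q by (simp add: gain_def)
  have "0 \<le> wt m (0::real^'n) * \<bar>F 0 0\<bar>" by simp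
  also have "\<dots> \<le> M" using b[of 0 0] T by simp
  finally have M: "0 \<le> M" .
  have c: "continuous_on UNIV (\<lambda>p. F (fst p) (snd p))" using reg_continuous[OF F, of "[]"] by simp
  have est: "wt m x * \<bar>sqrt t * kop T \<kappa> F t x\<bar> \<le> heat_moment TYPE('n) m * q * M * exp (l * t)"
    if k: "kernel \<kappa>" and kb: "\<And>z. \<bar>\<kappa> z\<bar> \<le> rho (-1/2) (fst z) * (wt 1 (snd z) * heat (snd z))" for \<kappa> :: "real \<times> (real^'n) \<Rightarrow> real"
  proof -
    let ?e = "\<lambda>s. rho (-1/2) s * exp (- l * t * s)"
    have t0: "0 \<le> t" using t by simp
    have ir: "integrable lborel ?e" using l t0 by (rule integrable_rho_exp)
    have "(LBINT z. wt m (snd z) * \<bar>\<kappa> z\<bar> * exp (- l * t * fst z))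
        \<le> (LBINT z. ?e (fst z) * (wt (1 + m) (snd z) * heat (snd z :: real^'n)))"
    proof (rule integral_mono)
      show "integrable lborel (\<lambda>z. wt m (snd z) * \<bar>\<kappa> z\<bar> * exp (- l * t * fst z))"
        by (rule kop_bound(2)[OF k c T b M l t])
      show "integrable lborel (\<lambda>z :: real \<times> (real^'n). ?e (fst z) * (wt (1 + m) (snd z) * heat (snd z)))"
        by (rule integrable_lborel_prod_mult[OF ir integrable_wt_heat])
      fix z :: "real \<times> (real^'n)"
      have "wt m (snd z) * \<bar>\<kappa> z\<bar> * exp (- l * t * fst z)
          \<le> wt m (snd z) * (rho (-1/2) (fst z) * (wt 1 (snd z) * heat (snd z))) * exp (- l * t * fst z)"
        by (intro mult_right_mono mult_left_mono kb) auto
      then show "wt m (snd z) * \<bar>\<kappa> z\<bar> * exp (- l * t * fst z) \<le> ?e (fst z) * (wt (1 + m) (snd z) * heat (snd z))"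
        by (simp only: wt_add mult_ac)
    qed
    also have "\<dots> = (LBINT s. ?e s) * heat_moment TYPE('n) m"
      unfolding heat_moment_def by (rule integral_lborel_prod_mult[OF ir integrable_wt_heat])
    finally have "wt m x * \<bar>kop T \<kappa> F t x\<bar> \<le> M * exp (l * t) * ((LBINT s. ?e s) * heat_moment TYPE('n) m)"
      using M by (intro order_trans[OF kop_bound(1)[OF k c T b M l t] mult_left_mono]) auto
    then have "sqrt t * (wt m x * \<bar>kop T \<kappa> F t x\<bar>) \<le> sqrt t * (M * exp (l * t) * ((LBINT s. ?e s) * heat_moment TYPE('n) m))"
      using t0 by (intro mult_left_mono) auto
    also have "\<dots> = (sqrt t * (LBINT s. ?e s)) * (M * exp (l * t) * heat_moment TYPE('n) m)" by simp
    also have "\<dots> \<le> q * (M * exp (l * t) * heat_moment TYPE('n) m)"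
      using q t M heat_moment_nonneg[where 'n='n] by (intro mult_right_mono) (auto simp: gain_def)
    finally show ?thesis using t0 by (simp add: abs_mult mult_ac)
  qed
  have "\<bar>duh_ker' i z\<bar> \<le> rho (-1/2) (fst z) * (wt 1 (snd z) * heat (snd z))" for z
    unfolding duh_ker'_def abs_mult[of "rho _ _"] by (simp only: abs_of_nonneg[OF rho_nonneg]) (intro mult_left_mono abs_component_heat rho_nonneg)
  from est[OF kernel_duh_ker' this] show "wt m x * \<bar>partial i (duh T F t) x\<bar> \<le> heat_moment TYPE('n) m * q * M * exp (l * t)"
    using t by (simp add: duh_partial[OF F])
  have "\<bar>duh_ker z\<bar> \<le> rho (-1/2) (fst z) * (wt 1 (snd z) * heat (snd z))" for z :: "real \<times> (real^'n)"
  proof (cases "0 < fst z \<and> fst z \<le> 1")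
    case True
    then have "1 \<le> fst z powr (-1/2)" by (simp add: powr_minus ge_one_powr_ge_zero powr_le1 one_le_inverse)
    then have "1 * (1 * heat (snd z)) \<le> fst z powr (-1/2) * (wt 1 (snd z) * heat (snd z))"
      by (intro mult_mono wt_ge1) auto
    then show ?thesis using True by (simp add: duh_ker_def rho_def)
  qed (auto simp: duh_ker_def rho_def)
  from est[OF kernel_duh_ker this] have e: "wt m x * \<bar>sqrt t * kop T duh_ker F t x\<bar> \<le> heat_moment TYPE('n) m * q * M * exp (l * t)" .
  have "t = sqrt t * sqrt t" using t by simp
  then have "wt m x * \<bar>duh T F t x\<bar> = sqrt t * (wt m x * \<bar>sqrt t * kop T duh_ker F t x\<bar>)"
    using t by (simp add: duh_def abs_mult mult_ac)
  also have "\<dots> \<le> 1 * (wt m x * \<bar>sqrt t * kop T duh_ker F t x\<bar>)"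
    using t T by (intro mult_right_mono) auto
  finally show "wt m x * \<bar>duh T F t x\<bar> \<le> heat_moment TYPE('n) m * q * M * exp (l * t)" using e by linarith
qed

subsection \<open>The Picard iteration\<close>

lemma bounded_over_finite:
  fixes f :: "'i::finite \<Rightarrow> 'x \<Rightarrow> real"
  assumes "\<And>i. \<exists>C. \<forall>x. f i x \<le> C" shows "\<exists>C. \<forall>i x. f i x \<le> C"
proof -
  obtain C where C: "\<And>i x. f i x \<le> C i" using assms by metis
  have "f i x \<le> Max (range C)" for i x
    using C[of i x] Max_ge[of "range C" "C i"] by (auto intro: order_trans)
  then show ?thesis by blast
qed

lemma family_bound_upto:
  fixes f :: "'i::finite \<Rightarrow> real^'n::finite \<Rightarrow> real"
  assumes "\<And>i. f i \<in> schwartz"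
  obtains C where "C \<ge> 0" "\<And>i js x. length js \<le> N \<Longrightarrow> wt m x * \<bar>pd js (f i) x\<bar> \<le> C"
proof -
  have "\<exists>C\<ge>0. \<forall>js p. length js \<le> N \<longrightarrow> wt m (snd p) * \<bar>pd js (f (fst p)) (snd p)\<bar> \<le> C"
  proof (rule bounds_upto)
    fix js
    have "\<exists>C. \<forall>i x. wt m x * \<bar>pd js (f i) x\<bar> \<le> C"
      using assms unfolding schwartz_iff by (intro bounded_over_finite) blast
    then show "\<exists>C. \<forall>p. wt m (snd p) * \<bar>pd js (f (fst p)) (snd p)\<bar> \<le> C" by auto
  qed
  then show ?thesis using that by auto
qed

text \<open>Apart from f times \<open>pd js g\<close>, every Leibniz term puts fewer than
  \<open>length js\<close> derivatives on g and is absorbed by A B. The highest derivative of g thus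
  meets only the undifferentiated f, which is what makes the top order linear.\<close>

lemma pd_mult_leading:
  assumes "smooth f" "smooth g"
    and "\<And>as x. length as \<le> length js \<Longrightarrow> \<bar>pd as f x\<bar> \<le> A"
    and "\<And>bs x. length bs < length js \<Longrightarrow> wt m x * \<bar>pd bs g x\<bar> \<le> B"
    and "0 \<le> A" "0 \<le> B"
  shows "wt m x * \<bar>pd js (\<lambda>x. f x * g x) x\<bar> \<le> wt m x * (\<bar>f x\<bar> * \<bar>pd js g x\<bar>) + 2 ^ length js * (A * B)"
  using assms
proof (induction js arbitrary: f g rule: rev_induct)
  case Nil
  then show ?case by (simp add: abs_mult)
next
  case (snoc i js)
  have pf: "\<bar>pd as (partial i f) x\<bar> \<le> A" if "length as \<le> length js" for as x
    using snoc.prems(3)[of "as @ [i]" x] that by simp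
  have pg: "wt m x * \<bar>pd as (partial i g) x\<bar> \<le> B" if "length as < length js" for as x
    using snoc.prems(4)[of "as @ [i]" x] that by simp
  have "1 * wt m x * \<bar>pd js (\<lambda>x. partial i f x * g x) x\<bar> \<le> 2 ^ length js * (A * B)"
    by (rule pd_mult_bound) (use snoc.prems pf in \<open>auto intro: smooth_partial\<close>)
  moreover have "wt m x * \<bar>pd js (\<lambda>x. f x * partial i g x) x\<bar>
      \<le> wt m x * (\<bar>f x\<bar> * \<bar>pd js (partial i g) x\<bar>) + 2 ^ length js * (A * B)"
    by (rule snoc.IH) (use snoc.prems pg in \<open>auto intro: smooth_partial\<close>)
  moreover have "wt m x * \<bar>pd (js @ [i]) (\<lambda>x. f x * g x) x\<bar> \<le>
      wt m x * (\<bar>pd js (\<lambda>x. partial i f x * g x) x\<bar> + \<bar>pd js (\<lambda>x. f x * partial i g x) x\<bar>)"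
    unfolding pd_mult_snoc[OF snoc.prems(1,2)] by (intro mult_left_mono abs_triangle_ineq) auto
  ultimately show ?case by (simp add: distrib_left)
qed

lemma duh_diff:
  assumes F: "reg F" and G: "reg G"
  shows "duh T F t x - duh T G t x = duh T (\<lambda>s y. F s y - G s y) t x"
proof -
  have "integrable lborel (\<lambda>z. duh_ker z * H (clamp_time T t * (1 - fst z)) (x + sqrt (clamp_time T t * fst z) *\<^sub>R snd z))"
    if H: "reg H" for H :: "real \<Rightarrow> real^'a \<Rightarrow> real"
  proof -
    obtain B where B: "\<And>t x. wt 0 x * \<bar>pd [] (H t) x\<bar> \<le> B" using reg_bound[OF H] by metis
    show ?thesis
      by (rule kop_integrable[OF kernel_duh_ker, where B=B]) (use B reg_continuous[OF H, of "[]"] in auto)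
  qed
  from this[OF F] this[OF G] show ?thesis
    by (simp add: duh_def kop_def right_diff_distrib)
qed

lemma duh_tendsto:
  assumes F: "\<And>n. reg (F n)" and G: "reg G" and b: "\<And>n t x. \<bar>F n t x\<bar> \<le> B"
    and lim: "\<And>t x. (\<lambda>n. F n t x) \<longlonglongrightarrow> G t x"
  shows "(\<lambda>n. duh T (F n) t x) \<longlonglongrightarrow> duh T G t x"
  unfolding duh_def kop_def
proof (intro tendsto_mult_left integral_dominated_convergence[where w="\<lambda>z. \<bar>duh_ker z\<bar> * B"])
  have c: "continuous_on UNIV (\<lambda>p. H (fst p) (snd p))" if "reg H" for H :: "real \<Rightarrow> real^'a \<Rightarrow> real"
    using reg_continuous[OF that, of "[]"] by simp
  note m = shift_measurable[OF c[OF F]] shift_measurable[OF c[OF G]] kernelD(1)[OF kernel_duh_ker]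
  show "(\<lambda>z. duh_ker z * G (clamp_time T t * (1 - fst z)) (x + sqrt (clamp_time T t * fst z) *\<^sub>R snd z)) \<in> borel_measurable lborel"
    using borel_measurable_times[OF m(3) m(2)] by simp
  show "(\<lambda>z. duh_ker z * F n (clamp_time T t * (1 - fst z)) (x + sqrt (clamp_time T t * fst z) *\<^sub>R snd z)) \<in> borel_measurable lborel" for n
    using borel_measurable_times[OF m(3) m(1)] by simp
  show "integrable lborel (\<lambda>z::real \<times> (real^'a). \<bar>duh_ker z\<bar> * B)"
    by (intro integrable_mult_left integrable_abs kernel_integrable kernel_duh_ker)
qed (auto intro!: AE_I2 tendsto_mult_left lim mult_left_mono b simp: abs_mult)

section \<open>The Burgers iteration\<close>

definition half_laplace :: "(real^'n::finite \<Rightarrow> real) \<Rightarrow> real^'n \<Rightarrow> real"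
  where "half_laplace f x = (1/2) * (\<Sum>j\<in>UNIV. partial j (partial j f) x)"

text \<open>Kept bilinear, so that the difference of two quadratic terms splits as adv (U' - U) U' +
  adv U (U' - U).\<close>

definition adv :: "('n::finite \<Rightarrow> real \<Rightarrow> real^'n \<Rightarrow> real) \<Rightarrow> ('n \<Rightarrow> real \<Rightarrow> real^'n \<Rightarrow> real) \<Rightarrow> 'n \<Rightarrow> real \<Rightarrow> real^'n \<Rightarrow> real"
  where "adv U V k t x = (\<Sum>j\<in>UNIV. U j t x * partial j (V k t) x)"

lemma schwartz_half_laplace: "f \<in> schwartz \<Longrightarrow> half_laplace f \<in> schwartz"
  unfolding half_laplace_def[abs_def] by (intro schwartz_cmult schwartz_sum schwartz_partial)

lemma reg_half_laplace: "reg F \<Longrightarrow> reg (\<lambda>t. half_laplace (F t))"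
  unfolding half_laplace_def[abs_def] by (intro reg_cmult reg_sum reg_partial)

lemma reg_adv: "(\<And>j. reg (U j)) \<Longrightarrow> reg (V k) \<Longrightarrow> reg (adv U V k)"
proof -
  assume U: "\<And>j. reg (U j)" and V: "reg (V k)"
  have "reg (\<lambda>t x. U j t x * partial j (V k t) x)" for j
    by (rule reg_mult[OF U reg_partial[OF V]])
  then show ?thesis unfolding adv_def[abs_def] by (rule reg_sum)
qed

lemma pd_adv:
  assumes "\<And>j. reg (U j)" "reg (V k)"
  shows "pd js (adv U V k t) x = (\<Sum>j\<in>UNIV. pd js (\<lambda>x. U j t x * partial j (V k t) x) x)"
  unfolding adv_def[abs_def] using assms
  by (subst pd_sum) (auto intro: smooth_mult[OF reg_smooth smooth_partial[OF reg_smooth]])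

text \<open>
  Writing the solution as \<open>a + v\<close> with \<open>v(0) = 0\<close> moves the initial value \<open>a\<close> into the forcing term
  \<open>\<Delta>a / 2\<close>, so that the heat semigroup is never applied to \<open>a\<close> itself.
\<close>

definition forcing :: "('n::finite \<Rightarrow> real^'n \<Rightarrow> real) \<Rightarrow> ('n \<Rightarrow> real \<Rightarrow> real^'n \<Rightarrow> real) \<Rightarrow> 'n \<Rightarrow> real \<Rightarrow> real^'n \<Rightarrow> real"
  where "forcing a U k t x = half_laplace (a k) x + adv U U k t x"

primrec picard :: "real \<Rightarrow> ('n::finite \<Rightarrow> real^'n \<Rightarrow> real) \<Rightarrow> nat \<Rightarrow> 'n \<Rightarrow> real \<Rightarrow> real^'n \<Rightarrow> real"
  where
    "picard T a 0 = (\<lambda>k t. a k)"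
  | "picard T a (Suc n) = (\<lambda>k t x. a k x + duh T (forcing a (picard T a n) k) t x)"

lemma reg_forcing: "a k \<in> schwartz \<Longrightarrow> (\<And>j. reg (U j)) \<Longrightarrow> reg (forcing a U k)"
  unfolding forcing_def[abs_def] by (intro reg_add reg_const reg_adv schwartz_half_laplace)

lemma reg_picard:
  assumes "\<And>k. a k \<in> schwartz" "0 < T" "T \<le> 1" shows "reg (picard T a n k)"
proof (induction n arbitrary: k)
  case (Suc n)
  then show ?case using assms by (auto intro!: reg_add reg_const reg_duh reg_forcing)
qed (simp add: assms reg_const)

text \<open>Transfers bounds proved on [0, T] to all real times, as \<open>reg\<close>
  demands.\<close>

lemma picard_clamp: "0 \<le> T \<Longrightarrow> picard T a n k t = picard T a n k (clamp_time T t)"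
  by (cases n) (use clamp_time_mem[of T t] in \<open>auto simp: duh_def kop_def fun_eq_iff\<close>)

lemma pd_picard_Suc:
  assumes "\<And>k. a k \<in> schwartz" "0 < T" "T \<le> 1"
  shows "pd js (picard T a (Suc n) k t) x = pd js (a k) x + pd js (duh T (forcing a (picard T a n) k) t) x"
  using assms by (simp add: pd_add reg_smooth reg_duh reg_forcing reg_picard schwartz_smooth)

text \<open>All derivatives but the outermost commute into F, and the outermost falls under the
  gradient estimate. Thus N derivatives of F control N + 1 of the Duhamel term, which repays the
  derivative lost in the advection term.\<close>

lemma duh_pd_estimate:
  fixes F :: "real \<Rightarrow> real^'n::finite \<Rightarrow> real"
  assumes F: "reg F" and T: "0 < T" "T \<le> 1" and q: "gain T l q"
    and b: "\<And>js s x. length js \<le> N \<Longrightarrow> s \<in> {0..T} \<Longrightarrow> wt m x * \<bar>pd js (F s) x\<bar> \<le> M * exp (l * s)"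
    and t: "t \<in> {0..T}" and js: "length js \<le> Suc N"
  shows "wt m x * \<bar>pd js (duh T F t) x\<bar> \<le> heat_moment TYPE('n) m * q * M * exp (l * t)"
proof (cases js)
  case Nil
  then show ?thesis using duh_estimate(1)[OF F T q b[of "[]", simplified] t] by simp
next
  case (Cons i ks)
  then have ks: "length ks \<le> N" using js by simp
  have "pd js (duh T F t) x = partial i (duh T (\<lambda>s. pd ks (F s)) t) x"
    using Cons duh_pd[OF F] by simp
  then show ?thesis using duh_estimate(2)[OF reg_pd[OF F] T q b[OF ks] t] by simp
qed

text \<open>The only estimate that is quadratic in the unknown, hence the only one that restricts T.
  Values and gradients are bounded together in the induction because the forcing contains both. Only
  the bound on the values is exported: gradients are treated linearly in
  \<open>picard_bound_step\<close>.\<close>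

lemma picard_base_bound:
  fixes a :: "'n::finite \<Rightarrow> real^'n \<Rightarrow> real"
  assumes a: "\<And>k. a k \<in> schwartz"
  obtains T R where "0 < T" "T \<le> 1" "0 \<le> R"
    "\<And>n k t x. t \<in> {0..T} \<Longrightarrow> \<bar>picard T a n k t x\<bar> \<le> R"
proof -
  let ?A = "heat_moment TYPE('n) 0" and ?d = "real CARD('n)"
  obtain S where S: "0 \<le> S" "\<And>k js x. length js \<le> 1 \<Longrightarrow> wt 0 x * \<bar>pd js (a k) x\<bar> \<le> S"
    using family_bound_upto[where f=a, OF a] by metis
  obtain L where L: "0 \<le> L" "\<And>k js x. length js \<le> 0 \<Longrightarrow> wt 0 x * \<bar>pd js (half_laplace (a k)) x\<bar> \<le> L"
    using family_bound_upto[where f="\<lambda>k. half_laplace (a k)"] schwartz_half_laplace a by metis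
  \<comment> \<open>S bounds the data and its gradient, and the 1 is room for the Duhamel term. M
    bounds the forcing as long as the iterate stays below R, and the choice of T makes the Duhamel
    term at most B sqrt T = B / (B + 1) \<le> 1.\<close>
  define R where "R = S + 1"
  define M where "M = L + ?d * (R * R)"
  define B where "B = 2 * ?A * M"
  define T where "T = (1 / (B + 1))\<^sup>2"
  have M0: "0 \<le> M" unfolding M_def R_def using S L by auto
  have B0: "0 \<le> B" unfolding B_def using M0 heat_moment_nonneg[where 'n='n] by auto
  have T: "0 < T" "T \<le> 1" using B0 by (auto simp: T_def power_le_one)
  have sT: "sqrt T = 1 / (B + 1)" using B0 by (simp add: T_def)
  have small: "?A * (2 * sqrt T) * M \<le> 1"
    using B0 unfolding sT by (simp add: B_def field_simps)
  have "\<bar>pd js (picard T a n k t) x\<bar> \<le> R" if "t \<in> {0..T}" "length js \<le> 1" for n k t x js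
    using that
  proof (induction n arbitrary: k t x js)
    case 0
    then show ?case using S(2)[of js x k] by (simp add: R_def)
  next
    case (Suc n)
    let ?U = "picard T a n"
    have U: "reg (?U k)" for k by (rule reg_picard[OF a T])
    have fb: "wt 0 x * \<bar>pd ks (forcing a ?U k s) x\<bar> \<le> M * exp (0 * s)"
      if ks: "length ks \<le> 0" and s: "s \<in> {0..T}" for ks s x
    proof -
      have "\<bar>?U j s x * partial j (?U k s) x\<bar> \<le> R * R" for j
        unfolding abs_mult using Suc.IH[OF s, of "[]" j x] Suc.IH[OF s, of "[j]" k x] by (intro mult_mono) auto
      then have "\<bar>adv ?U ?U k s x\<bar> \<le> (\<Sum>j\<in>(UNIV::'n set). R * R)"
        unfolding adv_def by (intro order_trans[OF sum_abs] sum_mono)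
      moreover have "\<bar>half_laplace (a k) x\<bar> \<le> L" using L(2)[of "[]" x k] by simp
      ultimately show ?thesis using ks by (simp add: forcing_def M_def)
    qed
    have "wt 0 x * \<bar>pd js (duh T (forcing a ?U k) t) x\<bar> \<le> ?A * (2 * sqrt T) * M * exp (0 * t)"
      by (rule duh_pd_estimate[OF reg_forcing[OF a U] T gain_small_time fb Suc.prems(1)]) (use T Suc.prems in auto)
    then have "\<bar>pd js (duh T (forcing a ?U k) t) x\<bar> \<le> 1" using small by simp
    moreover have "\<bar>pd js (a k) x\<bar> \<le> S" using S(2)[of js x k] Suc.prems by simp
    ultimately show ?case unfolding pd_picard_Suc[OF a T] R_def by linarith
  qed
  from this[of _ "[]"] show ?thesis by (intro that[of T R]) (use T S in \<open>auto simp: R_def\<close>)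
qed

text \<open>At order N + 1 the unknown enters the forcing only through the undifferentiated iterate,
  bounded by R, times a derivative of order N + 1. With exponential weights the induction on n
  therefore sends a bound K to S + A q (P + d R K), and a small q makes this stable on the given
  [0, T]. The lower-order bounds are unweighted for the first factor (C1) and weighted for the
  second (C2), so the weight is spent only once.\<close>

lemma picard_bound_step:
  fixes a :: "'n::finite \<Rightarrow> real^'n \<Rightarrow> real"
  assumes a: "\<And>k. a k \<in> schwartz" and T: "0 < T" "T \<le> 1"
    and R: "\<And>n k t x. t \<in> {0..T} \<Longrightarrow> \<bar>picard T a n k t x\<bar> \<le> R" "0 \<le> R"
    and C1: "\<And>n k js t x. length js \<le> N \<Longrightarrow> t \<in> {0..T} \<Longrightarrow> \<bar>pd js (picard T a n k t) x\<bar> \<le> C1" "0 \<le> C1"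
    and C2: "\<And>n k js t x. length js \<le> N \<Longrightarrow> js \<noteq> [] \<Longrightarrow> t \<in> {0..T} \<Longrightarrow> wt m x * \<bar>pd js (picard T a n k t) x\<bar> \<le> C2" "0 \<le> C2"
  shows "\<exists>C\<ge>0. \<forall>n k js. length js \<le> Suc N \<longrightarrow> (\<forall>t\<in>{0..T}. \<forall>x. wt m x * \<bar>pd js (picard T a n k t) x\<bar> \<le> C)"
proof -
  let ?A = "heat_moment TYPE('n) m" and ?d = "real CARD('n)"
  obtain S where S: "0 \<le> S" "\<And>k js x. length js \<le> Suc N \<Longrightarrow> wt m x * \<bar>pd js (a k) x\<bar> \<le> S"
    using family_bound_upto[where f=a, OF a] by metis
  obtain L where L: "0 \<le> L" "\<And>k js x. length js \<le> N \<Longrightarrow> wt m x * \<bar>pd js (half_laplace (a k)) x\<bar> \<le> L"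
    using family_bound_upto[where f="\<lambda>k. half_laplace (a k)"] schwartz_half_laplace a by metis
  have A0: "0 \<le> ?A" by (rule heat_moment_nonneg)
  have AR: "0 \<le> ?A * ?d * R" using A0 R(2) by simp
  then have "0 < 1 / (2 * (?A * ?d * R + 1))" by simp
  then obtain l q where q: "gain T l q" "q \<le> 1 / (2 * (?A * ?d * R + 1))"
    using gain_arbitrarily_small[OF T] by metis
  have lq: "0 \<le> l" "0 \<le> q" using q by (auto simp: gain_def)
  have "?A * ?d * R * q \<le> ?A * ?d * R * (1 / (2 * (?A * ?d * R + 1)))"
    using AR q(2) by (intro mult_left_mono)
  also have "\<dots> \<le> 1 / 2" using AR by (simp add: field_simps)
  finally have qh: "?A * ?d * R * q \<le> 1 / 2" .
  \<comment> \<open>P collects the part of the forcing that is already bounded: the Laplacian of the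
    data and the lower Leibniz terms. As A d R q \<le> 1/2, the constant K solves S + A q P + K / 2
    = K.\<close>
  define P where "P = L + ?d * (2 ^ N * (C1 * C2))"
  define K where "K = 2 * (S + ?A * q * P)"
  have P0: "0 \<le> P" unfolding P_def using L C1 C2 by auto
  have K0: "0 \<le> K" "S \<le> K" unfolding K_def using S A0 lq P0 by (auto simp: algebra_simps add_increasing2)
  have main: "wt m x * \<bar>pd js (picard T a n k t) x\<bar> \<le> K * exp (l * t)"
    if "length js \<le> Suc N" "t \<in> {0..T}" for n k js t x
    using that
  proof (induction n arbitrary: k js t x)
    case 0
    have "S * 1 \<le> K * exp (l * t)" using K0 S lq 0 by (intro mult_mono) auto
    with S(2)[OF 0(1), of x k] show ?case by simp
  next
    case (Suc n)
    let ?U = "picard T a n"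
    have U: "reg (?U k)" for k by (rule reg_picard[OF a T])
    have fb: "wt m x * \<bar>pd ks (forcing a ?U k s) x\<bar> \<le> (P + ?d * R * K) * exp (l * s)"
      if ks: "length ks \<le> N" and s: "s \<in> {0..T}" for ks s x
    proof -
      have e1: "1 \<le> exp (l * s)" using lq s by simp
      have "wt m x * \<bar>pd ks (\<lambda>x. ?U j s x * partial j (?U k s) x) x\<bar> \<le> R * K * exp (l * s) + 2 ^ N * (C1 * C2)" for j
      proof -
        have "wt m x * \<bar>pd ks (\<lambda>x. ?U j s x * partial j (?U k s) x) x\<bar> \<le>
            wt m x * (\<bar>?U j s x\<bar> * \<bar>pd ks (partial j (?U k s)) x\<bar>) + 2 ^ length ks * (C1 * C2)"
        proof (rule pd_mult_leading)
          show "\<bar>pd as (?U j s) x\<bar> \<le> C1" if "length as \<le> length ks" for as x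
            using C1(1)[of as s n j x] that ks s by simp
          show "wt m x * \<bar>pd bs (partial j (?U k s)) x\<bar> \<le> C2" if "length bs < length ks" for bs x
            using C2(1)[of "bs @ [j]" s x n k] that ks s by simp
        qed (auto intro: smooth_partial reg_smooth U C1 C2)
        also have "wt m x * (\<bar>?U j s x\<bar> * \<bar>pd ks (partial j (?U k s)) x\<bar>) =
            \<bar>?U j s x\<bar> * (wt m x * \<bar>pd (ks @ [j]) (?U k s) x\<bar>)" by simp
        also have "\<dots> \<le> R * (K * exp (l * s))"
          by (rule mult_mono[OF R(1)[OF s] Suc.IH R(2)]) (use ks s in auto)
        also have "2 ^ length ks * (C1 * C2) \<le> 2 ^ N * (C1 * C2)"
          using ks C1 C2 by (intro mult_right_mono power_increasing) auto
        finally show ?thesis by (simp add: mult.assoc)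
      qed
      then have "(\<Sum>j\<in>UNIV. wt m x * \<bar>pd ks (\<lambda>x. ?U j s x * partial j (?U k s) x) x\<bar>)
          \<le> (\<Sum>j\<in>(UNIV::'n set). R * K * exp (l * s) + 2 ^ N * (C1 * C2))"
        by (intro sum_mono)
      moreover have "wt m x * \<bar>pd ks (adv ?U ?U k s) x\<bar> \<le> (\<Sum>j\<in>UNIV. wt m x * \<bar>pd ks (\<lambda>x. ?U j s x * partial j (?U k s) x) x\<bar>)"
        unfolding pd_adv[OF U U] sum_distrib_left[symmetric] by (intro mult_left_mono sum_abs) auto
      ultimately have ab: "wt m x * \<bar>pd ks (adv ?U ?U k s) x\<bar> \<le> ?d * (R * K * exp (l * s) + 2 ^ N * (C1 * C2))"
        by simp
      have "pd ks (forcing a ?U k s) x = pd ks (half_laplace (a k)) x + pd ks (adv ?U ?U k s) x"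
        unfolding forcing_def[abs_def]
        by (subst pd_add) (auto intro: schwartz_smooth schwartz_half_laplace a reg_smooth reg_adv U)
      then have "wt m x * \<bar>pd ks (forcing a ?U k s) x\<bar> \<le> wt m x * (\<bar>pd ks (half_laplace (a k)) x\<bar> + \<bar>pd ks (adv ?U ?U k s) x\<bar>)"
        by (intro mult_left_mono) (auto intro: abs_triangle_ineq)
      also have "\<dots> \<le> L + ?d * (R * K * exp (l * s) + 2 ^ N * (C1 * C2))"
        using L(2)[OF ks, of x k] ab by (simp add: distrib_left)
      also have "\<dots> = P + ?d * R * K * exp (l * s)" by (simp add: P_def algebra_simps)
      also have "\<dots> \<le> P * exp (l * s) + ?d * R * K * exp (l * s)"
        using mult_left_mono[OF e1 P0] by simp
      finally show ?thesis by (simp add: algebra_simps)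
    qed
    have "wt m x * \<bar>pd js (duh T (forcing a ?U k) t) x\<bar> \<le> ?A * q * (P + ?d * R * K) * exp (l * t)"
      by (rule duh_pd_estimate[OF reg_forcing[OF a U] T q(1) fb Suc.prems(2,1)])
    moreover have "wt m x * \<bar>pd js (a k) x\<bar> \<le> S * exp (l * t)"
    proof -
      have "S * 1 \<le> S * exp (l * t)" using S lq Suc.prems by (intro mult_left_mono) auto
      then show ?thesis using S(2)[OF Suc.prems(1), of x k] by simp
    qed
    moreover have "wt m x * \<bar>pd js (picard T a (Suc n) k t) x\<bar> \<le> wt m x * (\<bar>pd js (a k) x\<bar> + \<bar>pd js (duh T (forcing a ?U k) t) x\<bar>)"
      unfolding pd_picard_Suc[OF a T] by (intro mult_left_mono abs_triangle_ineq) auto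
    ultimately have "wt m x * \<bar>pd js (picard T a (Suc n) k t) x\<bar> \<le> (S + ?A * q * (P + ?d * R * K)) * exp (l * t)"
      by (simp add: algebra_simps)
    also have "\<dots> \<le> K * exp (l * t)"
    proof (intro mult_right_mono)
      have "?A * ?d * R * q * K \<le> 1 / 2 * K" using qh K0(1) by (intro mult_right_mono)
      then show "S + ?A * q * (P + ?d * R * K) \<le> K" by (simp add: K_def algebra_simps)
    qed auto
    finally show ?case .
  qed
  have "wt m x * \<bar>pd js (picard T a n k t) x\<bar> \<le> K * exp (l * T)"
    if "length js \<le> Suc N" "t \<in> {0..T}" for n k js t x
    using main[OF that, of x n k] mult_left_mono[of "exp (l * t)" "exp (l * T)" K] that lq K0
    by (force intro: order_trans mult_left_mono)
  then show ?thesis using K0 by (intro exI[of _ "K * exp (l * T)"]) auto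
qed

text \<open>Induction on the order for all weights m at once: the step to order N + 2 takes the
  bounds of order N + 1 with weight 0 and with weight m.\<close>

lemma picard_bounds:
  fixes a :: "'n::finite \<Rightarrow> real^'n \<Rightarrow> real"
  assumes a: "\<And>k. a k \<in> schwartz" and T: "0 < T" "T \<le> 1"
    and R: "\<And>n k t x. t \<in> {0..T} \<Longrightarrow> \<bar>picard T a n k t x\<bar> \<le> R" "0 \<le> R"
  shows "\<exists>C\<ge>0. \<forall>n k js. length js \<le> N \<longrightarrow> (\<forall>t. \<forall>x. wt m x * \<bar>pd js (picard T a n k t) x\<bar> \<le> C)"
proof -
  let ?P = "\<lambda>N m. \<exists>C\<ge>0. \<forall>n k js. length js \<le> N \<longrightarrow> (\<forall>t\<in>{0..T}. \<forall>x. wt m x * \<bar>pd js (picard T a n k t) x\<bar> \<le> C)"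
  have P: "?P (Suc N) m" for N m
  proof (induction N arbitrary: m)
    case 0
    \<comment> \<open>No nonempty list has length 0, so the assumption on C2 is vacuous and C2 = 0
      will do. The unweighted bound R alone thus starts every weight m, for orders 0 and 1
      together.\<close>
    show ?case
      by (rule picard_bound_step[OF a T R, where ?C1.0=R and ?C2.0=0]) (use R in auto)
  next
    case (Suc N)
    obtain C1 where C1: "C1 \<ge> 0" "\<And>n k js t x. length js \<le> Suc N \<Longrightarrow> t \<in> {0..T} \<Longrightarrow> wt 0 x * \<bar>pd js (picard T a n k t) x\<bar> \<le> C1"
      using Suc[of 0] by blast
    obtain C2 where C2: "C2 \<ge> 0" "\<And>n k js t x. length js \<le> Suc N \<Longrightarrow> t \<in> {0..T} \<Longrightarrow> wt m x * \<bar>pd js (picard T a n k t) x\<bar> \<le> C2"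
      using Suc[of m] by blast
    show ?case
      by (rule picard_bound_step[OF a T R, where ?C1.0=C1 and ?C2.0=C2]) (use C1 C2 in auto)
  qed
  obtain C where C: "C \<ge> 0" "\<And>n k js t x. length js \<le> Suc N \<Longrightarrow> t \<in> {0..T} \<Longrightarrow> wt m x * \<bar>pd js (picard T a n k t) x\<bar> \<le> C"
    using P[of N m] by blast
  have "wt m x * \<bar>pd js (picard T a n k t) x\<bar> \<le> C" if "length js \<le> N" for n k js t x
    using C(2)[of js "clamp_time T t" x n k] that clamp_time_mem[of T t] T picard_clamp[of T a n k t] by simp
  with C(1) show ?thesis by blast
qed

text \<open>Successive differences solve a linear equation whose coefficients are iterates, already
  bounded to order N + 1. The product loses one derivative and the Duhamel operator regains it, so
  with a large exponential rate the norm of order N + 1 is halved at each step without shrinking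
  T.\<close>

lemma picard_differences:
  fixes a :: "'n::finite \<Rightarrow> real^'n \<Rightarrow> real"
  assumes a: "\<And>k. a k \<in> schwartz" and T: "0 < T" "T \<le> 1"
    and R: "\<And>n k t x. t \<in> {0..T} \<Longrightarrow> \<bar>picard T a n k t x\<bar> \<le> R" "0 \<le> R"
  shows "\<exists>K\<ge>0. \<forall>n k js. length js \<le> N \<longrightarrow>
    (\<forall>t. \<forall>x. \<bar>pd js (picard T a (Suc n) k t) x - pd js (picard T a n k t) x\<bar> \<le> K * (1/2) ^ n)"
proof -
  let ?A = "heat_moment TYPE('n) 0" and ?d = "real CARD('n)" and ?U = "picard T a"
  obtain C where "C \<ge> 0" "\<forall>n k js. length js \<le> Suc N \<longrightarrow> (\<forall>t. \<forall>x. wt 0 x * \<bar>pd js (?U n k t) x\<bar> \<le> C)"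
    using picard_bounds[OF a T R, of "Suc N" 0] by blast
  then have C: "C \<ge> 0" "\<And>n k js t x. length js \<le> Suc N \<Longrightarrow> \<bar>pd js (?U n k t) x\<bar> \<le> C"
    by auto
  have A0: "0 \<le> ?A" by (rule heat_moment_nonneg)
  \<comment> \<open>The factors count the two advection terms, their d summands, the 2^N Leibniz
    terms and the bound C on the coefficients. D q is then the contraction factor, and the induction
    starts from 2 C, the bound for a difference of two iterates.\<close>
  define D where "D = ?A * (2 * ?d * 2 ^ N * C)"
  have D0: "0 \<le> D" unfolding D_def using A0 C by simp
  then have "0 < 1 / (2 * (D + 1))" by simp
  then obtain l q where q: "gain T l q" "q \<le> 1 / (2 * (D + 1))"
    using gain_arbitrarily_small[OF T] by metis
  have lq: "0 \<le> l" "0 \<le> q" using q by (auto simp: gain_def)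
  have "D * q \<le> D * (1 / (2 * (D + 1)))" using D0 q(2) by (intro mult_left_mono)
  also have "\<dots> \<le> 1 / 2" using D0 by (simp add: field_simps)
  finally have qh: "D * q \<le> 1 / 2" .
  have U: "reg (?U n k)" for n k by (rule reg_picard[OF a T])
  define W where "W n k t x = ?U (Suc n) k t x - ?U n k t x" for n k t x
  have W: "reg (W n k)" for n k unfolding W_def[abs_def] by (intro reg_diff U)
  have pdW: "pd js (W n k t) x = pd js (?U (Suc n) k t) x - pd js (?U n k t) x" for js n k t x
    unfolding W_def[abs_def] by (rule fun_cong[OF pd_diff]) (rule reg_smooth[OF U])+
  have WS: "W (Suc n) k t = duh T (\<lambda>s x. adv (W n) (?U (Suc n)) k s x + adv (?U n) (W n) k s x) t" for n k t
  proof
    fix x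
    have "W (Suc n) k t x = duh T (forcing a (?U (Suc n)) k) t x - duh T (forcing a (?U n) k) t x"
      unfolding W_def by simp
    also have "\<dots> = duh T (\<lambda>s y. forcing a (?U (Suc n)) k s y - forcing a (?U n) k s y) t x"
      by (rule duh_diff) (intro reg_forcing a U)+
    also have "(\<lambda>s y. forcing a (?U (Suc n)) k s y - forcing a (?U n) k s y) =
        (\<lambda>s x. adv (W n) (?U (Suc n)) k s x + adv (?U n) (W n) k s x)"
    proof (intro ext)
      fix s y
      have pj: "partial j (W n k s) y = partial j (?U (Suc n) k s) y - partial j (?U n k s) y" for j
        using pdW[of "[j]"] by simp
      have "forcing a (?U (Suc n)) k s y - forcing a (?U n) k s y =
          (\<Sum>j\<in>UNIV. ?U (Suc n) j s y * partial j (?U (Suc n) k s) y - ?U n j s y * partial j (?U n k s) y)"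
        by (simp only: forcing_def adv_def sum_subtractf)
      also have "\<dots> = (\<Sum>j\<in>UNIV. W n j s y * partial j (?U (Suc n) k s) y + ?U n j s y * partial j (W n k s) y)"
        unfolding pj by (rule sum.cong[OF refl]) (simp add: W_def left_diff_distrib right_diff_distrib del: picard.simps)
      finally show "forcing a (?U (Suc n)) k s y - forcing a (?U n) k s y =
          adv (W n) (?U (Suc n)) k s y + adv (?U n) (W n) k s y"
        by (simp only: adv_def sum.distrib)
    qed
    finally show "W (Suc n) k t x = duh T (\<lambda>s x. adv (W n) (?U (Suc n)) k s x + adv (?U n) (W n) k s x) t x" .
  qed
  have main: "\<bar>pd js (W n k t) x\<bar> \<le> 2 * C * (1/2) ^ n * exp (l * t)"
    if "length js \<le> Suc N" "t \<in> {0..T}" for n k js t x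
    using that
  proof (induction n arbitrary: k js t x)
    case 0
    have "2 * C * 1 \<le> 2 * C * exp (l * t)" using C lq 0 by (intro mult_left_mono) auto
    with C(2)[OF 0(1), of 0 k t x] C(2)[OF 0(1), of "Suc 0" k t x] show ?case unfolding pdW by simp
  next
    case (Suc n)
    define w where "w = 2 * C * (1/2) ^ n"
    have w0: "0 \<le> w" unfolding w_def using C by simp
    have fb: "wt 0 x * \<bar>pd ks (\<lambda>x. adv (W n) (?U (Suc n)) k s x + adv (?U n) (W n) k s x) x\<bar> \<le> (2 * ?d * 2 ^ N * C * w) * exp (l * s)"
      if ks: "length ks \<le> N" and s: "s \<in> {0..T}" for ks s x
    proof -
      have IH: "\<bar>pd bs (W n j s) x\<bar> \<le> w * exp (l * s)" if "length bs \<le> Suc N" for bs j x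
        unfolding w_def by (rule Suc.IH[OF that s])
      have two: "(2::real) ^ length ks \<le> 2 ^ N" using ks by (intro power_increasing) auto
      have we: "0 \<le> w * exp (l * s)" using w0 by simp
      have 1: "\<bar>pd ks (\<lambda>x. W n j s x * partial j (?U (Suc n) k s) x) x\<bar> \<le> 2 ^ N * (w * exp (l * s) * C)" for j
      proof -
        have "1 * 1 * \<bar>pd ks (\<lambda>x. W n j s x * partial j (?U (Suc n) k s) x) x\<bar> \<le> 2 ^ length ks * (w * exp (l * s) * C)"
        proof (rule pd_mult_bound)
          show "1 * \<bar>pd as (W n j s) x\<bar> \<le> w * exp (l * s)" if "length as \<le> length ks" for as x
            using IH[of as j x] that ks by simp
          show "1 * \<bar>pd bs (partial j (?U (Suc n) k s)) x\<bar> \<le> C" if "length bs \<le> length ks" for bs x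
            using C(2)[of "bs @ [j]" "Suc n" k s x] that ks by (simp del: picard.simps)
        qed (auto intro: smooth_partial reg_smooth U W we simp del: picard.simps)
        also have "\<dots> \<le> 2 ^ N * (w * exp (l * s) * C)"
          using two we C by (intro mult_right_mono) auto
        finally show ?thesis by simp
      qed
      have 2: "\<bar>pd ks (\<lambda>x. ?U n j s x * partial j (W n k s) x) x\<bar> \<le> 2 ^ N * (w * exp (l * s) * C)" for j
      proof -
        have "1 * 1 * \<bar>pd ks (\<lambda>x. ?U n j s x * partial j (W n k s) x) x\<bar> \<le> 2 ^ length ks * (C * (w * exp (l * s)))"
        proof (rule pd_mult_bound)
          show "1 * \<bar>pd as (?U n j s) x\<bar> \<le> C" if "length as \<le> length ks" for as x
            using C(2)[of as n j s x] that ks by simp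
          show "1 * \<bar>pd bs (partial j (W n k s)) x\<bar> \<le> w * exp (l * s)" if "length bs \<le> length ks" for bs x
            using IH[of "bs @ [j]" k x] that ks by simp
        qed (auto intro: smooth_partial reg_smooth U W C)
        also have "\<dots> \<le> 2 ^ N * (C * (w * exp (l * s)))"
          using two we C by (intro mult_right_mono) auto
        finally show ?thesis by (simp add: mult_ac)
      qed
      have "\<bar>pd ks (adv (W n) (?U (Suc n)) k s) x\<bar> \<le> (\<Sum>j\<in>(UNIV::'n set). 2 ^ N * (w * exp (l * s) * C))"
        unfolding pd_adv[of "W n" "?U (Suc n)" k, OF W U] by (intro order_trans[OF sum_abs] sum_mono 1)
      moreover have "\<bar>pd ks (adv (?U n) (W n) k s) x\<bar> \<le> (\<Sum>j\<in>(UNIV::'n set). 2 ^ N * (w * exp (l * s) * C))"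
        unfolding pd_adv[of "?U n" "W n" k, OF U W] by (intro order_trans[OF sum_abs] sum_mono 2)
      moreover have "pd ks (\<lambda>x. adv (W n) (?U (Suc n)) k s x + adv (?U n) (W n) k s x) x =
          pd ks (adv (W n) (?U (Suc n)) k s) x + pd ks (adv (?U n) (W n) k s) x"
        by (subst pd_add) (auto intro: reg_smooth reg_adv U W simp del: picard.simps)
      ultimately have "wt 0 x * \<bar>pd ks (\<lambda>x. adv (W n) (?U (Suc n)) k s x + adv (?U n) (W n) k s x) x\<bar>
          \<le> 2 * (?d * (2 ^ N * (w * exp (l * s) * C)))" by simp
      then show ?thesis by (simp add: mult_ac)
    qed
    have "wt 0 x * \<bar>pd js (W (Suc n) k t) x\<bar> \<le> ?A * q * (2 * ?d * 2 ^ N * C * w) * exp (l * t)"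
      unfolding WS
      by (rule duh_pd_estimate[OF _ T q(1) fb Suc.prems(2,1)]) (intro reg_add reg_adv U W)
    also have "?A * q * (2 * ?d * 2 ^ N * C * w) = D * q * w" by (simp add: D_def)
    also have "D * q * w * exp (l * t) \<le> 1 / 2 * w * exp (l * t)"
      using qh w0 by (intro mult_right_mono) auto
    finally show ?case by (simp add: w_def)
  qed
  have "\<bar>pd js (?U (Suc n) k t) x - pd js (?U n k t) x\<bar> \<le> 2 * C * exp (l * T) * (1/2) ^ n"
    if "length js \<le> N" for n k js t x
  proof -
    let ?t = "clamp_time T t"
    have t: "?t \<in> {0..T}" using clamp_time_mem T by simp
    have "\<bar>pd js (?U (Suc n) k t) x - pd js (?U n k t) x\<bar> = \<bar>pd js (W n k ?t) x\<bar>"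
      unfolding pdW using picard_clamp[of T a _ k t] T by (metis less_imp_le)
    also have "\<dots> \<le> 2 * C * (1/2) ^ n * exp (l * ?t)" using that t by (intro main) auto
    also have "\<dots> \<le> 2 * C * (1/2) ^ n * exp (l * T)"
      using t lq C by (intro mult_left_mono) (auto intro: mult_left_mono)
    finally show ?thesis by (simp add: mult_ac)
  qed
  then show ?thesis using C by (intro exI[of _ "2 * C * exp (l * T)"]) auto
qed

section \<open>Passage to the limit\<close>

lemma geometric_limit:
  fixes s :: "nat \<Rightarrow> real"
  assumes s: "\<And>n. \<bar>s (Suc n) - s n\<bar> \<le> K * (1/2) ^ n"
  shows "s \<longlonglongrightarrow> lim s" and "\<bar>s n - lim s\<bar> \<le> 2 * K * (1/2) ^ n"
proof -
  \<comment> \<open>Subtracting the tail 2 K (1/2)^(n + k) gives the geometric sum its exact value,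
    which lets the induction on k close.\<close>
  have d: "\<bar>s (n + k) - s n\<bar> \<le> 2 * K * (1/2) ^ n - 2 * K * (1/2) ^ (n + k)" for n k
  proof (induction k)
    case (Suc k)
    have "\<bar>s (n + Suc k) - s n\<bar> \<le> \<bar>s (Suc (n + k)) - s (n + k)\<bar> + \<bar>s (n + k) - s n\<bar>"
      using abs_triangle_ineq[of "s (Suc (n + k)) - s (n + k)" "s (n + k) - s n"] by simp
    also have "\<dots> \<le> K * (1/2) ^ (n + k) + (2 * K * (1/2) ^ n - 2 * K * (1/2) ^ (n + k))"
      by (intro add_mono s Suc)
    finally show ?case by simp
  qed simp
  have K: "0 \<le> K" using s[of 0] by simp
  have "summable (\<lambda>n. s (Suc n) - s n)"
  proof (rule summable_comparison_test')
    show "summable (\<lambda>n. K * (1/2) ^ n)" by (intro summable_mult summable_geometric) auto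
    show "norm (s (Suc n) - s n) \<le> K * (1/2) ^ n" if "n \<ge> 0" for n using s by simp
  qed
  then have "convergent (\<lambda>n. \<Sum>i<n. s (Suc i) - s i)" by (simp add: summable_iff_convergent)
  then have "convergent (\<lambda>n. s n - s 0)" by (simp add: sum_lessThan_telescope)
  then have "convergent s" by (simp add: convergent_diff_const_right_iff)
  then show l: "s \<longlonglongrightarrow> lim s" by (simp add: convergent_LIMSEQ_iff)
  have "(\<lambda>k. \<bar>s n - s (n + k)\<bar>) \<longlonglongrightarrow> \<bar>s n - lim s\<bar>"
    using LIMSEQ_ignore_initial_segment[OF l, of n] by (intro tendsto_intros) (simp add: add.commute)
  moreover have "\<bar>s n - s (n + k)\<bar> \<le> 2 * K * (1/2) ^ n" for k
  proof -
    have "0 \<le> 2 * K * (1/2) ^ (n + k)" using K by simp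
    then show ?thesis using d[of n k] by linarith
  qed
  ultimately show "\<bar>s n - lim s\<bar> \<le> 2 * K * (1/2) ^ n" by (intro LIMSEQ_le_const2) auto
qed

text \<open>Every derivative converges uniformly, so each candidate \<open>V js\<close> is
  differentiable and its partial derivatives are the candidates for the longer lists.\<close>

lemma
  fixes f :: "nat \<Rightarrow> real^'n::finite \<Rightarrow> real"
  assumes f: "\<And>n. smooth (f n)"
    and V: "\<And>js. \<exists>K. \<forall>n x. \<bar>pd js (f n) x - V js x\<bar> \<le> K * (1/2) ^ n"
  shows smooth_limit: "smooth (V [])" and pd_limit: "pd js (V []) = V js"
proof -
  obtain K where K: "\<And>js n x. \<bar>pd js (f n) x - V js x\<bar> \<le> K js * (1/2) ^ n" using V by metis
  have K0: "0 \<le> K js" for js using order_trans[OF abs_ge_zero K[of js 0 0]] by simp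
  have z: "(\<lambda>n. c * (1/2) ^ n) \<longlonglongrightarrow> 0" for c :: real
    using tendsto_mult_right_zero[OF LIMSEQ_power_zero[of "1/2::real"]] by simp
  have lim: "(\<lambda>n. pd js (f n) x) \<longlonglongrightarrow> V js x" for js x
    by (rule LIM_zero_cancel, rule Lim_null_comparison[OF _ z[of "K js"]]) (use K in auto)
  have der: "(V js has_derivative (\<lambda>h. \<Sum>i\<in>UNIV. h $ i * V (i # js) x)) (at x)" for js x
  proof -
    define B where "B = (\<Sum>i\<in>UNIV. K (i # js))"
    have KB: "K (i # js) \<le> B" for i unfolding B_def by (intro member_le_sum) (auto intro: K0)
    have "\<exists>g. \<forall>x\<in>UNIV. (\<lambda>n. pd js (f n) x) \<longlonglongrightarrow> g x \<and>
        (g has_derivative (\<lambda>h. \<Sum>i\<in>UNIV. h $ i * V (i # js) x)) (at x within UNIV)"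
    proof (rule has_derivative_sequence)
      show "(pd js (f n) has_derivative (\<lambda>h. \<Sum>i\<in>UNIV. h $ i * partial i (pd js (f n)) x)) (at x within UNIV)" for n x
        using smooth_has_derivative[OF smooth_pd[OF f]] by simp
      show "(\<lambda>n. pd js (f n) 0) \<longlonglongrightarrow> V js 0" by (rule lim)
      fix e :: real assume e: "e > 0"
      have "\<forall>\<^sub>F n in sequentially. real CARD('n) * B * (1/2) ^ n < e"
        using order_tendstoD(2)[OF z e] by simp
      then show "\<forall>\<^sub>F n in sequentially. \<forall>x\<in>UNIV. \<forall>h.
          norm ((\<Sum>i\<in>UNIV. h $ i * partial i (pd js (f n)) x) - (\<Sum>i\<in>UNIV. h $ i * V (i # js) x)) \<le> e * norm h"
      proof eventually_elim
        case (elim n)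
        show ?case
        proof (intro ballI allI)
          fix x h :: "real^'n"
          have b: "\<bar>partial i (pd js (f n)) x - V (i # js) x\<bar> \<le> B * (1/2) ^ n" for i
            using order_trans[OF K[of "i # js" n x] mult_right_mono[OF KB]] by simp
          have "norm ((\<Sum>i\<in>UNIV. h $ i * partial i (pd js (f n)) x) - (\<Sum>i\<in>UNIV. h $ i * V (i # js) x))
              = \<bar>\<Sum>i\<in>UNIV. h $ i * (partial i (pd js (f n)) x - V (i # js) x)\<bar>"
            by (simp add: sum_subtractf right_diff_distrib)
          also have "\<dots> \<le> real CARD('n) * (B * (1/2) ^ n) * norm h" by (rule abs_sum_component_le[OF b])
          also have "\<dots> \<le> e * norm h" using elim by (intro mult_right_mono) auto
          finally show "norm ((\<Sum>i\<in>UNIV. h $ i * partial i (pd js (f n)) x) - (\<Sum>i\<in>UNIV. h $ i * V (i # js) x)) \<le> e * norm h" .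
        qed
      qed
    qed auto
    then obtain g where g: "\<And>x. (\<lambda>n. pd js (f n) x) \<longlonglongrightarrow> g x"
      "\<And>x. (g has_derivative (\<lambda>h. \<Sum>i\<in>UNIV. h $ i * V (i # js) x)) (at x)" by auto
    have "g = V js" using LIMSEQ_unique[OF g(1) lim] by (rule ext)
    with g(2) show ?thesis by simp
  qed
  have eq: "pd js (V []) = V js" for js
  proof (induction js)
    case (Cons i js)
    have "partial i (V js) x = V (i # js) x" for x
      by (subst partialI[OF der]) (simp add: axis_def if_distrib if_distribR sum.delta cong: if_cong)
    then show ?case using Cons by (auto intro!: ext)
  qed simp
  show "pd js (V []) = V js" by (rule eq)
  show "smooth (V [])" unfolding smooth_def eq
    by (intro allI differentiable_at_imp_differentiable_on differentiableI[OF der])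
qed

text \<open>The iterates converge in unweighted sup norms only. The decay of the limit comes from
  weighted bounds that are uniform in n and hold for pointwise limits, continuity comes from uniform
  convergence, and the equation from dominated convergence in the Duhamel term.\<close>

lemma mild_solution:
  fixes a :: "'n::finite \<Rightarrow> real^'n \<Rightarrow> real"
  assumes a: "\<And>k. a k \<in> schwartz"
  obtains T U where "0 < T" "T \<le> 1" "\<And>k. reg (U k)"
    "\<And>k t x. U k t x = a k x + duh T (forcing a U k) t x"
proof -
  obtain T R where T: "0 < T" "T \<le> 1" and R: "\<And>n k t x. t \<in> {0..T} \<Longrightarrow> \<bar>picard T a n k t x\<bar> \<le> R" "0 \<le> R"
    using picard_base_bound[of a, OF a] by metis
  define V where "V js k t x = lim (\<lambda>n. pd js (picard T a n k t) x)" for js k t x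
  define U where "U k t = V [] k t" for k t
  obtain K where K: "\<And>N. 0 \<le> K N" "\<And>N n k js t x. length js \<le> N \<Longrightarrow>
      \<bar>pd js (picard T a (Suc n) k t) x - pd js (picard T a n k t) x\<bar> \<le> K N * (1/2) ^ n"
    using picard_differences[OF a T R] by metis
  have lim: "(\<lambda>n. pd js (picard T a n k t) x) \<longlonglongrightarrow> V js k t x" for js k t x
    unfolding V_def by (rule geometric_limit(1)[OF K(2)[OF order_refl]])
  have unif: "\<bar>pd js (picard T a n k t) x - V js k t x\<bar> \<le> 2 * K (length js) * (1/2) ^ n" for js n k t x
    unfolding V_def by (rule geometric_limit(2)[OF K(2)[OF order_refl]])
  have P: "reg (picard T a n k)" for n k by (rule reg_picard[OF a T])
  have sU: "smooth (U k t)" and pU: "pd js (U k t) = V js k t" for js k t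
    unfolding U_def using unif
    by (intro smooth_limit[of "\<lambda>n. picard T a n k t" "\<lambda>js. V js k t"] pd_limit[of "\<lambda>n. picard T a n k t" "\<lambda>js. V js k t"]
        reg_smooth[OF P]; blast)+
  have bd: "\<exists>C\<ge>0. \<forall>n k t x. wt m x * \<bar>pd js (picard T a n k t) x\<bar> \<le> C" for m js
    using picard_bounds[OF a T R, of "length js" m] by blast
  have U: "reg (U k)" for k
    unfolding reg_def pU
  proof (intro conjI allI sU)
    fix js
    show "continuous_on UNIV (\<lambda>p. V js k (fst p) (snd p))"
    proof (rule uniform_limit_theorem[where f="\<lambda>n p. pd js (picard T a n k (fst p)) (snd p)" and F=sequentially])
      show "uniform_limit UNIV (\<lambda>n p. pd js (picard T a n k (fst p)) (snd p)) (\<lambda>p. V js k (fst p) (snd p)) sequentially"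
      proof (rule uniform_limitI)
        fix e :: real assume e: "e > 0"
        have "(\<lambda>n. 2 * K (length js) * (1/2) ^ n) \<longlonglongrightarrow> 0"
          using tendsto_mult_right_zero[OF LIMSEQ_power_zero[of "1/2::real"]] by simp
        from order_tendstoD(2)[OF this e]
        show "\<forall>\<^sub>F n in sequentially. \<forall>p\<in>UNIV. dist (pd js (picard T a n k (fst p)) (snd p)) (V js k (fst p) (snd p)) < e"
          by eventually_elim (auto simp: dist_real_def intro: le_less_trans[OF unif])
      qed
    qed (auto intro!: always_eventually reg_continuous P)
    fix m
    obtain C where C: "\<And>n k t x. wt m x * \<bar>pd js (picard T a n k t) x\<bar> \<le> C" using bd by blast
    have "wt m x * \<bar>V js k t x\<bar> \<le> C" for t x
      by (rule LIMSEQ_le_const2[OF tendsto_mult_left[OF tendsto_rabs[OF lim]]]) (use C in auto)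
    then show "\<exists>C. \<forall>t x. wt m x * \<bar>V js k t x\<bar> \<le> C" by blast
  qed
  have eq: "U k t x = a k x + duh T (forcing a U k) t x" for k t x
  proof -
    have limF: "(\<lambda>n. forcing a (picard T a n) k t x) \<longlonglongrightarrow> forcing a U k t x" for t x
      unfolding forcing_def adv_def
      using lim[of "[]", folded U_def] lim[of "[_]" k t x, folded pU] by (intro tendsto_intros) auto
    obtain L where L: "\<And>js x. length js \<le> 0 \<Longrightarrow> wt 0 x * \<bar>pd js (half_laplace (a k)) x\<bar> \<le> L"
      using schwartz_bound_upto[OF schwartz_half_laplace[OF a]] by metis
    obtain C0 where C0: "C0 \<ge> 0" "\<And>n k t x. wt 0 x * \<bar>pd [] (picard T a n k t) x\<bar> \<le> C0" using bd by blast
    obtain C1 where C1: "\<And>j n k t x. wt 0 x * \<bar>pd [j] (picard T a n k t) x\<bar> \<le> C1 j" using bd[of 0 "[_]"] by metis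
    have "\<bar>forcing a (picard T a n) k t x\<bar> \<le> L + (\<Sum>j\<in>UNIV. C0 * C1 j)" for n t x
    proof -
      have "\<bar>picard T a n j t x * partial j (picard T a n k t) x\<bar> \<le> C0 * C1 j" for j
        unfolding abs_mult using C0 C1[of x j n k t] by (intro mult_mono) auto
      then have "\<bar>adv (picard T a n) (picard T a n) k t x\<bar> \<le> (\<Sum>j\<in>UNIV. C0 * C1 j)"
        unfolding adv_def by (intro order_trans[OF sum_abs] sum_mono)
      then show ?thesis using L[of "[]" x] by (simp add: forcing_def)
    qed
    from duh_tendsto[OF reg_forcing[where a=a, OF a P] reg_forcing[where a=a, OF a U] this limF]
    have "(\<lambda>n. picard T a (Suc n) k t x) \<longlonglongrightarrow> a k x + duh T (forcing a U k) t x"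
      by (simp add: tendsto_add)
    moreover have "(\<lambda>n. picard T a (Suc n) k t x) \<longlonglongrightarrow> U k t x"
      using LIMSEQ_Suc[OF lim[of "[]" k t x]] by (simp add: U_def)
    ultimately show ?thesis using LIMSEQ_unique by blast
  qed
  show ?thesis by (rule that[OF T U eq])
qed

subsection \<open>The mild solution solves the integral equation\<close>

text \<open>The heat semigroup at time \<theta>^2. In the variable \<theta> it is differentiable at
  0 as well, and the chain rule with sqrt is then applied at positive times only.\<close>

definition gavg :: "(real^'n::finite \<Rightarrow> real) \<Rightarrow> real \<Rightarrow> real^'n \<Rightarrow> real"
  where "gavg f \<theta> x = (LBINT y. heat y * f (x + \<theta> *\<^sub>R y))"

lemma bounded_heat_integrable:
  assumes [measurable]: "f \<in> borel_measurable borel" and "\<And>y. \<bar>f y\<bar> \<le> B * wt m y"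
  shows "integrable lborel (\<lambda>y. heat y * f y)"
proof (rule Bochner_Integration.integrable_bound[OF integrable_mult_right[OF integrable_wt_heat[of m], of B]])
  show "AE y in lborel. norm (heat y * f y) \<le> norm (B * (wt m y * heat y))"
  proof (rule AE_I2)
    fix y
    have "heat y * \<bar>f y\<bar> \<le> heat y * (B * wt m y)" by (intro mult_left_mono assms) auto
    then show "norm (heat y * f y) \<le> norm (B * (wt m y * heat y))"
      using abs_ge_self[of "B * (wt m y * heat y)"] by (simp add: abs_mult mult_ac)
  qed
qed simp

lemma gavg_continuous:
  fixes F :: "real \<Rightarrow> real^'n::finite \<Rightarrow> real"
  assumes F: "reg F"
  shows "continuous_on UNIV (\<lambda>p. gavg (F (fst p)) (snd p) x)"
proof (rule continuous_on_sequentiallyI)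
  fix u :: "nat \<Rightarrow> real \<times> real" and a assume u: "u \<longlonglongrightarrow> a"
  obtain B where B: "\<And>t x. wt 0 x * \<bar>pd [] (F t) x\<bar> \<le> B" using reg_bound[OF F] by metis
  have c: "continuous_on UNIV (\<lambda>p. F (fst p) (snd p))" using reg_continuous[OF F, of "[]"] by simp
  have m: "F s \<in> borel_measurable borel" for s by (rule smooth_measurable[OF reg_smooth[OF F]])
  show "(\<lambda>n. gavg (F (fst (u n))) (snd (u n)) x) \<longlonglongrightarrow> gavg (F (fst a)) (snd a) x"
    unfolding gavg_def
  proof (rule integral_dominated_convergence[where w="\<lambda>y. heat y * B"])
    show "AE y in lborel. (\<lambda>n. heat y * F (fst (u n)) (x + snd (u n) *\<^sub>R y)) \<longlonglongrightarrow> heat y * F (fst a) (x + snd a *\<^sub>R y)"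
    proof (intro AE_I2 tendsto_mult_left)
      fix y
      have "(\<lambda>n. (fst (u n), x + snd (u n) *\<^sub>R y)) \<longlonglongrightarrow> (fst a, x + snd a *\<^sub>R y)"
        by (intro tendsto_intros u)
      from continuous_on_tendsto_compose[OF c this] 
      show "(\<lambda>n. F (fst (u n)) (x + snd (u n) *\<^sub>R y)) \<longlonglongrightarrow> F (fst a) (x + snd a *\<^sub>R y)" by simp
    qed
    show "AE y in lborel. norm (heat y * F (fst (u n)) (x + snd (u n) *\<^sub>R y)) \<le> heat y * B" for n
      using B by (intro AE_I2) (auto simp: abs_mult intro!: mult_left_mono)
    show "integrable lborel (\<lambda>y::real^'n. heat y * B)" by (intro integrable_mult_left integrable_heat)
  qed (use m in measurable)
qed

lemma gavg_0: "gavg f 0 x = f x"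
  by (simp add: gavg_def integral_heat)

text \<open>Differentiation brings down y_i times the i-th derivative of f, and Gaussian integration
  by parts exchanges y_i for \<theta> and a second derivative. The sum is \<theta> \<Delta> f = 2
  \<theta> (\<Delta> / 2) f.\<close>

lemma gavg_derivative:
  fixes f :: "real^'n::finite \<Rightarrow> real"
  assumes f: "f \<in> schwartz"
  shows "((\<lambda>\<theta>. gavg f \<theta> x) has_real_derivative 2 * \<theta> * gavg (half_laplace f) \<theta> x) (at \<theta>)"
proof -
  have s: "smooth (pd js f)" for js by (intro smooth_pd schwartz_smooth f)
  obtain B where B: "0 \<le> B" "\<And>js x. length js \<le> 2 \<Longrightarrow> wt 0 x * \<bar>pd js f x\<bar> \<le> B"
    using schwartz_bound_upto[OF f] by metis
  have aff: "((\<lambda>\<theta>. x + \<theta> *\<^sub>R y) has_derivative (\<lambda>h. h *\<^sub>R y)) (at \<theta>)" for y \<theta>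
    by (auto intro!: derivative_eq_intros)
  have ms: "(\<lambda>y. pd js f (x + \<theta> *\<^sub>R y)) \<in> borel_measurable borel" for js \<theta>
    using smooth_measurable[OF s[of js]] by measurable
  have mc [measurable]: "(\<lambda>y::real^'n. y $ i) \<in> borel_measurable borel" for i
    by (intro borel_measurable_continuous_onI continuous_intros)
  have int: "integrable lborel (\<lambda>y. heat y * (y $ i * pd js f (x + \<theta> *\<^sub>R y)))" if "length js \<le> 2" for i js
  proof (rule bounded_heat_integrable[where B=B and m=1])
    show "(\<lambda>y. y $ i * pd js f (x + \<theta> *\<^sub>R y)) \<in> borel_measurable borel" using ms[of js] by measurable
    show "\<bar>y $ i * pd js f (x + \<theta> *\<^sub>R y)\<bar> \<le> B * wt 1 y" for y
      using mult_mono[OF component_le_norm_cart[of y i] B(2)[OF that, of "x + \<theta> *\<^sub>R y"]] B(1)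
      by (simp add: abs_mult wt_def algebra_simps)
  qed
  have d: "((\<lambda>\<theta>. gavg f \<theta> x) has_derivative
      (\<lambda>h. LBINT y. heat y * (\<Sum>i\<in>UNIV. (h *\<^sub>R y) $ i * partial i f (x + \<theta> *\<^sub>R y)))) (at \<theta>)"
    unfolding gavg_def
  proof (rule has_derivative_integral[where W="\<lambda>y. real CARD('n) * B * (wt 1 y * heat y)"])
    show "integrable lborel (\<lambda>y. heat y * f (x + \<theta> *\<^sub>R y))" for \<theta>
      using B(2)[of "[]"] ms[of "[]" \<theta>] by (intro bounded_heat_integrable[where B=B and m=0]) auto
    show "((\<lambda>\<theta>. heat y * f (x + \<theta> *\<^sub>R y)) has_derivative
        (\<lambda>h. heat y * (\<Sum>i\<in>UNIV. (h *\<^sub>R y) $ i * partial i f (x + \<theta> *\<^sub>R y)))) (at \<theta>)" for y \<theta>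
      by (intro has_derivative_mult_right has_derivative_compose[OF aff smooth_has_derivative[OF schwartz_smooth[OF f]]])
    show "(\<lambda>y. heat y * (\<Sum>i\<in>UNIV. (h *\<^sub>R y) $ i * partial i f (x + \<theta> *\<^sub>R y))) \<in> borel_measurable lborel" for h
      using ms[of "[_]"] by simp
    show "integrable lborel (\<lambda>y::real^'n. real CARD('n) * B * (wt 1 y * heat y))"
      by (intro integrable_mult_right integrable_wt_heat)
    fix y :: "real^'n" and \<theta> h :: real
    have "\<bar>\<Sum>i\<in>UNIV. (h *\<^sub>R y) $ i * partial i f (x + \<theta> *\<^sub>R y)\<bar> \<le> real CARD('n) * B * norm (h *\<^sub>R y)"
      by (rule abs_sum_component_le) (use B(2)[of "[_]"] in simp)
    also have "\<dots> \<le> real CARD('n) * B * (\<bar>h\<bar> * wt 1 y)"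
      using B(1) by (intro mult_left_mono) (auto simp: wt_def mult_left_mono)
    finally have "heat y * \<bar>\<Sum>i\<in>UNIV. (h *\<^sub>R y) $ i * partial i f (x + \<theta> *\<^sub>R y)\<bar> \<le> heat y * (real CARD('n) * B * (\<bar>h\<bar> * wt 1 y))"
      by (intro mult_left_mono) auto
    then show "\<bar>heat y * (\<Sum>i\<in>UNIV. (h *\<^sub>R y) $ i * partial i f (x + \<theta> *\<^sub>R y))\<bar> \<le> real CARD('n) * B * (wt 1 y * heat y) * norm h"
      by (simp add: abs_mult mult_ac)
  qed
  have ibp: "(LBINT y. heat y * (y $ i * partial i f (x + \<theta> *\<^sub>R y))) = \<theta> * gavg (partial i (partial i f)) \<theta> x" for i
  proof -
    let ?g = "\<lambda>y. partial i f (\<theta> *\<^sub>R y + x)"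
    have pg: "partial i ?g = (\<lambda>y. \<theta> * partial i (partial i f) (\<theta> *\<^sub>R y + x))"
      using partial_affine[OF s[of "[i]"], of i \<theta> x] by simp
    have "(LBINT y. ?g y * partial i heat y) = - (LBINT y. partial i ?g y * heat y)"
    proof (rule integral_by_parts[where A="B + \<bar>\<theta>\<bar> * B"])
      show "smooth ?g" using smooth_affine[OF s[of "[i]"], of \<theta> x] by simp
      show "\<bar>?g y\<bar> \<le> B + \<bar>\<theta>\<bar> * B" for y
        using B(2)[of "[i]" "\<theta> *\<^sub>R y + x"] B(1) by (simp add: add_increasing2)
      show "\<bar>partial i ?g y\<bar> \<le> B + \<bar>\<theta>\<bar> * B" for y
        unfolding pg abs_mult using mult_left_mono[OF B(2)[of "[i, i]" "\<theta> *\<^sub>R y + x"], of "\<bar>\<theta>\<bar>"] B(1)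
        by simp
    qed (rule heat_schwartz)
    then show ?thesis unfolding pg partial_heat gavg_def by (simp add: mult_ac add.commute)
  qed
  have hl: "gavg (half_laplace f) \<theta> x = 1/2 * (\<Sum>i\<in>UNIV. gavg (partial i (partial i f)) \<theta> x)"
  proof -
    have "integrable lborel (\<lambda>y. heat y * partial i (partial i f) (x + \<theta> *\<^sub>R y))" for i
      using B(2)[of "[i,i]"] ms[of "[i,i]" \<theta>] by (intro bounded_heat_integrable[where B=B and m=0]) auto
    then show ?thesis unfolding gavg_def half_laplace_def
      by (simp add: sum_distrib_left mult.left_commute[of "heat _"] Bochner_Integration.integral_sum flip: sum_divide_distrib)
  qed
  have "(LBINT y. heat y * (\<Sum>i\<in>UNIV. (h *\<^sub>R y) $ i * partial i f (x + \<theta> *\<^sub>R y))) = 2 * \<theta> * gavg (half_laplace f) \<theta> x * h" for h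
  proof -
    have "(LBINT y. heat y * (\<Sum>i\<in>UNIV. (h *\<^sub>R y) $ i * partial i f (x + \<theta> *\<^sub>R y)))
        = (LBINT y. (\<Sum>i\<in>UNIV. h * (heat y * (y $ i * partial i f (x + \<theta> *\<^sub>R y)))))"
      by (simp add: sum_distrib_left mult_ac)
    also have "\<dots> = (\<Sum>i\<in>UNIV. h * (LBINT y. heat y * (y $ i * partial i f (x + \<theta> *\<^sub>R y))))"
      using int[of "[_]"] by (subst Bochner_Integration.integral_sum) auto
    also have "\<dots> = 2 * \<theta> * gavg (half_laplace f) \<theta> x * h"
      unfolding ibp hl by (simp add: sum_distrib_left sum_distrib_right mult_ac)
    finally show ?thesis .
  qed
  with d show ?thesis by (simp add: has_field_derivative_def)
qed

text \<open>The heat equation in integrated form. Under \<theta> = sqrt \<rho> the factor 2 \<theta>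
  cancels against the derivative of the root; the fundamental theorem is used in the version for
  interior points because sqrt is not differentiable at 0.\<close>

lemma gavg_integral:
  fixes F :: "real \<Rightarrow> real^'n::finite \<Rightarrow> real"
  assumes F: "reg F" and r: "0 \<le> r"
  shows "gavg (F s) (sqrt r) x = F s x + (LBINT \<rho>. indicator {0..r} \<rho> * gavg (half_laplace (F s)) (sqrt \<rho>) x)"
proof -
  let ?h = "\<lambda>\<rho>. gavg (half_laplace (F s)) (sqrt \<rho>) x"
  have c: "continuous_on UNIV (\<lambda>\<rho>. gavg (G s) (sqrt \<rho>) x)" if "reg G" for G :: "real \<Rightarrow> real^'n \<Rightarrow> real"
    using continuous_on_compose2[OF gavg_continuous[OF that], OF continuous_on_Pair[OF continuous_on_const continuous_on_real_sqrt[OF continuous_on_id]]]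
    by simp
  have "(?h has_integral gavg (F s) (sqrt r) x - gavg (F s) (sqrt 0) x) {0..r}"
  proof (rule fundamental_theorem_of_calculus_interior[OF r])
    show "continuous_on {0..r} (\<lambda>\<rho>. gavg (F s) (sqrt \<rho>) x)"
      using c[OF F] continuous_on_subset by blast
    fix \<rho> assume "\<rho> \<in> {0<..<r}"
    then have \<rho>: "0 < \<rho>" by simp
    have "((\<lambda>\<rho>. gavg (F s) (sqrt \<rho>) x) has_real_derivative 2 * sqrt \<rho> * ?h \<rho> * (inverse (sqrt \<rho>) / 2)) (at \<rho>)"
      by (rule DERIV_chain2[OF gavg_derivative[OF reg_schwartz[OF F]] DERIV_real_sqrt[OF \<rho>]])
    then show "((\<lambda>\<rho>. gavg (F s) (sqrt \<rho>) x) has_vector_derivative ?h \<rho>) (at \<rho>)"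
      using \<rho> by (simp add: has_real_derivative_iff_has_vector_derivative field_simps)
  qed
  then have 1: "integral {0..r} ?h = gavg (F s) (sqrt r) x - F s x"
    by (simp add: gavg_0 integral_unique)
  have "continuous_on {0..r} ?h" using c[OF reg_half_laplace[OF F]] continuous_on_subset by blast
  then have "set_integrable lborel {0..r} ?h"
    unfolding set_integrable_def by (rule borel_integrable_atLeastAtMost'[unfolded set_integrable_def])
  from set_borel_integral_eq_integral(2)[OF this] 1
  show ?thesis by (simp add: set_lebesgue_integral_def)
qed

text \<open>Undoes the rescaling by s = t - t \<sigma>; the interval (0, 1] of \<open>rho\<close>
  corresponds to [0, t).\<close>

lemma duh_as_time_integral:
  fixes F :: "real \<Rightarrow> real^'n::finite \<Rightarrow> real"
  assumes F: "reg F" and t: "t \<in> {0..T}"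
  shows "duh T F t x = (LBINT s. indicator {0..<t} s * gavg (F s) (sqrt (t - s)) x)"
proof (cases "t = 0")
  case True
  then show ?thesis using t by (simp add: duh_def)
next
  case False
  then have t0: "0 < t" using t by simp
  obtain B where B: "\<And>t x. wt 0 x * \<bar>pd [] (F t) x\<bar> \<le> B" using reg_bound[OF F] by metis
  have i: "integrable lborel (\<lambda>z. duh_ker z * F (clamp_time T t * (1 - fst z)) (x + sqrt (clamp_time T t * fst z) *\<^sub>R snd z))"
    by (rule kop_integrable[OF kernel_duh_ker, where B=B]) (use B reg_continuous[OF F, of "[]"] in auto)
  have "(LBINT s. indicator {0..<t} s * gavg (F s) (sqrt (t - s)) x) =
      \<bar>- t\<bar> *\<^sub>R (LBINT \<sigma>. indicator {0..<t} (t + (- t) * \<sigma>) * gavg (F (t + (- t) * \<sigma>)) (sqrt (t - (t + (- t) * \<sigma>))) x)"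
    using t0 by (intro lborel_integral_real_affine) auto
  also have "\<dots> = t * (LBINT \<sigma>. (LBINT y. duh_ker (\<sigma>, y) * F (t * (1 - \<sigma>)) (x + sqrt (t * \<sigma>) *\<^sub>R y)))"
  proof -
    have "indicator {0..<t} (t + (- t) * \<sigma>) * gavg (F (t + (- t) * \<sigma>)) (sqrt (t - (t + (- t) * \<sigma>))) x =
        (LBINT y. duh_ker (\<sigma>, y) * F (t * (1 - \<sigma>)) (x + sqrt (t * \<sigma>) *\<^sub>R y))" for \<sigma>
    proof -
      have "t + (- t) * \<sigma> \<in> {0..<t} \<longleftrightarrow> \<sigma> \<in> {0<..1}" using t0 by (auto simp: field_simps zero_less_mult_iff)
      then have "indicator {0..<t} (t + (- t) * \<sigma>) = rho 0 \<sigma>" by (auto simp: rho_def indicator_def)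
      then show ?thesis
        by (simp add: gavg_def duh_ker_def mult.assoc right_diff_distrib)
    qed
    then show ?thesis using t0 by simp
  qed
  also have "\<dots> = duh T F t x"
    using integral_lborel_pair[OF i] t by (simp add: duh_def kop_def)
  finally show ?thesis by simp
qed

lemma duh_half_laplace:
  assumes F: "reg F" and T: "0 < T" "T \<le> 1"
  shows "half_laplace (duh T F t) x = duh T (\<lambda>s. half_laplace (F s)) t x"
proof -
  have p: "partial i (partial i (duh T F t)) = duh T (\<lambda>s. partial i (partial i (F s))) t" for i t
    using duh_pd[OF F, of "[i, i]" T t] by simp
  have add: "duh T (\<lambda>s y. F s y + G s y) t x = duh T F t x + duh T G t x" if "reg F" "reg G" for F G :: "real \<Rightarrow> real^'a \<Rightarrow> real"
    using duh_diff[OF reg_add[OF that] that(2), of T t x] by simp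
  have "duh T (\<lambda>s y. \<Sum>i\<in>A. partial i (partial i (F s)) y) t x = (\<Sum>i\<in>A. duh T (\<lambda>s. partial i (partial i (F s))) t x)" for A
  proof (induction A rule: infinite_finite_induct)
    case (insert i A)
    have "duh T (\<lambda>s y. partial i (partial i (F s)) y + (\<Sum>i\<in>A. partial i (partial i (F s)) y)) t x =
        duh T (\<lambda>s. partial i (partial i (F s))) t x + duh T (\<lambda>s y. \<Sum>i\<in>A. partial i (partial i (F s)) y) t x"
      by (rule add) (intro reg_sum reg_partial F)+
    with insert show ?case by simp
  qed (simp_all add: duh_def kop_def)
  moreover have "duh T (\<lambda>s y. 1/2 * G s y) t x = 1/2 * duh T G t x" for G
    by (simp add: duh_def kop_def mult.left_commute[of _ "1/2"])
  ultimately show ?thesis unfolding half_laplace_def p by simp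
qed

text \<open>By \<open>gavg_integral\<close>, the semigroup over time t - s changes F s by an
  integral over intermediate times r between s and t. Exchanging the order of integration on this
  triangle turns the integral over s at fixed r into the Duhamel operator, at time r, applied to
  half the Laplacian of F, and the Laplacian commutes with it.\<close>

lemma duh_integral_equation:
  fixes F :: "real \<Rightarrow> real^'n::finite \<Rightarrow> real"
  assumes F: "reg F" and T: "0 < T" "T \<le> 1" and t: "t \<in> {0..T}"
  shows "duh T F t x = (LBINT s. indicator {0..<t} s * (half_laplace (duh T F s) x + F s x))"
proof -
  define H where "H s \<rho> = gavg (half_laplace (F s)) (sqrt \<rho>) x" for s \<rho>
  have HL: "reg (\<lambda>s. half_laplace (F s))" by (rule reg_half_laplace[OF F])
  have cH: "continuous_on UNIV (\<lambda>p. H (fst p) (snd p))"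
  proof -
    have "continuous_on UNIV (\<lambda>p::real \<times> real. (fst p, sqrt (snd p)))" by (intro continuous_intros)
    from continuous_on_compose2[OF gavg_continuous[OF HL] this] show ?thesis unfolding H_def by simp
  qed
  obtain B where B: "0 \<le> B" "\<And>t x. wt 0 x * \<bar>pd [] (half_laplace (F t)) x\<bar> \<le> B" using reg_bound[OF HL] by metis
  have HB: "\<bar>H s \<rho>\<bar> \<le> B" for s \<rho>
  proof -
    have m: "half_laplace (F s) \<in> borel_measurable borel" by (rule smooth_measurable[OF reg_smooth[OF HL]])
    have "integrable lborel (\<lambda>y. heat y * half_laplace (F s) (x + sqrt \<rho> *\<^sub>R y))"
      by (rule bounded_heat_integrable[where B=B and m=0]) (use B(2) m in \<open>auto\<close>)
    then have "(LBINT y. norm (heat y * half_laplace (F s) (x + sqrt \<rho> *\<^sub>R y))) \<le> (LBINT y. heat (y::real^'n) * B)"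
      by (intro integral_mono integrable_norm integrable_mult_left integrable_heat)
         (use B(2) in \<open>auto simp: abs_mult intro!: mult_left_mono\<close>)
    then have "norm (H s \<rho>) \<le> (LBINT y. heat (y::real^'n) * B)"
      unfolding H_def gavg_def by (rule order_trans[OF integral_norm_bound])
    then show ?thesis by (simp add: integral_heat)
  qed
  define \<Phi> where "\<Phi> = (\<lambda>p. indicator {p. 0 \<le> fst p \<and> fst p < snd p \<and> snd p \<le> t} p * H (fst p) (snd p - fst p))"
  have m\<Phi>: "\<Phi> \<in> borel_measurable borel"
  proof -
    have "continuous_on UNIV (\<lambda>p::real \<times> real. (fst p, snd p - fst p))" by (intro continuous_intros)
    from continuous_on_compose2[OF cH this] have "(\<lambda>p. H (fst p) (snd p - fst p)) \<in> borel_measurable borel"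
      by (intro borel_measurable_continuous_onI) simp
    then show ?thesis unfolding \<Phi>_def by measurable
  qed
  have i\<Phi>: "integrable lborel \<Phi>"
  proof (rule Bochner_Integration.integrable_bound)
    show "integrable lborel (\<lambda>p::real \<times> real. B * indicator (cbox (0,0) (t,t)) p)"
      using emeasure_lborel_cbox_finite[of "(0::real,0::real)" "(t,t)"]
      by (intro integrable_mult_right integrable_real_indicator) auto
    show "AE p in lborel. norm (\<Phi> p) \<le> norm (B * indicator (cbox (0,0) (t,t)) p)"
    proof (rule AE_I2)
      fix p :: "real \<times> real"
      obtain u v where p: "p = (u, v)" by (cases p)
      show "norm (\<Phi> p) \<le> norm (B * indicator (cbox (0,0) (t,t)) p)"
      proof (cases "0 \<le> u \<and> u < v \<and> v \<le> t")
        case True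
        then have "p \<in> cbox (0,0) (t,t)" by (auto simp: p cbox_Pair_eq)
        then show ?thesis using True HB[of u "v - u"] B(1) by (simp add: \<Phi>_def p)
      qed (simp add: \<Phi>_def p)
    qed
  qed (use m\<Phi> in simp)
  have sq: "(LBINT s. (LBINT r. \<Phi> (s, r))) = (LBINT r. (LBINT s. \<Phi> (s, r)))"
    using lborel_pair.Fubini_integral[of "\<lambda>s r. \<Phi> (s, r)"] i\<Phi> by (simp add: lborel_prod)
  have in1: "(LBINT r. \<Phi> (s, r)) = indicator {0..<t} s * (gavg (F s) (sqrt (t - s)) x - F s x)" for s
  proof (cases "0 \<le> s \<and> s < t")
    case True
    have "(LBINT r. \<Phi> (s, r)) = (LBINT \<rho>. \<Phi> (s, s + 1 * \<rho>))"
      using lborel_integral_real_affine[of 1 "\<lambda>r. \<Phi> (s, r)" s] by simp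
    also have "\<dots> = (LBINT \<rho>. indicator {0..t - s} \<rho> * H s \<rho>)"
    \<comment> \<open>\<Phi> omits the diagonal r = s, that is \<rho> = 0, which the closed interval
      contains.\<close>
    proof (rule integral_discrete_difference[where X="{0}"])
      show "\<Phi> (s, s + 1 * \<rho>) = indicator {0..t - s} \<rho> * H s \<rho>" if "\<rho> \<notin> {0}" for \<rho>
        using True that by (auto simp: \<Phi>_def indicator_def)
    qed auto
    also have "\<dots> = gavg (F s) (sqrt (t - s)) x - F s x"
      unfolding H_def using gavg_integral[OF F, of "t - s" s x] True by simp
    finally show ?thesis using True by simp
  next
    case False
    then have "\<Phi> (s, r) = 0" for r by (auto simp: \<Phi>_def indicator_def)
    then show ?thesis using False by simp
  qed
  have in2: "(LBINT s. \<Phi> (s, r)) = indicator {0..t} r * half_laplace (duh T F r) x" for r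
  proof (cases "0 \<le> r \<and> r \<le> t")
    case True
    then have r: "r \<in> {0..T}" using t by simp
    have "\<Phi> (s, r) = indicator {0..<r} s * gavg (half_laplace (F s)) (sqrt (r - s)) x" for s
      using True by (auto simp: \<Phi>_def H_def indicator_def)
    then show ?thesis using True
      by (simp add: duh_half_laplace[OF F T] duh_as_time_integral[OF HL r])
  next
    case False
    then have "\<Phi> (s, r) = 0" for s by (auto simp: \<Phi>_def indicator_def)
    then show ?thesis using False by auto
  qed
  have ib: "integrable lborel (\<lambda>s. indicator {0..<t} s * f s)" if "continuous_on UNIV f" for f :: "real \<Rightarrow> real"
  proof -
    have "set_integrable lborel {0..t} f"
      using that by (intro borel_integrable_atLeastAtMost') (blast intro: continuous_on_subset)
    then have "set_integrable lborel {0..<t} f" by (rule set_integrable_subset) auto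
    then show ?thesis by (simp add: set_integrable_def)
  qed
  have cx: "continuous_on UNIV (\<lambda>s. G s x)" if "reg G" for G :: "real \<Rightarrow> real^'n \<Rightarrow> real"
  proof -
    have "continuous_on UNIV (\<lambda>s. (s, x))" by (intro continuous_intros)
    from continuous_on_compose2[OF reg_continuous[OF that, of "[]"] this] show ?thesis by simp
  qed
  have c2: "continuous_on UNIV (\<lambda>s. gavg (F s) (sqrt (t - s)) x)"
  proof -
    have "continuous_on UNIV (\<lambda>s. (s, sqrt (t - s)))" by (intro continuous_intros)
    from continuous_on_compose2[OF gavg_continuous[OF F] this] show ?thesis by simp
  qed
  have "duh T F t x - (LBINT s. indicator {0..<t} s * F s x) =
      (LBINT s. indicator {0..<t} s * gavg (F s) (sqrt (t - s)) x - indicator {0..<t} s * F s x)"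
    by (simp add: duh_as_time_integral[OF F t] ib[OF c2] ib[OF cx[OF F]])
  also have "\<dots> = (LBINT s. (LBINT r. \<Phi> (s, r)))" unfolding in1 by (simp add: right_diff_distrib)
  also have "\<dots> = (LBINT r. indicator {0..t} r * half_laplace (duh T F r) x)" unfolding sq in2 ..
  also have "\<dots> = (LBINT s. indicator {0..<t} s * half_laplace (duh T F s) x)"
    by (rule integral_discrete_difference[where X="{t}"]) (auto simp: indicator_def)
  finally show ?thesis
    using ib[OF cx[OF F]] ib[OF cx[OF reg_half_laplace[OF reg_duh[OF F T]]]] by (simp add: distrib_left)
qed

lemma classical_solution:
  fixes a :: "'n::finite \<Rightarrow> real^'n \<Rightarrow> real"
  assumes a: "\<And>k. a k \<in> schwartz"
  obtains T U where "0 < T" "\<And>k. reg (U k)"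
    "\<And>k t x. t \<in> {0..T} \<Longrightarrow> U k t x = a k x + (LBINT s. indicator {0..<t} s * (half_laplace (U k s) x + adv U U k s x))"
proof -
  obtain T U where T: "0 < T" "T \<le> 1" and U: "\<And>k. reg (U k)"
    and eq: "\<And>k t x. U k t x = a k x + duh T (forcing a U k) t x"
    using mild_solution[of a, OF a] by metis
  have G: "reg (forcing a U k)" for k by (rule reg_forcing[OF a U])
  have "half_laplace (U k s) x = half_laplace (a k) x + half_laplace (duh T (forcing a U k) s) x" for k s x
  proof -
    have "U k s = (\<lambda>x. a k x + duh T (forcing a U k) s x)" using eq by (rule ext)
    moreover have "partial i (partial i (\<lambda>x. a k x + duh T (forcing a U k) s x)) x =
        partial i (partial i (a k)) x + partial i (partial i (duh T (forcing a U k) s)) x" for i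
      using pd_add[OF schwartz_smooth[OF a[of k]] reg_smooth[OF reg_duh[OF G T]], of "[i, i]"] by simp
    ultimately show ?thesis by (simp add: half_laplace_def sum.distrib)
  qed
  \<comment> \<open>Half the Laplacian of a, split off from U, is exactly the term by which
    \<open>forcing\<close> exceeds the advection.\<close>
  then have e: "half_laplace (U k s) x + adv U U k s x = half_laplace (duh T (forcing a U k) s) x + forcing a U k s x" for k s x
    by (simp add: forcing_def)
  have "U k t x = a k x + (LBINT s. indicator {0..<t} s * (half_laplace (U k s) x + adv U U k s x))"
    if "t \<in> {0..T}" for k t x
    unfolding e eq[of k t x] using duh_integral_equation[OF G T that] by simp
  with T U show ?thesis using that by blast
qed

subsection \<open>Uniqueness of weak derivatives\<close>

text \<open>A smooth step whose rescalings tend to an indicator. Times the Gaussian it yields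
  Schwartz test functions without any construction of bump functions.\<close>

definition logistic :: "real \<Rightarrow> real" where "logistic t = 1 / (1 + exp (- t))"

lemma logistic_range: "0 < logistic t" "logistic t < 1"
  by (auto simp: logistic_def field_simps add_pos_pos)

lemma logistic_derivative: "(logistic has_real_derivative logistic t - (logistic t)\<^sup>2) (at t)"
proof -
  have p: "1 + exp (- t) \<noteq> 0" by (metis add_pos_pos exp_gt_zero less_irrefl zero_less_one)
  have "(logistic has_real_derivative exp (- t) / (1 + exp (- t))\<^sup>2) (at t)"
    unfolding logistic_def[abs_def] using p
    by (auto intro!: derivative_eq_intros simp: power2_eq_square)
  moreover have "exp (- t) / (1 + exp (- t))\<^sup>2 = logistic t - (logistic t)\<^sup>2"
  proof -
    define s where "s = 1 + exp (- t)"
    then have "exp (- t) = s - 1" "s \<noteq> 0" using p by auto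
    then show ?thesis by (simp add: logistic_def diff_divide_distrib power2_eq_square)
  qed
  ultimately show ?thesis by simp
qed

lemma logistic_limits:
  "0 < t \<Longrightarrow> (\<lambda>n. logistic (real n * t)) \<longlonglongrightarrow> 1" "t < 0 \<Longrightarrow> (\<lambda>n. logistic (real n * t)) \<longlonglongrightarrow> 0"
  unfolding logistic_def by real_asymp+

text \<open>Since L' = L - L^2, every derivative is a polynomial in L, and L takes values in (0, 1),
  where polynomials are bounded.\<close>

lemma moderate_logistic:
  "moderate (\<lambda>x::real^'n::finite. logistic (c * (x $ i - b)))"
proof -
  let ?L = "\<lambda>x::real^'n. logistic (c * (x $ i - b))"
  have der: "((\<lambda>x. poly p (?L x)) has_derivative
      (\<lambda>h. poly (pderiv p) (?L x) * ((?L x - (?L x)\<^sup>2) * (c * h $ i)))) (at x)" for p x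
  proof -
    have 1: "((\<lambda>x. c * (x $ i - b)) has_derivative (\<lambda>h. c * h $ i)) (at x)"
      by (auto intro!: derivative_eq_intros bounded_linear_imp_has_derivative[OF bounded_linear_vec_nth])
    have 2: "((\<lambda>t. poly p (logistic t)) has_derivative
        (\<lambda>h. poly (pderiv p) (logistic t) * (logistic t - (logistic t)\<^sup>2) * h)) (at t)" for t
      using DERIV_chain2[OF poly_DERIV logistic_derivative, of p t] by (simp add: has_field_derivative_def)
    show ?thesis using has_derivative_compose[OF 1 2] by (simp add: mult_ac)
  qed
  have pd: "\<exists>q. pd js (\<lambda>x. poly p (?L x)) = (\<lambda>x. poly q (?L x))" for js p
  proof (induction js)
    case (Cons j js)
    then obtain q where q: "pd js (\<lambda>x. poly p (?L x)) = (\<lambda>x. poly q (?L x))" by blast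
    have "partial j (\<lambda>x. poly q (?L x)) x = poly (pderiv q * [:0, 1, -1:] * [:c * axis j 1 $ i:]) (?L x)" for x
      by (subst partialI[OF der]) (simp add: algebra_simps power2_eq_square)
    then have "pd (j # js) (\<lambda>x. poly p (?L x)) = (\<lambda>x. poly (pderiv q * [:0, 1, -1:] * [:c * axis j 1 $ i:]) (?L x))"
      using q by (auto intro!: ext)
    then show ?case by blast
  qed auto
  have pd1: "\<exists>q. pd js ?L = (\<lambda>x. poly q (?L x))" for js
    using pd[of js "[:0, 1:]"] by simp
  have "smooth ?L"
    unfolding smooth_def
  proof
    fix js
    obtain q where "pd js ?L = (\<lambda>x. poly q (?L x))" using pd1 by blast
    then show "pd js ?L differentiable_on UNIV"
      using der by (auto intro!: differentiable_at_imp_differentiable_on differentiableI)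
  qed
  moreover have "\<exists>m C. \<forall>x. \<bar>pd js ?L x\<bar> \<le> C * wt m x" for js
  proof -
    obtain q where q: "pd js ?L = (\<lambda>x. poly q (?L x))" using pd1 by blast
    have "compact (poly q ` {0..1})" by (intro compact_continuous_image continuous_intros) auto
    then have "bounded (poly q ` {0..1})" by (rule compact_imp_bounded)
    then obtain C where "\<forall>u\<in>poly q ` {0..1}. norm u \<le> C" unfolding bounded_iff ..
    then have C: "\<bar>poly q t\<bar> \<le> C" if "t \<in> {0..1}" for t using that by simp
    have "\<bar>pd js ?L x\<bar> \<le> C * wt 0 x" for x
      using C[of "?L x"] logistic_range[of "c * (x $ i - b)"] q by simp
    then show ?thesis by blast
  qed
  ultimately show ?thesis by (simp add: moderate_def)
qed

lemma moderate_prod: "(\<And>i. i \<in> A \<Longrightarrow> moderate (f i)) \<Longrightarrow> moderate (\<lambda>x. \<Prod>i\<in>A. f i x)"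
  by (induction A rule: infinite_finite_induct) (auto intro: moderate_const moderate_mult)

lemma L2_schwartz: assumes "f \<in> schwartz" shows "f \<in> L2"
  using schwartz_integrable[OF schwartz_mult[OF assms assms]] smooth_measurable[OF schwartz_smooth[OF assms]]
  by (simp add: L2_def power2_eq_square)

lemma L2_measurable: "f \<in> L2 \<Longrightarrow> f \<in> borel_measurable borel" by (simp add: L2_def)

lemma L2_mult_integrable:
  assumes "f \<in> L2" "g \<in> L2" shows "integrable lborel (\<lambda>x. f x * g x)"
proof (rule Bochner_Integration.integrable_bound)
  show "integrable lborel (\<lambda>x. (f x)\<^sup>2 + (g x)\<^sup>2)" using assms by (simp add: L2_def)
  show "AE x in lborel. norm (f x * g x) \<le> norm ((f x)\<^sup>2 + (g x)\<^sup>2)"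
  proof (rule AE_I2)
    fix x
    have "0 \<le> (\<bar>f x\<bar> - \<bar>g x\<bar>)\<^sup>2" by simp
    then have "2 * (\<bar>f x\<bar> * \<bar>g x\<bar>) \<le> (f x)\<^sup>2 + (g x)\<^sup>2" by (simp add: power2_diff)
    moreover have "0 \<le> \<bar>f x\<bar> * \<bar>g x\<bar>" by simp
    ultimately show "norm (f x * g x) \<le> norm ((f x)\<^sup>2 + (g x)\<^sup>2)"
      using abs_ge_self[of "(f x)\<^sup>2 + (g x)\<^sup>2"] unfolding real_norm_def abs_mult by linarith
  qed
qed (use assms in \<open>auto simp: L2_def\<close>)

lemma L2_diff: assumes "f \<in> L2" "g \<in> L2" shows "(\<lambda>x. f x - g x) \<in> L2"
proof -
  have "integrable lborel (\<lambda>x. (f x)\<^sup>2 + (g x)\<^sup>2 - 2 * (f x * g x))"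
    using assms L2_mult_integrable[OF assms] by (auto simp: L2_def)
  moreover have "(\<lambda>x. f x - g x) \<in> borel_measurable borel"
    using assms by (intro borel_measurable_diff L2_measurable)
  ultimately show ?thesis by (simp add: L2_def power2_diff mult.assoc)
qed

text \<open>
  Products of scaled logistic functions converge, almost everywhere, to the indicators of the
  corners \<open>{x. \<forall>i. a $ i < x $ i}\<close>, which generate the Borel sets.
\<close>

lemma L2_orthogonal_schwartz:
  fixes h :: "real^'n::finite \<Rightarrow> real"
  assumes h: "h \<in> L2" and orth: "\<And>\<phi>. \<phi> \<in> schwartz \<Longrightarrow> (LBINT x. h x * \<phi> x) = 0"
  shows "AE x in lborel. h x = 0"
proof -
  let ?f = "\<lambda>x. h x * gauss x"
  have [measurable]: "h \<in> borel_measurable borel" by (rule L2_measurable[OF h])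
  have int: "integrable lborel ?f" by (rule L2_mult_integrable[OF h L2_schwartz[OF gauss_schwartz]])
  have corner: "set_lebesgue_integral lborel {x. \<forall>i. a $ i < x $ i} ?f = 0" for a
  proof -
    let ?L = "\<lambda>n x. \<Prod>i\<in>UNIV. logistic (real n * (x $ i - a $ i))"
    let ?S = "{x. \<forall>i. a $ i < x $ i}"
    have L: "moderate (?L n)" for n by (intro moderate_prod moderate_logistic)
    have Lb: "\<bar>?L n x\<bar> \<le> 1" for n x
      unfolding abs_prod using logistic_range less_imp_le by (intro prod_le_1) (auto simp: less_imp_le)
    have [measurable]: "?L n \<in> borel_measurable borel" for n
      using L[of n] smooth_measurable unfolding moderate_def by blast
    have "open ?S"
      unfolding Collect_all_eq by (intro open_INT ballI open_Collect_less continuous_intros) auto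
    then have [measurable]: "?S \<in> sets borel" by simp
    have null: "AE x in lborel. \<forall>i. x $ i \<noteq> a $ i"
    proof -
      have "{x::real^'n. \<exists>i. x $ i = a $ i} = (\<Union>i. {x. x \<bullet> axis i 1 = a $ i})" by (auto simp: inner_axis)
      moreover have "negligible {x::real^'n. x \<bullet> axis i 1 = a $ i}" for i
        by (rule negligible_standard_hyperplane) (simp add: axis_in_Basis_iff)
      ultimately have "negligible {x::real^'n. \<exists>i. x $ i = a $ i}" by (auto intro!: negligible_Union simp: image_iff)
      then have "AE x in lebesgue. \<not> (\<exists>i. (x::real^'n) $ i = a $ i)"
        unfolding negligible_iff_null_sets by (rule AE_not_in[THEN AE_mp]) auto
      moreover have "{x::real^'n. \<forall>i. x $ i \<noteq> a $ i} \<in> sets borel"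
        unfolding Collect_all_eq by (intro borel_open open_INT ballI open_Collect_neq continuous_intros) auto
      ultimately show ?thesis by (simp add: AE_completion_iff)
    qed
    have "(\<lambda>n. LBINT x. h x * (?L n x * gauss x)) \<longlonglongrightarrow> (LBINT x. indicator ?S x * ?f x)"
    proof (rule integral_dominated_convergence[where w="\<lambda>x. \<bar>?f x\<bar>"])
      show "AE x in lborel. (\<lambda>n. h x * (?L n x * gauss x)) \<longlonglongrightarrow> indicator ?S x * ?f x"
        using null
      proof eventually_elim
        case (elim x)
        have "(\<lambda>n. ?L n x) \<longlonglongrightarrow> (\<Prod>i\<in>UNIV. if a $ i < x $ i then 1 else 0)"
        proof (intro tendsto_prod)
          fix i
          show "(\<lambda>n. logistic (real n * (x $ i - a $ i))) \<longlonglongrightarrow> (if a $ i < x $ i then 1 else 0)"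
            using logistic_limits[of "x $ i - a $ i"] elim[rule_format, of i] by (cases "a $ i < x $ i") auto
        qed
        also have "(\<Prod>i\<in>UNIV. if a $ i < x $ i then 1 else 0) = (indicator ?S x :: real)"
          by (auto simp: indicator_def)
        finally have "(\<lambda>n. h x * (?L n x * gauss x)) \<longlonglongrightarrow> h x * (indicator ?S x * gauss x)"
          by (intro tendsto_intros)
        then show ?case by (simp add: mult_ac)
      qed
      show "AE x in lborel. norm (h x * (?L n x * gauss x)) \<le> \<bar>?f x\<bar>" for n
      proof (rule AE_I2)
        fix x
        have "\<bar>h x * gauss x\<bar> * \<bar>?L n x\<bar> \<le> \<bar>h x * gauss x\<bar> * 1" by (intro mult_left_mono Lb) auto
        then show "norm (h x * (?L n x * gauss x)) \<le> \<bar>?f x\<bar>" by (simp add: abs_mult mult_ac)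
      qed
    qed (use int in \<open>auto intro: integrable_abs\<close>)
    moreover have "(LBINT x. h x * (?L n x * gauss x)) = 0" for n
      by (intro orth schwartz_mult_moderate[OF L gauss_schwartz])
    ultimately show ?thesis
      by (simp add: set_lebesgue_integral_def LIMSEQ_const_iff)
  qed
  let ?G = "range (\<lambda>a::real^'n. {x. \<forall>i. a $ i < x $ i})"
  have G: "sets borel = sigma_sets UNIV ?G"
  proof -
    have "eucl_less a x \<longleftrightarrow> (\<forall>i. a $ i < x $ i)" for a x :: "real^'n"
      by (auto simp: eucl_less_def Basis_vec_def inner_axis)
    then have "(borel :: (real^'n) measure) = sigma UNIV ?G"
      using borel_eq_greaterThan[where 'a="real^'n"] by simp
    then have "sets (borel :: (real^'n) measure) = sets (sigma UNIV ?G)" by (rule arg_cong)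
    also have "\<dots> = sigma_sets UNIV ?G" by (rule sets_measure_of) simp
    finally show ?thesis .
  qed
  have "set_lebesgue_integral lborel A ?f = 0" if "A \<in> sets lborel" for A
  proof -
    have stable: "Int_stable ?G"
    proof (rule Int_stableI)
      fix A B assume "A \<in> ?G" "B \<in> ?G"
      then obtain a b :: "real^'n" where "A = {x. \<forall>i. a $ i < x $ i}" "B = {x. \<forall>i. b $ i < x $ i}" by blast
      then have "A \<inter> B = {x. \<forall>i. (\<chi> i. max (a $ i) (b $ i)) $ i < x $ i}" by auto
      then show "A \<inter> B \<in> ?G" by blast
    qed
    have A: "A \<in> sigma_sets UNIV ?G" using that G by simp
    have si: "set_integrable lborel B ?f" if "B \<in> sigma_sets UNIV ?G" for B
      using that int unfolding set_integrable_def G[symmetric] by (intro integrable_mult_indicator) auto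
    have "?G \<subseteq> Pow UNIV" by simp
    from stable this A show ?thesis
    proof (induction rule: sigma_sets_induct_disjoint)
      case (compl A)
      have "set_lebesgue_integral lborel UNIV ?f = set_lebesgue_integral lborel (A \<union> (UNIV - A)) ?f" by simp
      also have "\<dots> = set_lebesgue_integral lborel A ?f + set_lebesgue_integral lborel (UNIV - A) ?f"
        using compl.hyps by (intro set_integral_Un si sigma_sets.Compl) auto
      finally show ?case using compl orth[OF gauss_schwartz] by (simp add: set_lebesgue_integral_def)
    next
      case (union A)
      have "set_lebesgue_integral lborel (\<Union>i. A i) ?f = (\<Sum>i. set_lebesgue_integral lborel (A i) ?f)"
        using union.hyps G by (intro lebesgue_integral_countable_add si sigma_sets.Union) (auto simp: disjoint_family_on_def)
      then show ?case using union by simp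
    qed (use corner in \<open>auto simp: set_lebesgue_integral_def\<close>)
  qed
  with int have "AE x in lborel. ?f x = 0" by (rule sigma_finite_measure.density_zero[OF sigma_finite_lborel])
  then show ?thesis by eventually_elim (simp add: less_imp_neq[symmetric])
qed

text \<open>Integration by parts makes the classical derivative a candidate for the choice in
  \<open>wpartial\<close>, and two candidates differ by an L2 function orthogonal to all Schwartz
  functions. Only g = f almost everywhere is assumed, so that the result can be applied again to a
  weak derivative.\<close>

lemma
  assumes f: "f \<in> schwartz" "AE x in lborel. g x = f x" "g \<in> borel_measurable borel"
  shows wpartial_L2: "wpartial i g \<in> L2" and wpartial_AE: "AE x in lborel. wpartial i g x = partial i f x"
proof -
  have m [measurable]: "f \<in> borel_measurable borel" "g \<in> borel_measurable borel"
    using f smooth_measurable schwartz_smooth by auto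
  let ?P = "\<lambda>k. k \<in> L2 \<and> (\<forall>\<phi>\<in>schwartz. (LBINT x. g x * partial i \<phi> x) = - (LBINT x. k x * \<phi> x))"
  have pf: "partial i f \<in> schwartz" by (rule schwartz_partial[OF f(1)])
  have "(LBINT x. g x * partial i \<phi> x) = - (LBINT x. partial i f x * \<phi> x)" if \<phi>: "\<phi> \<in> schwartz" for \<phi>
  proof -
    have [measurable]: "partial i \<phi> \<in> borel_measurable borel"
      by (intro smooth_measurable schwartz_smooth schwartz_partial \<phi>)
    obtain C where C: "\<And>js x. length js \<le> 1 \<Longrightarrow> wt 0 x * \<bar>pd js f x\<bar> \<le> C"
      using schwartz_bound_upto[OF f(1)] by metis
    have "(LBINT x. g x * partial i \<phi> x) = (LBINT x. f x * partial i \<phi> x)"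
      by (rule integral_cong_AE) (use f(2) in auto)
    also have "\<dots> = - (LBINT x. partial i f x * \<phi> x)"
      by (rule integral_by_parts[where A=C]) (use C[of "[]"] C[of "[i]"] schwartz_smooth f \<phi> in auto)
    finally show ?thesis .
  qed
  with L2_schwartz[OF pf] have "?P (partial i f)" by blast
  then have P: "?P (wpartial i g)" unfolding wpartial_def by (rule someI[where P="?P"])
  then show "wpartial i g \<in> L2" by blast
  have "AE x in lborel. wpartial i g x - partial i f x = 0"
  proof (rule L2_orthogonal_schwartz)
    show "(\<lambda>x. wpartial i g x - partial i f x) \<in> L2" using P L2_schwartz[OF pf] L2_diff by blast
    fix \<phi> :: "real^'a \<Rightarrow> real" assume \<phi>: "\<phi> \<in> schwartz"
    have "(LBINT x. (wpartial i g x - partial i f x) * \<phi> x) = (LBINT x. wpartial i g x * \<phi> x) - (LBINT x. partial i f x * \<phi> x)"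
      using L2_mult_integrable[OF _ L2_schwartz[OF \<phi>]] P L2_schwartz[OF pf] by (simp add: left_diff_distrib)
    also have "\<dots> = 0" using P \<open>?P (partial i f)\<close> \<phi> by (metis (no_types, lifting) add.inverse_inverse cancel_comm_monoid_add_class.diff_cancel)
    finally show "(LBINT x. (wpartial i g x - partial i f x) * \<phi> x) = 0" .
  qed
  then show "AE x in lborel. wpartial i g x = partial i f x" by simp
qed

subsection \<open>Hermite--Sobolev norms of Schwartz functions\<close>

definition wderiv :: "('n::finite \<Rightarrow> nat) \<Rightarrow> ('n \<Rightarrow> nat) \<Rightarrow> (real^'n \<Rightarrow> real) \<Rightarrow> real^'n \<Rightarrow> real"
  where "wderiv \<alpha> \<beta> f x = monomial \<alpha> x * mi_deriv \<beta> f x"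

abbreviation mi_pairs :: "nat \<Rightarrow> (('n::finite \<Rightarrow> nat) \<times> ('n \<Rightarrow> nat)) set"
  where "mi_pairs p \<equiv> {(\<alpha>, \<beta>). mi_order \<alpha> + mi_order \<beta> \<le> 2 * p}"

lemma schwartz_inner_eq:
  "schwartz_inner p f g = (\<Sum>(\<alpha>, \<beta>)\<in>mi_pairs p. LBINT x. wderiv \<alpha> \<beta> f x * wderiv \<alpha> \<beta> g x)"
  by (simp add: schwartz_inner_def wderiv_def)

lemma wderiv_schwartz: "f \<in> schwartz \<Longrightarrow> wderiv \<alpha> \<beta> f \<in> schwartz"
  unfolding wderiv_def[abs_def] mi_deriv_eq_pd
  by (intro schwartz_mult_moderate moderate_monomial schwartz_pd)

lemma wderiv_diff: "f \<in> schwartz \<Longrightarrow> g \<in> schwartz \<Longrightarrow> wderiv \<alpha> \<beta> (\<lambda>x. f x - g x) x = wderiv \<alpha> \<beta> f x - wderiv \<alpha> \<beta> g x"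
  by (simp add: wderiv_def mi_deriv_eq_pd pd_diff schwartz_smooth right_diff_distrib)

lemma wderiv_mult_integrable:
  "f \<in> schwartz \<Longrightarrow> g \<in> schwartz \<Longrightarrow> integrable lborel (\<lambda>x. wderiv \<alpha> \<beta> f x * wderiv \<alpha> \<beta> g x)"
  by (intro schwartz_integrable schwartz_mult wderiv_schwartz)

lemma schwartz_inner_diff:
  assumes "f \<in> schwartz" "g \<in> schwartz"
  shows "schwartz_inner p (\<lambda>x. f x - g x) (\<lambda>x. f x - g x) =
    schwartz_inner p f f - 2 * schwartz_inner p f g + schwartz_inner p g g"
proof -
  have "(LBINT x. wderiv \<alpha> \<beta> (\<lambda>x. f x - g x) x * wderiv \<alpha> \<beta> (\<lambda>x. f x - g x) x) =
      (LBINT x. wderiv \<alpha> \<beta> f x * wderiv \<alpha> \<beta> f x) - 2 * (LBINT x. wderiv \<alpha> \<beta> f x * wderiv \<alpha> \<beta> g x)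
      + (LBINT x. wderiv \<alpha> \<beta> g x * wderiv \<alpha> \<beta> g x)" for \<alpha> \<beta>
  proof -
    have "(LBINT x. wderiv \<alpha> \<beta> (\<lambda>x. f x - g x) x * wderiv \<alpha> \<beta> (\<lambda>x. f x - g x) x) =
        (LBINT x. wderiv \<alpha> \<beta> f x * wderiv \<alpha> \<beta> f x - 2 * (wderiv \<alpha> \<beta> f x * wderiv \<alpha> \<beta> g x) + wderiv \<alpha> \<beta> g x * wderiv \<alpha> \<beta> g x)"
      unfolding wderiv_diff[OF assms] by (intro Bochner_Integration.integral_cong refl) (simp add: algebra_simps)
    then show ?thesis
      by (simp add: wderiv_mult_integrable[OF assms(1,1)] wderiv_mult_integrable[OF assms] wderiv_mult_integrable[OF assms(2,2)])
  qed
  then show ?thesis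
    unfolding schwartz_inner_eq case_prod_beta by (simp add: sum.distrib sum_subtractf sum_distrib_left)
qed

lemma schwartz_inner_self_nonneg: "0 \<le> schwartz_inner p f f"
  unfolding schwartz_inner_def by (intro sum_nonneg) (auto intro!: Bochner_Integration.integral_nonneg)

lemma schwartz_norm_nonneg: "0 \<le> schwartz_norm p f"
  by (simp add: schwartz_norm_def schwartz_inner_self_nonneg)

lemma schwartz_norm_power2: "(schwartz_norm p f)\<^sup>2 = schwartz_inner p f f"
  by (simp add: schwartz_norm_def schwartz_inner_self_nonneg)

text \<open>In the weight, 2 p pays for the monomial, and the extra d makes the squared term
  integrable by \<open>integrable_inverse_wt\<close>. The constant is chosen before f and e, so
  smallness in the weighted sup norms is smallness in the p-norm.\<close>

lemma schwartz_norm_le: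
  "\<exists>C\<ge>0. \<forall>(f :: real^'n::finite \<Rightarrow> real) e. f \<in> schwartz \<longrightarrow> 0 \<le> e \<longrightarrow>
    (\<forall>js x. length js \<le> 2 * p \<longrightarrow> wt (2 * p + CARD('n)) x * \<bar>pd js f x\<bar> \<le> e) \<longrightarrow> schwartz_norm p f \<le> C * e"
proof -
  let ?J = "LBINT x. 1 / wt (2 * CARD('n)) (x::real^'n)" and ?I = "mi_pairs p :: (('n \<Rightarrow> nat) \<times> ('n \<Rightarrow> nat)) set"
  have J: "0 \<le> ?J" by (intro Bochner_Integration.integral_nonneg) simp
  have "schwartz_norm p f \<le> sqrt (real (card ?I) * ?J) * e"
    if f: "f \<in> schwartz" and e: "0 \<le> e"
      and b: "\<And>js x. length js \<le> 2 * p \<Longrightarrow> wt (2 * p + CARD('n)) x * \<bar>pd js f x\<bar> \<le> e" for f :: "real^'n \<Rightarrow> real" and e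
  proof -
    have "schwartz_inner p f f \<le> real (card ?I) * (e\<^sup>2 * ?J)"
      unfolding schwartz_inner_eq
    proof (rule sum_bounded_above, clarify)
      fix \<alpha> \<beta> :: "'n \<Rightarrow> nat" assume ab: "mi_order \<alpha> + mi_order \<beta> \<le> 2 * p"
      have "(LBINT x. wderiv \<alpha> \<beta> f x * wderiv \<alpha> \<beta> f x) \<le> (LBINT x. e\<^sup>2 * (1 / wt (2 * CARD('n)) (x::real^'n)))"
      proof (intro integral_mono wderiv_mult_integrable f integrable_mult_right integrable_inverse_wt)
        fix x :: "real^'n"
        have "wt (CARD('n)) x * \<bar>wderiv \<alpha> \<beta> f x\<bar> \<le> wt (CARD('n)) x * (wt (2 * p) x * \<bar>pd (mi_list \<beta>) f x\<bar>)"
          unfolding wderiv_def mi_deriv_eq_pd abs_mult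
          using ab by (intro mult_left_mono mult_right_mono order_trans[OF monomial_le_wt wt_mono]) auto
        also have "\<dots> = wt (2 * p + CARD('n)) x * \<bar>pd (mi_list \<beta>) f x\<bar>" by (simp add: wt_add)
        also have "\<dots> \<le> e" using ab by (intro b) (simp add: length_mi_list)
        finally have "(wt (CARD('n)) x * \<bar>wderiv \<alpha> \<beta> f x\<bar>)\<^sup>2 \<le> e\<^sup>2" by (intro power_mono) auto
        moreover have "wt (2 * CARD('n)) x = (wt (CARD('n)) x)\<^sup>2"
          by (simp add: wt_def power_mult[symmetric] mult.commute)
        then have "(wt (CARD('n)) x * \<bar>wderiv \<alpha> \<beta> f x\<bar>)\<^sup>2 = wt (2 * CARD('n)) x * (wderiv \<alpha> \<beta> f x * wderiv \<alpha> \<beta> f x)"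
          unfolding power_mult_distrib power2_abs by (simp only: power2_eq_square)
        ultimately show "wderiv \<alpha> \<beta> f x * wderiv \<alpha> \<beta> f x \<le> e\<^sup>2 * (1 / wt (2 * CARD('n)) x)"
          by (simp add: field_simps)
      qed
      then show "(LBINT x. wderiv \<alpha> \<beta> f x * wderiv \<alpha> \<beta> f x) \<le> e\<^sup>2 * ?J"
        by (simp only: integral_mult_right_zero)
    qed
    then have "schwartz_norm p f \<le> sqrt (real (card ?I) * (e\<^sup>2 * ?J))"
      unfolding schwartz_norm_def by simp
    also have "\<dots> = sqrt (real (card ?I) * ?J) * e" using e by (simp add: real_sqrt_mult)
    finally show ?thesis .
  qed
  then show ?thesis using J by (intro exI[of _ "sqrt (real (card ?I) * ?J)"]) auto
qed

section \<open>Closability and the norm of Schwartz representatives\<close>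

lemma pd_adjoint:
  assumes "w \<in> schwartz"
  shows "\<exists>w'\<in>schwartz. \<forall>h\<in>schwartz. (LBINT x. pd js h x * w x) = (LBINT x. h x * w' x)"
  using assms
proof (induction js arbitrary: w)
  case (Cons j js)
  have "(\<lambda>x. (- 1) * partial j w x) \<in> schwartz" by (intro schwartz_cmult schwartz_partial Cons)
  then obtain w' where w': "w' \<in> schwartz"
    "\<And>h. h \<in> schwartz \<Longrightarrow> (LBINT x. pd js h x * ((- 1) * partial j w x)) = (LBINT x. h x * w' x)"
    using Cons.IH by blast
  have "(LBINT x. pd (j # js) h x * w x) = (LBINT x. h x * w' x)" if h: "h \<in> schwartz" for h
  proof -
    obtain A where A: "\<And>ks x. length ks \<le> 1 \<Longrightarrow> wt 0 x * \<bar>pd ks (pd js h) x\<bar> \<le> A"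
      using schwartz_bound_upto[OF schwartz_pd[OF h]] by metis
    have "(LBINT x. pd js h x * partial j w x) = - (LBINT x. partial j (pd js h) x * w x)"
      by (rule integral_by_parts[where A=A])
         (use A[of "[]"] A[of "[j]"] Cons.prems in \<open>auto intro: schwartz_smooth schwartz_pd h\<close>)
    then show ?thesis using w'(2)[OF h] by simp
  qed
  with w'(1) show ?case by blast
qed auto

text \<open>Monomials and derivatives are moved onto g by \<open>pd_adjoint\<close>, after which
  convergence in L2 suffices.\<close>

lemma schwartz_inner_tendsto_0:
  fixes h :: "nat \<Rightarrow> real^'n::finite \<Rightarrow> real"
  assumes h: "\<And>n. h n \<in> schwartz" and lim: "(\<lambda>n. LBINT x. (h n x)\<^sup>2) \<longlonglongrightarrow> 0" and g: "g \<in> schwartz"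
  shows "(\<lambda>n. schwartz_inner p (h n) g) \<longlonglongrightarrow> 0"
proof -
  have w0: "(\<lambda>n. LBINT x. h n x * w x) \<longlonglongrightarrow> 0" if w: "w \<in> schwartz" for w
  proof (rule LIMSEQ_I)
    fix e :: real assume e: "e > 0"
    define W where "W = (LBINT x. (w x)\<^sup>2)"
    have W: "0 \<le> W" unfolding W_def by (intro Bochner_Integration.integral_nonneg) simp
    \<comment> \<open>Young's inequality |h w| \<le> h^2 / (2 \<delta>) + \<delta> w^2 / 2. This
      \<delta> keeps the integral of the second term below e / 2, and the first follows once the
      integral of h^2 is below \<delta> e.\<close>
    define \<delta> where "\<delta> = e / (W + 1)"
    have \<delta>: "\<delta> > 0" "\<delta> * W \<le> e" unfolding \<delta>_def using e W by (auto simp: field_simps)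
    have i: "integrable lborel (\<lambda>x. (f x)\<^sup>2)" if "f \<in> schwartz" for f :: "real^'n \<Rightarrow> real"
      using L2_schwartz[OF that] by (simp add: L2_def)
    obtain N where N: "\<And>n. n \<ge> N \<Longrightarrow> \<bar>LBINT x. (h n x)\<^sup>2\<bar> < \<delta> * e"
      using LIMSEQ_D[OF lim, of "\<delta> * e"] \<delta> e by auto
    have "norm ((LBINT x. h n x * w x) - 0) < e" if n: "n \<ge> N" for n
    proof -
      have "norm (LBINT x. h n x * w x) \<le> (LBINT x. norm (h n x * w x))" by (rule integral_norm_bound)
      also have "\<dots> \<le> (LBINT x. (1 / (2 * \<delta>)) * (h n x)\<^sup>2 + (\<delta> / 2) * (w x)\<^sup>2)"
      proof (rule integral_mono)
        show "integrable lborel (\<lambda>x. norm (h n x * w x))"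
          by (intro integrable_norm schwartz_integrable schwartz_mult h w)
        show "integrable lborel (\<lambda>x. (1 / (2 * \<delta>)) * (h n x)\<^sup>2 + (\<delta> / 2) * (w x)\<^sup>2)"
          by (intro Bochner_Integration.integrable_add integrable_mult_right i h w)
        fix x
        have "0 \<le> (\<bar>h n x\<bar> - \<delta> * \<bar>w x\<bar>)\<^sup>2 / (2 * \<delta>)" using \<delta> by simp
        also have "\<dots> = (1 / (2 * \<delta>)) * (h n x)\<^sup>2 + (\<delta> / 2) * (w x)\<^sup>2 - \<bar>h n x\<bar> * \<bar>w x\<bar>"
          using \<delta> by (simp add: power2_diff power_mult_distrib field_simps power2_eq_square)
        finally show "norm (h n x * w x) \<le> (1 / (2 * \<delta>)) * (h n x)\<^sup>2 + (\<delta> / 2) * (w x)\<^sup>2"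
          by (simp add: abs_mult)
      qed
      also have "\<dots> = (1 / (2 * \<delta>)) * (LBINT x. (h n x)\<^sup>2) + (\<delta> / 2) * W"
        unfolding W_def using i[OF h] i[OF w] by simp
      also have "\<dots> < (1 / (2 * \<delta>)) * (\<delta> * e) + e / 2"
        using N[OF n] \<delta> by (intro add_less_le_mono mult_strict_left_mono) auto
      also have "\<dots> = e" using \<delta> by simp
      finally show ?thesis by simp
    qed
    then show "\<exists>N. \<forall>n\<ge>N. norm ((LBINT x. h n x * w x) - 0) < e" by blast
  qed
  have "(\<lambda>n. LBINT x. wderiv \<alpha> \<beta> (h n) x * wderiv \<alpha> \<beta> g x) \<longlonglongrightarrow> 0" for \<alpha> \<beta>
  proof -
    have "(\<lambda>x. monomial \<alpha> x * wderiv \<alpha> \<beta> g x) \<in> schwartz"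
      by (intro schwartz_mult_moderate moderate_monomial wderiv_schwartz g)
    then obtain w where w: "w \<in> schwartz"
      "\<And>h. h \<in> schwartz \<Longrightarrow> (LBINT x. pd (mi_list \<beta>) h x * (monomial \<alpha> x * wderiv \<alpha> \<beta> g x)) = (LBINT x. h x * w x)"
      using pd_adjoint by blast
    have "(LBINT x. wderiv \<alpha> \<beta> (h n) x * wderiv \<alpha> \<beta> g x) = (LBINT x. h n x * w x)" for n
      using w(2)[OF h[of n]] by (simp add: wderiv_def mi_deriv_eq_pd mult_ac)
    then show ?thesis using w0[OF w(1)] by simp
  qed
  then have "(\<lambda>n. schwartz_inner p (h n) g) \<longlonglongrightarrow> (\<Sum>(\<alpha>, \<beta>)\<in>(mi_pairs p :: (('n \<Rightarrow> nat) \<times> ('n \<Rightarrow> nat)) set). 0)"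
    unfolding schwartz_inner_eq case_prod_beta by (intro tendsto_sum)
  then show ?thesis by simp
qed

text \<open>
  Closability: if \<open>h\<^sub>n\<close> tends to \<open>0\<close> in \<open>L\<^sup>2\<close>, then
  \<open>\<parallel>h\<^sub>n\<parallel>\<^sup>2 \<le> \<parallel>h\<^sub>n - h\<^sub>N\<parallel>\<^sup>2 + 2 \<langle>h\<^sub>n, h\<^sub>N\<rangle>\<close>, where the last term tends to \<open>0\<close>, the derivatives being moved onto \<open>h\<^sub>N\<close>.
\<close>

lemma hs_approx_norm_tendsto:
  fixes f :: "real^'n::finite \<Rightarrow> real"
  assumes f: "f \<in> schwartz" and a: "hs_approx p f \<phi>"
  shows "(\<lambda>n. schwartz_norm p (\<phi> n)) \<longlonglongrightarrow> schwartz_norm p f"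
proof -
  have \<phi>: "\<phi> n \<in> schwartz" for n using a by (simp add: hs_approx_def)
  define h where "h n = (\<lambda>x. \<phi> n x - f x)" for n
  have h: "h n \<in> schwartz" for n unfolding h_def by (intro schwartz_diff \<phi> f)
  have L: "(\<lambda>n. LBINT x. (h n x)\<^sup>2) \<longlonglongrightarrow> 0" using a by (simp add: hs_approx_def h_def)
  have hh: "(\<lambda>n. schwartz_inner p (h n) (h n)) \<longlonglongrightarrow> 0"
  proof (rule LIMSEQ_I)
    fix e :: real assume e: "e > 0"
    then have "sqrt (e / 2) > 0" by simp
    then obtain N where N: "\<And>m n. m \<ge> N \<Longrightarrow> n \<ge> N \<Longrightarrow> schwartz_norm p (\<phi> m - \<phi> n) < sqrt (e / 2)"
      using a unfolding hs_approx_def by blast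
    have "e / 4 > 0" using e by simp
    from LIMSEQ_D[OF schwartz_inner_tendsto_0[OF h L h[of N]] this]
    obtain M where M: "\<And>n. n \<ge> M \<Longrightarrow> \<bar>schwartz_inner p (h n) (h N)\<bar> < e / 4" by auto
    have "norm (schwartz_inner p (h n) (h n) - 0) < e" if n: "n \<ge> max N M" for n
    proof -
      have "(schwartz_norm p (\<phi> n - \<phi> N))\<^sup>2 < (sqrt (e / 2))\<^sup>2"
        using N[of n N] n schwartz_norm_nonneg by (intro power_strict_mono) auto
      moreover have "\<phi> n - \<phi> N = (\<lambda>x. h n x - h N x)" by (auto simp: h_def)
      ultimately have "schwartz_inner p (\<lambda>x. h n x - h N x) (\<lambda>x. h n x - h N x) < e / 2"
        using e by (simp add: schwartz_norm_power2)
      then have "schwartz_inner p (h n) (h n) - 2 * schwartz_inner p (h n) (h N) + schwartz_inner p (h N) (h N) < e / 2"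
        by (simp add: schwartz_inner_diff h)
      moreover have "schwartz_inner p (h n) (h N) < e / 4" using M[of n] n by auto
      ultimately show ?thesis
        using schwartz_inner_self_nonneg[of p "h N"] schwartz_inner_self_nonneg[of p "h n"] by simp
    qed
    then show "\<exists>N. \<forall>n\<ge>N. norm (schwartz_inner p (h n) (h n) - 0) < e" by blast
  qed
  have "schwartz_inner p (\<phi> n) (\<phi> n) = schwartz_inner p (h n) (h n) + 2 * schwartz_inner p (h n) f + schwartz_inner p f f" for n
  proof -
    have m: "mi_deriv \<beta> (\<lambda>x. (- 1) * f x) = (\<lambda>x. - mi_deriv \<beta> f x)" for \<beta>
      unfolding mi_deriv_eq_pd by (subst pd_cmult) (auto intro: schwartz_smooth f)
    have 1: "schwartz_inner p (h n) (\<lambda>x. (- 1) * f x) = - schwartz_inner p (h n) f"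
      unfolding schwartz_inner_def m by (simp add: case_prod_beta sum_negf)
    have 2: "schwartz_inner p (\<lambda>x. (- 1) * f x) (\<lambda>x. (- 1) * f x) = schwartz_inner p f f"
      unfolding schwartz_inner_def m by simp
    have 3: "(\<lambda>x. h n x - (- 1) * f x) = \<phi> n" by (simp add: h_def)
    show ?thesis using schwartz_inner_diff[OF h[of n] schwartz_cmult[OF f, of "- 1"], of p] unfolding 1 2 3 by simp
  qed
  moreover have "(\<lambda>n. schwartz_inner p (h n) (h n) + 2 * schwartz_inner p (h n) f + schwartz_inner p f f) \<longlonglongrightarrow> 0 + 2 * 0 + schwartz_inner p f f"
    by (intro tendsto_intros hh schwartz_inner_tendsto_0 h L f)
  ultimately show ?thesis unfolding schwartz_norm_def by (intro tendsto_real_sqrt) simp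
qed

text \<open>The definite description in \<open>hs_norm\<close> needs one limit for all approximating
  sequences: \<open>hs_approx_norm_tendsto\<close> supplies it, and the constant sequence f leaves
  no other value. As g enters \<open>hs_approx\<close> only through L2 distances, it may be replaced
  by f.\<close>

lemma
  assumes f: "f \<in> schwartz" "AE x in lborel. g x = f x" "g \<in> borel_measurable borel"
  shows hs_space_AE: "g \<in> hs_space p" and hs_norm_AE: "hs_norm p g = schwartz_norm p f"
proof -
  have m [measurable]: "f \<in> borel_measurable borel" "g \<in> borel_measurable borel"
    using f smooth_measurable schwartz_smooth by auto
  have eq: "hs_approx p g \<phi> \<longleftrightarrow> hs_approx p f \<phi>" for \<phi>
  proof -
    have "(LBINT x. (\<phi> n x - g x)\<^sup>2) = (LBINT x. (\<phi> n x - f x)\<^sup>2)" if "\<forall>n. \<phi> n \<in> schwartz" for n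
    proof -
      have [measurable]: "\<phi> n \<in> borel_measurable borel"
        using that by (intro smooth_measurable schwartz_smooth) auto
      show ?thesis by (rule integral_cong_AE) (use f(2) in auto)
    qed
    then show ?thesis unfolding hs_approx_def by auto
  qed
  have const: "hs_approx p f (\<lambda>n. f)"
  proof -
    have "schwartz_norm p (f - f) = 0"
    proof -
      have "f - f = (\<lambda>x. f x - f x)" by auto
      then show ?thesis using schwartz_inner_diff[OF f(1) f(1), of p] by (simp add: schwartz_norm_def)
    qed
    then show ?thesis by (auto simp: hs_approx_def f)
  qed
  have "integrable lborel (\<lambda>x. (g x)\<^sup>2)"
  proof (rule integrable_cong_AE_imp)
    show "integrable lborel (\<lambda>x. (f x)\<^sup>2)" using L2_schwartz[OF f(1)] by (simp add: L2_def)
    show "AE x in lborel. (f x)\<^sup>2 = (g x)\<^sup>2" using f(2) by eventually_elim simp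
  qed simp
  then show "g \<in> hs_space p" using const eq by (auto simp: hs_space_def L2_def)
  show "hs_norm p g = schwartz_norm p f"
    unfolding hs_norm_def eq
  proof (rule the_equality)
    show "\<forall>\<phi>. hs_approx p f \<phi> \<longrightarrow> (\<lambda>n. schwartz_norm p (\<phi> n)) \<longlonglongrightarrow> schwartz_norm p f"
      using hs_approx_norm_tendsto[OF f(1)] by blast
    fix c assume "\<forall>\<phi>. hs_approx p f \<phi> \<longrightarrow> (\<lambda>n. schwartz_norm p (\<phi> n)) \<longlonglongrightarrow> c"
    with const have "(\<lambda>n::nat. schwartz_norm p f) \<longlonglongrightarrow> c" by blast
    then show "c = schwartz_norm p f" by (simp add: LIMSEQ_const_iff)
  qed
qed

lemma vhs_norm_le:
  "\<exists>C\<ge>0. \<forall>(u :: real^'n \<Rightarrow> real^'n::finite) (f :: 'n \<Rightarrow> real^'n \<Rightarrow> real) e. 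
    (\<forall>k. f k \<in> schwartz \<and> (AE x in lborel. u x $ k = f k x) \<and> (\<lambda>x. u x $ k) \<in> borel_measurable borel) \<longrightarrow> 0 \<le> e \<longrightarrow>
    (\<forall>k js x. length js \<le> 2 * p \<longrightarrow> wt (2 * p + CARD('n)) x * \<bar>pd js (f k) x\<bar> \<le> e) \<longrightarrow>
    vhs_norm p u \<le> C * e"
proof -
  obtain C where C: "C \<ge> 0" "\<And>(f :: real^'n \<Rightarrow> real) e. f \<in> schwartz \<Longrightarrow> 0 \<le> e \<Longrightarrow>
    (\<forall>js x. length js \<le> 2 * p \<longrightarrow> wt (2 * p + CARD('n)) x * \<bar>pd js f x\<bar> \<le> e) \<Longrightarrow> schwartz_norm p f \<le> C * e"
    using schwartz_norm_le[where 'n='n, of p] by blast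
  have "vhs_norm p u \<le> (sqrt (real CARD('n)) * C) * e"
    if u: "\<And>k. f k \<in> schwartz \<and> (AE x in lborel. u x $ k = f k x) \<and> (\<lambda>x. u x $ k) \<in> borel_measurable borel" and e: "0 \<le> e"
      and b: "\<And>k. \<forall>js x. length js \<le> 2 * p \<longrightarrow> wt (2 * p + CARD('n)) x * \<bar>pd js (f k) x\<bar> \<le> e"
    for u :: "real^'n \<Rightarrow> real^'n" and f e
  proof -
    have "(\<Sum>j\<in>UNIV. (hs_norm p (\<lambda>x. u x $ j))\<^sup>2) \<le> (\<Sum>j\<in>(UNIV::'n set). (C * e)\<^sup>2)"
    proof (rule sum_mono)
      fix j
      have "hs_norm p (\<lambda>x. u x $ j) = schwartz_norm p (f j)"
        using u[of j] by (intro hs_norm_AE) auto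
      also have "(schwartz_norm p (f j))\<^sup>2 \<le> (C * e)\<^sup>2"
        using C(2)[of "f j" e] u[of j] e b[of j] by (intro power_mono schwartz_norm_nonneg) auto
      finally show "(hs_norm p (\<lambda>x. u x $ j))\<^sup>2 \<le> (C * e)\<^sup>2" by simp
    qed
    also have "\<dots> = (sqrt (real CARD('n)) * C * e)\<^sup>2" by (simp add: power_mult_distrib)
    finally have "vhs_norm p u \<le> sqrt ((sqrt (real CARD('n)) * C * e)\<^sup>2)"
      unfolding vhs_norm_def by (rule real_sqrt_le_mono)
    then show ?thesis using C(1) e by simp
  qed
  then show ?thesis using C(1) by (intro exI[of _ "sqrt (real CARD('n)) * C"]) auto
qed

subsection \<open>Riemann sums of Schwartz-valued curves\<close>

text \<open>For large x one additional power of the weight makes each of the two terms at most e /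
  2; on the remaining compact set of times and points uniform continuity applies. Finitely many
  lists and components share one \<delta>.\<close>

lemma reg_uniformly_continuous:
  fixes F :: "'i::finite \<Rightarrow> real \<Rightarrow> real^'n::finite \<Rightarrow> real"
  assumes F: "\<And>k. reg (F k)" and e: "e > 0"
  obtains \<delta> where "\<delta> > 0" "\<And>k js s t x. length js \<le> N \<Longrightarrow> s \<in> {0..T} \<Longrightarrow> t \<in> {0..T} \<Longrightarrow> \<bar>s - t\<bar> < \<delta> \<Longrightarrow>
    wt m x * \<bar>pd js (F k s) x - pd js (F k t) x\<bar> \<le> e"
proof -
  let ?P = "\<lambda>k js \<delta>. \<forall>s\<in>{0..T}. \<forall>t\<in>{0..T}. \<bar>s - t\<bar> < \<delta> \<longrightarrow> (\<forall>x. wt m x * \<bar>pd js (F k s) x - pd js (F k t) x\<bar> \<le> e)"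
  have one: "\<forall>\<^sub>F \<delta> in at_right 0. ?P k js \<delta>" for k js
  proof -
    obtain C where C: "0 \<le> C" "\<And>t x. wt (m + 1) x * \<bar>pd js (F k t) x\<bar> \<le> C" using reg_bound[OF F] by metis
    \<comment> \<open>With this radius the bound with weight m + 1 reads C = (e / 2) r, and outside
      the ball 1 + |x| exceeds 1 + r.\<close>
    define r where "r = 2 * C / e"
    have r: "0 \<le> r" using C e by (simp add: r_def)
    have far: "wt m x * \<bar>pd js (F k t) x\<bar> \<le> e / 2" if "norm x > r" for t x
    proof -
      have "wt m x * \<bar>pd js (F k t) x\<bar> * (1 + r) \<le> wt m x * \<bar>pd js (F k t) x\<bar> * (1 + norm x)"
        using that by (intro mult_left_mono) auto
      also have "\<dots> \<le> C" using C(2)[of x t] by (simp add: wt_def mult_ac)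
      finally have "wt m x * \<bar>pd js (F k t) x\<bar> * (1 + r) \<le> e / 2 * r" using e by (simp add: r_def)
      also have "\<dots> \<le> e / 2 * (1 + r)" using e by simp
      finally show ?thesis using r by (simp add: mult_le_cancel_right)
    qed
    let ?K = "{0..T} \<times> cball (0 :: real^'n) r" and ?g = "\<lambda>p. wt m (snd p) * pd js (F k (fst p)) (snd p)"
    have "continuous_on ?K ?g"
      by (intro continuous_intros continuous_on_subset[OF reg_continuous[OF F]]) auto
    then have "uniformly_continuous_on ?K ?g"
      by (intro compact_uniformly_continuous compact_Times) auto
    then obtain d where d: "d > 0" "\<And>p q. p \<in> ?K \<Longrightarrow> q \<in> ?K \<Longrightarrow> dist q p < d \<Longrightarrow> dist (?g q) (?g p) < e"
      unfolding uniformly_continuous_on_def using e by metis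
    have "?P k js \<delta>" if "\<delta> < d" for \<delta>
    proof (intro ballI impI allI)
      fix s t x assume st: "s \<in> {0..T}" "t \<in> {0..T}" "\<bar>s - t\<bar> < \<delta>"
      show "wt m x * \<bar>pd js (F k s) x - pd js (F k t) x\<bar> \<le> e"
      proof (cases "norm x \<le> r")
        case True
        have "dist (?g (s, x)) (?g (t, x)) < e"
          by (rule d(2)) (use True st that in \<open>auto simp: dist_Pair_Pair dist_real_def\<close>)
        then show ?thesis by (simp add: dist_real_def right_diff_distrib[symmetric] abs_mult)
      next
        case False
        have "wt m x * \<bar>pd js (F k s) x - pd js (F k t) x\<bar> \<le> wt m x * (\<bar>pd js (F k s) x\<bar> + \<bar>pd js (F k t) x\<bar>)"
          by (intro mult_left_mono) auto
        then show ?thesis using far[of x s] far[of x t] False by (simp add: distrib_left)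
      qed
    qed
    then show ?thesis using d(1) by (auto simp: eventually_at_right_field intro!: exI[of _ d])
  qed
  have fin: "finite {js::'n list. length js \<le> N}"
    using finite_lists_length_le[of "UNIV::'n set" N] by simp
  have "\<forall>\<^sub>F \<delta> in at_right 0. \<forall>js\<in>{js. length js \<le> N}. ?P k js \<delta>" for k
    by (rule eventually_ball_finite[OF fin ballI[OF one]])
  then have "\<forall>\<^sub>F \<delta> in at_right 0. \<forall>k\<in>UNIV. \<forall>js\<in>{js. length js \<le> N}. ?P k js \<delta>"
    by (intro eventually_ball_finite[OF finite] ballI)
  then obtain b where b: "b > 0" "\<And>\<delta>. 0 < \<delta> \<Longrightarrow> \<delta> < b \<Longrightarrow> \<forall>k\<in>UNIV. \<forall>js\<in>{js. length js \<le> N}. ?P k js \<delta>"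
    unfolding eventually_at_right_field by blast
  have "b / 2 > 0" "b / 2 < b" using b(1) by auto
  from b(2)[OF this] show ?thesis using that[OF \<open>b / 2 > 0\<close>] by blast
qed

text \<open>Rounding down to multiples of 1 / (n + 1). The grid does not depend on t, and for r
  \<ge> 0 the node stays in [0, r], so left Riemann sums evaluate curves only inside the
  interval.\<close>

definition grid :: "nat \<Rightarrow> real \<Rightarrow> real"
  where "grid n r = real_of_int \<lfloor>r * real (Suc n)\<rfloor> / real (Suc n)"

lemma grid_bounds: "grid n r \<le> r" "r - grid n r \<le> 1 / real (Suc n)" "0 \<le> r \<Longrightarrow> 0 \<le> grid n r"
proof -
  have p: "0 < real (Suc n)" by simp
  show "grid n r \<le> r" unfolding grid_def using p of_int_floor_le[of "r * real (Suc n)"] by (simp only: pos_divide_le_eq)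
  have "r * real (Suc n) - 1 \<le> real_of_int \<lfloor>r * real (Suc n)\<rfloor>" by linarith
  then have "(r * real (Suc n) - 1) / real (Suc n) \<le> grid n r"
    unfolding grid_def by (rule divide_right_mono) simp
  then show "r - grid n r \<le> 1 / real (Suc n)" using p by (simp add: diff_divide_distrib del: of_nat_Suc)
  show "0 \<le> r \<Longrightarrow> 0 \<le> grid n r" by (simp add: grid_def)
qed

lemma grid_simple: "simple_function (restrict_space lborel {0..<t}) (grid n)"
proof (rule simple_function_borel_measurable)
  have "grid n \<in> borel_measurable borel" unfolding grid_def[abs_def] by measurable
  then show "grid n \<in> borel_measurable (restrict_space lborel {0..<t})"
    by (intro measurable_restrict_space1) simp
  have "grid n ` {0..<t} \<subseteq> (\<lambda>i. real_of_int i / real (Suc n)) ` {0..\<lfloor>t * real (Suc n)\<rfloor>}"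
    unfolding grid_def by (auto intro!: imageI floor_mono mult_right_mono simp del: of_nat_Suc)
  then show "finite (grid n ` space (restrict_space lborel {0..<t}))"
    by (simp only: space_restrict_space) (auto intro: finite_subset[OF _ finite_imageI[OF finite_atLeastAtMost_int]])
qed

text \<open>The grid takes finitely many values on [0, t), so composing it with B gives a simple
  function. With B in an arbitrary real vector space, one formula describes both the sums of vector
  fields and the scalar sums of their derivatives at a point.\<close>

lemma simple_bochner_grid:
  fixes B :: "real \<Rightarrow> 'v::real_vector"
  shows "Bochner_Integration.simple_bochner_integrable (restrict_space lborel {0..<t}) (\<lambda>r. B (grid n r))"
    and "Bochner_Integration.simple_bochner_integral (restrict_space lborel {0..<t}) (\<lambda>r. B (grid n r)) =
      (\<Sum>y\<in>grid n ` {0..<t}. measure (restrict_space lborel {0..<t}) {r \<in> {0..<t}. grid n r = y} *\<^sub>R B y)"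
proof -
  let ?M = "restrict_space lborel {0..<t} :: real measure"
  show i: "Bochner_Integration.simple_bochner_integrable ?M (\<lambda>r. B (grid n r))"
  proof
    show s: "simple_function ?M (\<lambda>r. B (grid n r))"
      using simple_function_compose[OF grid_simple[of t n], of B] by (simp add: o_def)
    have "emeasure ?M {r \<in> space ?M. B (grid n r) \<noteq> 0} \<le> emeasure ?M (space ?M)"
      by (rule emeasure_space)
    also have "\<dots> < \<infinity>"
      by (cases "0 \<le> t") (auto simp: space_restrict_space emeasure_restrict_space)
    finally show "emeasure ?M {r \<in> space ?M. B (grid n r) \<noteq> 0} \<noteq> \<infinity>" by simp
  qed
  show "Bochner_Integration.simple_bochner_integral ?M (\<lambda>r. B (grid n r)) =
      (\<Sum>y\<in>grid n ` {0..<t}. measure ?M {r \<in> {0..<t}. grid n r = y} *\<^sub>R B y)"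
    using simple_bochner_integral_partition[OF i grid_simple[of t n], where v=B] by (simp add: space_restrict_space)
qed

lemma sum_fun_apply: "(\<Sum>y\<in>A. f y) x = (\<Sum>y\<in>A. f y x)"
  for f :: "'i \<Rightarrow> 'x \<Rightarrow> 'v::comm_monoid_add"
  by (induction A rule: infinite_finite_induct) auto

definition vfield :: "('n \<Rightarrow> real \<Rightarrow> real^'n \<Rightarrow> real) \<Rightarrow> real \<Rightarrow> real^'n \<Rightarrow> real^'n::finite"
  where "vfield b r = (\<lambda>x. \<chi> k. b k r x)"

lemma vfield_component [simp]: "vfield b r x $ k = b k r x" by (simp add: vfield_def)

lemma vhs_norm_nonneg: "0 \<le> vhs_norm p u" by (simp add: vhs_norm_def sum_nonneg)

lemma schwartz_vhs_space:
  assumes "\<And>k. f k \<in> schwartz" "\<And>k. AE x in lborel. u x $ k = f k x" "\<And>k. (\<lambda>x. u x $ k) \<in> borel_measurable borel"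
  shows "u \<in> vhs_space p"
  unfolding vhs_space_def mem_Collect_eq by (intro allI hs_space_AE[OF assms])

text \<open>A Riemann sum is a finite combination of Schwartz functions and can be differentiated
  termwise. Reading the result as the integral of a step function prepares the comparison with
  \<open>time_integral_pd\<close> under one integral sign.\<close>

lemma Riemann_sum_derivative:
  fixes b :: "'n::finite \<Rightarrow> real \<Rightarrow> real^'n \<Rightarrow> real" and t :: real
  assumes b: "\<And>k. reg (b k)"
  defines "S \<equiv> \<lambda>n. Bochner_Integration.simple_bochner_integral (restrict_space lborel {0..<t}) (\<lambda>r. vfield b (grid n r))"
  shows "(\<lambda>x. S n x $ k) \<in> schwartz"
    and "integrable lborel (\<lambda>r. indicator {0..<t} r * pd js (b k (grid n r)) x)"
    and "pd js (\<lambda>x. S n x $ k) x = (LBINT r. indicator {0..<t} r * pd js (b k (grid n r)) x)"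
proof -
  let ?M = "restrict_space lborel {0..<t} :: real measure"
  let ?c = "\<lambda>y. measure ?M {r \<in> {0..<t}. grid n r = y}"
  have S: "(\<lambda>x. S n x $ k) = (\<lambda>x. \<Sum>y\<in>grid n ` {0..<t}. ?c y * b k y x)"
    unfolding S_def simple_bochner_grid(2) by (simp add: sum_fun_apply scaleR_fun_def fun_eq_iff)
  show "(\<lambda>x. S n x $ k) \<in> schwartz"
    unfolding S by (intro schwartz_sum schwartz_cmult reg_schwartz b)
  note i = simple_bochner_grid(1)[where B="\<lambda>y. pd js (b k y) x" and n=n and t=t]
  have "has_bochner_integral ?M (\<lambda>r. pd js (b k (grid n r)) x)
      (Bochner_Integration.simple_bochner_integral ?M (\<lambda>r. pd js (b k (grid n r)) x))"
    by (rule has_bochner_integral_simple_bochner_integrable[OF i])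
  then have *: "integrable ?M (\<lambda>r. pd js (b k (grid n r)) x)"
    "(\<integral>r. pd js (b k (grid n r)) x \<partial>?M) = (\<Sum>y\<in>grid n ` {0..<t}. ?c y * pd js (b k y) x)"
    by (auto simp: has_bochner_integral_iff simple_bochner_grid(2)[where B="\<lambda>y. pd js (b k y) x"])
  then show "integrable lborel (\<lambda>r. indicator {0..<t} r * pd js (b k (grid n r)) x)"
    by (simp add: integrable_restrict_space)
  have "pd js (\<lambda>x. S n x $ k) x = (\<Sum>y\<in>grid n ` {0..<t}. ?c y * pd js (b k y) x)"
    unfolding S by (simp add: pd_sum pd_cmult smooth_cmult reg_smooth b)
  also have "\<dots> = (LBINT r. indicator {0..<t} r * pd js (b k (grid n r)) x)"
    unfolding *(2)[symmetric] by (simp add: integral_restrict_space)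
  finally show "pd js (\<lambda>x. S n x $ k) x = (LBINT r. indicator {0..<t} r * pd js (b k (grid n r)) x)" .
qed

lemma
  fixes b :: "real \<Rightarrow> real^'n::finite \<Rightarrow> real"
  assumes b: "reg b"
  shows time_integral_pd: "pd js (\<lambda>x. LBINT s. indicator {0..<t} s * b s x) =
      (\<lambda>x. LBINT s. indicator {0..<t} s * pd js (b s) x)"
    and time_integrable: "integrable lborel (\<lambda>s. indicator {0..<t} s * pd js (b s) x)"
proof -
  have cm: "(\<lambda>s. pd js (b s) x) \<in> borel_measurable borel" for js x
  proof -
    have "continuous_on UNIV (\<lambda>s. (s, x))" by (intro continuous_intros)
    from continuous_on_compose2[OF reg_continuous[OF b, of js] this] show ?thesis
      by (intro borel_measurable_continuous_onI) simp
  qed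
  have s: "smooth (\<lambda>x. indicator {0..<t} s * b s x)" for s by (intro smooth_cmult reg_smooth b)
  have p: "pd js (\<lambda>x. indicator {0..<t} s * b s x) = (\<lambda>x. indicator {0..<t} s * pd js (b s) x)" for s js
    by (intro pd_cmult reg_smooth b)
  have m: "(\<lambda>s. pd js (\<lambda>x. indicator {0..<t} s * b s x) x) \<in> borel_measurable lborel" for js x
    unfolding p using cm[of js x] by measurable
  have W: "\<exists>W. integrable lborel W \<and> (\<forall>s\<in>space lborel. \<forall>x. \<bar>pd js (\<lambda>x. indicator {0..<t} s * b s x) x\<bar> \<le> W s)" for js
  proof -
    obtain C where C: "\<And>t x. wt 0 x * \<bar>pd js (b t) x\<bar> \<le> C" using reg_bound[OF b] by metis
    have "integrable lborel (\<lambda>s. indicator {0..<t} s * C)"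
      by (cases "t < 0") (auto intro!: integrable_real_indicator)
    moreover have "\<bar>pd js (\<lambda>x. indicator {0..<t} s * b s x) x\<bar> \<le> indicator {0..<t} s * C" for s x
      unfolding p using C[of x s] by (simp add: abs_mult mult_left_mono)
    ultimately show ?thesis by blast
  qed
  show "pd js (\<lambda>x. LBINT s. indicator {0..<t} s * b s x) = (\<lambda>x. LBINT s. indicator {0..<t} s * pd js (b s) x)"
    using pd_integral[OF s m W, of js] unfolding p .
  obtain W where W: "integrable lborel W" "\<And>s x. \<bar>pd js (\<lambda>x. indicator {0..<t} s * b s x) x\<bar> \<le> W s"
    using W[of js] by auto
  from W(1) show "integrable lborel (\<lambda>s. indicator {0..<t} s * pd js (b s) x)"
  proof (rule Bochner_Integration.integrable_bound, goal_cases)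
    case 2
    show ?case using W by (intro AE_I2) (metis p abs_ge_self order_trans real_norm_def)
  qed (use m[of js x] in \<open>simp add: p\<close>)
qed

text \<open>The curve is uniformly continuous in the weighted sup norms that dominate
  \<open>vhs_norm\<close>, so the Riemann sums approximate both the integrand, uniformly in r, and
  the pointwise integral. The integrand g is tied to the regular curve b only almost everywhere in
  x, because \<open>burgers\<close> involves chosen representatives of weak derivatives.\<close>

lemma has_bochner_integral_in_vhs:
  fixes b :: "'n::finite \<Rightarrow> real \<Rightarrow> real^'n \<Rightarrow> real"
  assumes b: "\<And>k. reg (b k)"
    and g: "\<And>r k. r \<in> {0..<t} \<Longrightarrow> AE x in lborel. g r x $ k = b k r x"
      "\<And>r k. r \<in> {0..<t} \<Longrightarrow> (\<lambda>x. g r x $ k) \<in> borel_measurable borel"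
    and I: "\<And>k. (\<lambda>x. I x $ k) \<in> schwartz" "\<And>k x. I x $ k = (LBINT s. indicator {0..<t} s * b k s x)"
    and t: "0 \<le> t"
  shows "has_bochner_integral_in (vhs_space p) (vhs_norm p) (restrict_space lborel {0..<t}) g I"
proof -
  let ?M = "restrict_space lborel {0..<t} :: real measure" and ?s = "\<lambda>n r. vfield b (grid n r)"
  have sp: "space ?M = {0..<t}" by (simp add: space_restrict_space)
  have bm: "b k r \<in> borel_measurable borel" for k r by (rule smooth_measurable[OF reg_smooth[OF b]])
  have s_in: "?s n r \<in> vhs_space p" for n r
    by (rule schwartz_vhs_space[where f="\<lambda>k. b k (grid n r)"]) (auto intro: reg_schwartz b bm)
  have simple: "simple_in (vhs_space p) ?M (?s n)" for n
    unfolding simple_in_def using simple_bochner_grid(1) s_in by blast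
  have g_in: "g ` space ?M \<subseteq> vhs_space p"
    unfolding sp using schwartz_vhs_space[where f="\<lambda>k. b k _"] reg_schwartz[OF b] g by blast
  have I_in: "I \<in> vhs_space p"
    by (rule schwartz_vhs_space[where f="\<lambda>k x. I x $ k"]) (auto intro: I smooth_measurable schwartz_smooth)
  obtain C where C: "C \<ge> 0" "\<And>(u :: real^'n \<Rightarrow> real^'n) (f :: 'n \<Rightarrow> real^'n \<Rightarrow> real) e.
    (\<And>k. f k \<in> schwartz \<and> (AE x in lborel. u x $ k = f k x) \<and> (\<lambda>x. u x $ k) \<in> borel_measurable borel) \<Longrightarrow> 0 \<le> e \<Longrightarrow>
    (\<And>k js x. length js \<le> 2 * p \<Longrightarrow> wt (2 * p + CARD('n)) x * \<bar>pd js (f k) x\<bar> \<le> e) \<Longrightarrow> vhs_norm p u \<le> C * e"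
    using vhs_norm_le[where 'n='n, of p] by blast
  have key: "\<exists>n0. \<forall>n\<ge>n0. \<forall>k js x. \<forall>r\<in>{0..<t}. length js \<le> 2 * p \<longrightarrow>
      wt (2 * p + CARD('n)) x * \<bar>pd js (b k r) x - pd js (b k (grid n r)) x\<bar> \<le> e" if e: "e > 0" for e
  proof -
    obtain \<delta> where \<delta>: "\<delta> > 0" "\<And>k js s r x. length js \<le> 2 * p \<Longrightarrow> s \<in> {0..t} \<Longrightarrow> r \<in> {0..t} \<Longrightarrow> \<bar>s - r\<bar> < \<delta> \<Longrightarrow>
        wt (2 * p + CARD('n)) x * \<bar>pd js (b k s) x - pd js (b k r) x\<bar> \<le> e"
      using reg_uniformly_continuous[where F=b, OF b e] by metis
    obtain n0 where n0: "inverse (real (Suc n0)) < \<delta>" using reals_Archimedean[OF \<delta>(1)] by blast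
    have "wt (2 * p + CARD('n)) x * \<bar>pd js (b k r) x - pd js (b k (grid n r)) x\<bar> \<le> e"
      if n: "n \<ge> n0" and r: "r \<in> {0..<t}" and js: "length js \<le> 2 * p" for n k js x r
    proof (rule \<delta>(2)[OF js])
      have "1 / real (Suc n) \<le> inverse (real (Suc n0))" using n by (simp add: field_simps)
      then show "\<bar>r - grid n r\<bar> < \<delta>" using grid_bounds(1,2)[where n=n and r=r] n0 by linarith
      show "grid n r \<in> {0..t}" using grid_bounds(1,3)[where n=n and r=r] r by auto
    qed (use r in auto)
    then show ?thesis by blast
  qed
  have diff: "\<exists>n0. \<forall>n\<ge>n0. \<forall>r\<in>{0..<t}. vhs_norm p (g r - ?s n r) \<le> e" if e: "e > 0" for e
  proof -
    have "e / (C + 1) > 0" using e C(1) by simp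
    from key[OF this] obtain n0 where n0: "\<And>n k js x r. n \<ge> n0 \<Longrightarrow> r \<in> {0..<t} \<Longrightarrow> length js \<le> 2 * p \<Longrightarrow>
      wt (2 * p + CARD('n)) x * \<bar>pd js (b k r) x - pd js (b k (grid n r)) x\<bar> \<le> e / (C + 1)" by blast
    have "vhs_norm p (g r - ?s n r) \<le> C * (e / (C + 1))" if n: "n \<ge> n0" and r: "r \<in> {0..<t}" for n r
    proof (rule C(2)[where f="\<lambda>k x. b k r x - b k (grid n r) x"])
      fix k
      have "AE x in lborel. (g r - ?s n r) x $ k = b k r x - b k (grid n r) x"
        using g(1)[OF r, of k] by eventually_elim simp
      moreover have "(\<lambda>x. (g r - ?s n r) x $ k) \<in> borel_measurable borel"
        using g(2)[OF r, of k] bm[of k "grid n r"] by simp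
      ultimately show "(\<lambda>x. b k r x - b k (grid n r) x) \<in> schwartz \<and>
          (AE x in lborel. (g r - ?s n r) x $ k = b k r x - b k (grid n r) x) \<and>
          (\<lambda>x. (g r - ?s n r) x $ k) \<in> borel_measurable borel"
        by (auto intro: schwartz_diff reg_schwartz b)
      show "wt (2 * p + CARD('n)) x * \<bar>pd js (\<lambda>x. b k r x - b k (grid n r) x) x\<bar> \<le> e / (C + 1)"
        if "length js \<le> 2 * p" for js x
        using n0[OF n r that] by (simp add: pd_diff reg_smooth b)
    qed (use e C(1) in simp)
    moreover have "C * (e / (C + 1)) \<le> e" using e C(1) by (simp add: field_simps)
    ultimately show ?thesis by (meson order_trans)
  qed
  have conv: "(\<lambda>n. vhs_norm p (g r - ?s n r)) \<longlonglongrightarrow> 0" if r: "r \<in> {0..<t}" for r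
  proof (rule LIMSEQ_I)
    fix e :: real assume "e > 0"
    then have "e / 2 > 0" by simp
    from diff[OF this] obtain n0 where n0: "\<And>n. n \<ge> n0 \<Longrightarrow> vhs_norm p (g r - ?s n r) \<le> e / 2" using r by blast
    have "norm (vhs_norm p (g r - ?s n r) - 0) < e" if "n \<ge> n0" for n
      using n0[OF that] \<open>e / 2 > 0\<close> vhs_norm_nonneg[of p "g r - ?s n r"] by simp
    then show "\<exists>n0. \<forall>n\<ge>n0. norm (vhs_norm p (g r - ?s n r) - 0) < e" by blast
  qed
  have emM: "emeasure ?M (space ?M) = ennreal t"
    using t by (simp add: sp emeasure_restrict_space)
  have nn: "(\<lambda>n. \<integral>\<^sup>+r. ennreal (vhs_norm p (g r - ?s n r)) \<partial>?M) \<longlonglongrightarrow> 0"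
  proof (rule order_tendstoI)
    \<comment> \<open>As y may be infinite, a smaller finite y' supplies the real tolerance
      e.\<close>
    fix y :: ennreal assume "0 < y"
    then obtain y' where y': "0 < y'" "y' < y" using dense by blast
    have top: "y' < top" by (rule order.strict_trans2[OF y'(2) top_greatest])
    define e where "e = enn2real y'"
    have e: "e > 0" and ey: "ennreal e = y'" using y'(1) top by (auto simp: e_def enn2real_positive_iff)
    have "e / (t + 1) > 0" using e t by simp
    from diff[OF this] obtain n0 where n0: "\<And>n r. n \<ge> n0 \<Longrightarrow> r \<in> {0..<t} \<Longrightarrow> vhs_norm p (g r - ?s n r) \<le> e / (t + 1)"
      by blast
    have "(\<integral>\<^sup>+r. ennreal (vhs_norm p (g r - ?s n r)) \<partial>?M) \<le> ennreal e" if n: "n \<ge> n0" for n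
    proof -
      have "(\<integral>\<^sup>+r. ennreal (vhs_norm p (g r - ?s n r)) \<partial>?M) \<le> (\<integral>\<^sup>+r. ennreal (e / (t + 1)) \<partial>?M)"
        using n0[OF n] by (intro nn_integral_mono ennreal_leI) (simp add: sp)
      also have "\<dots> = ennreal (e / (t + 1) * t)"
        using e t by (simp add: sp emM[unfolded sp] ennreal_mult[symmetric])
      also have "\<dots> \<le> ennreal e" using e t by (intro ennreal_leI) (simp add: field_simps)
      finally show ?thesis .
    qed
    then have "(\<integral>\<^sup>+r. ennreal (vhs_norm p (g r - ?s n r)) \<partial>?M) < y" if "n \<ge> n0" for n
      using that y'(2) unfolding ey by (meson le_less_trans)
    then show "\<forall>\<^sub>F n in sequentially. (\<integral>\<^sup>+r. ennreal (vhs_norm p (g r - ?s n r)) \<partial>?M) < y"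
      unfolding eventually_sequentially by blast
  qed simp
  have int: "(\<lambda>n. vhs_norm p (Bochner_Integration.simple_bochner_integral ?M (?s n) - I)) \<longlonglongrightarrow> 0"
  proof (rule LIMSEQ_I)
    fix e :: real assume e: "e > 0"
    let ?S = "\<lambda>n. Bochner_Integration.simple_bochner_integral ?M (?s n)"
    \<comment> \<open>The bound obtained is C e' t \<le> (C + 1) e' (t + 1) = e / 2. Adding 1 to C
      and to t keeps the divisor positive.\<close>
    define e' where "e' = e / (2 * ((C + 1) * (t + 1)))"
    have e': "e' > 0" unfolding e'_def using e C(1) t by simp
    from key[OF e'] obtain n0 where n0: "\<And>n k js x r. n \<ge> n0 \<Longrightarrow> r \<in> {0..<t} \<Longrightarrow> length js \<le> 2 * p \<Longrightarrow>
      wt (2 * p + CARD('n)) x * \<bar>pd js (b k r) x - pd js (b k (grid n r)) x\<bar> \<le> e'" by blast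
    have "vhs_norm p (?S n - I) < e" if n: "n \<ge> n0" for n
    proof -
      have Sn: "(\<lambda>x. ?S n x $ k) \<in> schwartz" for k by (rule Riemann_sum_derivative(1)[OF b])
      have "vhs_norm p (?S n - I) \<le> C * (e' * t)"
      proof (rule C(2)[where f="\<lambda>k x. ?S n x $ k - I x $ k"])
        fix k
        show "(\<lambda>x. ?S n x $ k - I x $ k) \<in> schwartz \<and> (AE x in lborel. (?S n - I) x $ k = ?S n x $ k - I x $ k) \<and>
            (\<lambda>x. (?S n - I) x $ k) \<in> borel_measurable borel"
          using schwartz_diff[OF Sn I(1), of k k] by (auto intro: smooth_measurable schwartz_smooth)
        fix js :: "'n list" and x :: "real^'n" assume js: "length js \<le> 2 * p"
        let ?w = "wt (2 * p + CARD('n)) x"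
        have pI: "pd js (\<lambda>x. I x $ k) x = (LBINT s. indicator {0..<t} s * pd js (b k s) x)"
          unfolding I(2) by (simp add: time_integral_pd[OF b])
        have "pd js (\<lambda>x. ?S n x $ k - I x $ k) x = pd js (\<lambda>x. ?S n x $ k) x - pd js (\<lambda>x. I x $ k) x"
          by (rule fun_cong[OF pd_diff]) (auto intro: schwartz_smooth Sn I)
        also have "\<dots> = (LBINT r. indicator {0..<t} r * pd js (b k (grid n r)) x - indicator {0..<t} r * pd js (b k r) x)"
          unfolding Riemann_sum_derivative(3)[OF b] pI
          by (rule Bochner_Integration.integral_diff[symmetric]) (intro Riemann_sum_derivative(2)[OF b] time_integrable[OF b])+
        finally have "?w * \<bar>pd js (\<lambda>x. ?S n x $ k - I x $ k) x\<bar> \<le>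
            ?w * (LBINT r. norm (indicator {0..<t} r * pd js (b k (grid n r)) x - indicator {0..<t} r * pd js (b k r) x))"
          by (simp only: real_norm_def[symmetric]) (intro mult_left_mono integral_norm_bound wt_pos)
        also have "\<dots> = (LBINT r. ?w * norm (indicator {0..<t} r * pd js (b k (grid n r)) x - indicator {0..<t} r * pd js (b k r) x))"
          by simp
        also have "\<dots> \<le> (LBINT r. indicator {0..<t} r * e')"
        proof (rule integral_mono)
          show "integrable lborel (\<lambda>r. ?w * norm (indicator {0..<t} r * pd js (b k (grid n r)) x - indicator {0..<t} r * pd js (b k r) x))"
            by (intro integrable_mult_right integrable_norm Bochner_Integration.integrable_diff Riemann_sum_derivative(2)[OF b] time_integrable[OF b])
          show "integrable lborel (\<lambda>r. indicator {0..<t} r * e')"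
            using t by (auto intro!: integrable_real_indicator)
          show "?w * norm (indicator {0..<t} r * pd js (b k (grid n r)) x - indicator {0..<t} r * pd js (b k r) x) \<le> indicator {0..<t} r * e'" for r
            using n0[OF n _ js, of r x k] by (auto simp: indicator_def abs_minus_commute)
        qed
        also have "\<dots> = e' * t" using t by simp
        finally show "?w * \<bar>pd js (\<lambda>x. ?S n x $ k - I x $ k) x\<bar> \<le> e' * t" .
      qed (use e' t in simp)
      also have "\<dots> \<le> (C + 1) * (e' * (t + 1))" using C(1) e' t by (intro mult_mono) auto
      also have "\<dots> = e' * ((C + 1) * (t + 1))" by (simp only: mult_ac)
      also have "\<dots> = e / 2"
      proof -
        have "(C + 1) * (t + 1) \<noteq> 0" using C(1) t by simp
        then show ?thesis unfolding e'_def by (simp del: mult_eq_0_iff)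
      qed
      also have "\<dots> < e" using e by simp
      finally show ?thesis .
    qed
    then show "\<exists>n0. \<forall>n\<ge>n0. norm (vhs_norm p (?S n - I) - 0) < e"
      by (intro exI[of _ n0]) (simp add: vhs_norm_nonneg abs_of_nonneg)
  qed
  show ?thesis
    unfolding has_bochner_integral_in_def strongly_measurable_in_def
    using g_in simple I_in nn int conv by (auto simp: sp intro!: exI[of _ ?s] AE_I2)
qed

subsection \<open>The Burgers equation\<close>

lemma
  fixes U :: "'n::finite \<Rightarrow> real^'n \<Rightarrow> real"
  assumes U: "\<And>k. U k \<in> schwartz"
  defines "u \<equiv> (\<lambda>x. \<chi> k. U k x)"
  shows burgers_AE: "AE x in lborel. burgers u x $ k = half_laplace (U k) x + (\<Sum>j\<in>UNIV. U j x * partial j (U k) x)"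
    and burgers_measurable: "(\<lambda>x. burgers u x $ k) \<in> borel_measurable borel"
proof -
  have m: "U k \<in> borel_measurable borel" for k by (intro smooth_measurable schwartz_smooth U)
  have w1: "AE x in lborel. wpartial j (U k) x = partial j (U k) x" "wpartial j (U k) \<in> borel_measurable borel" for j k
    using wpartial_AE[OF U AE_I2[OF refl] m] wpartial_L2[OF U AE_I2[OF refl] m] by (auto intro: L2_measurable)
  \<comment> \<open>The inner weak derivative equals the classical one only almost everywhere, so
    \<open>wpartial_AE\<close> is used with the classical first derivative as f and the chosen weak
    one as g.\<close>
  have w2: "AE x in lborel. wpartial j (wpartial j (U k)) x = partial j (partial j (U k)) x"
    "wpartial j (wpartial j (U k)) \<in> borel_measurable borel" for j k
    using wpartial_AE[OF schwartz_partial[OF U] w1] wpartial_L2[OF schwartz_partial[OF U] w1] by (auto intro: L2_measurable)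
  have eq: "burgers u x $ k = 1/2 * (\<Sum>j\<in>UNIV. wpartial j (wpartial j (U k)) x) + (\<Sum>j\<in>UNIV. U j x * wpartial j (U k) x)" for x
    by (simp add: burgers_def laplacian_def advection_def u_def scaleR_fun_def)
  have "AE x in lborel. \<forall>j\<in>UNIV. wpartial j (U k) x = partial j (U k) x \<and> wpartial j (wpartial j (U k)) x = partial j (partial j (U k)) x"
    using w1(1) w2(1) by (intro AE_finite_allI) auto
  then show "AE x in lborel. burgers u x $ k = half_laplace (U k) x + (\<Sum>j\<in>UNIV. U j x * partial j (U k) x)"
    by eventually_elim (simp add: eq half_laplace_def)
  show "(\<lambda>x. burgers u x $ k) \<in> borel_measurable borel"
    unfolding eq using w1(2) w2(2) m by measurable
qed

theorem theorem3p10: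
  fixes u\<^sub>0 :: "real^'n \<Rightarrow> real^'n::finite"
  assumes "u\<^sub>0 \<in> vschwartz"
  shows "\<exists>u \<tau>. schwartz_local_solution u\<^sub>0 u \<tau>"
proof -
  define a where "a k = (\<lambda>x. u\<^sub>0 x $ k)" for k
  have a: "a k \<in> schwartz" for k using assms by (simp add: vschwartz_def a_def)
  obtain T U where T: "0 < T" and U: "\<And>k. reg (U k)"
    and eq: "\<And>k t x. t \<in> {0..T} \<Longrightarrow> U k t x = a k x + (LBINT s. indicator {0..<t} s * (half_laplace (U k s) x + adv U U k s x))"
    by (rule classical_solution[where a=a, OF a]) (rule that)
  define b where "b k t x = half_laplace (U k t) x + adv U U k t x" for k t x
  have b: "reg (b k)" for k
    unfolding b_def[abs_def] by (intro reg_add reg_half_laplace reg_adv U)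
  let ?u = "vfield U"
  have bu: "AE x in lborel. burgers (?u t) x $ k = b k t x" "(\<lambda>x. burgers (?u t) x $ k) \<in> borel_measurable borel" for t k
    using burgers_AE[of "\<lambda>k. U k t" k] burgers_measurable[of "\<lambda>k. U k t" k] reg_schwartz[OF U]
    by (auto simp: vfield_def b_def adv_def)
  have Um: "U k t \<in> borel_measurable borel" for k t by (rule smooth_measurable[OF reg_smooth[OF U]])
  \<comment> \<open>Taking u(t) - u_0 itself as the value of the integral makes the integral
    equation immediate. The endpoint t = T is included because integrability on the whole of [0, T)
    is that case, and q is arbitrary because every order lives on the same interval.\<close>
  have bochner: "has_bochner_integral_in (vhs_space q) (vhs_norm q) (restrict_space lborel {0..<t}) (\<lambda>s. burgers (?u s)) (\<lambda>x. ?u t x - u\<^sub>0 x)"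
    if t: "t \<in> {0..T}" for q t
  proof (rule has_bochner_integral_in_vhs[where b=b])
    show "(\<lambda>x. (?u t x - u\<^sub>0 x) $ k) \<in> schwartz" for k
      using schwartz_diff[OF reg_schwartz[OF U] a, of k t k] by (simp add: a_def)
    show "(?u t x - u\<^sub>0 x) $ k = (LBINT s. indicator {0..<t} s * b k s x)" for k x
      using eq[OF t, of k x] by (simp add: a_def b_def)
  qed (use b bu t in auto)
  have "hs_local_solution p u\<^sub>0 ?u T" for p
    unfolding hs_local_solution_def
  proof (intro conjI ballI T)
    show "u\<^sub>0 \<in> vhs_space p"
      by (rule schwartz_vhs_space[where f=a]) (use a smooth_measurable[OF schwartz_smooth[OF a]] in \<open>auto simp: a_def\<close>)
    show "?u t \<in> vhs_space p" for t
      by (rule schwartz_vhs_space[where f="\<lambda>k. U k t"]) (auto intro: reg_schwartz U Um)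
    show "bochner_integrable_in (vhs_space (p - 1)) (vhs_norm (p - 1)) (restrict_space lborel {0..<T}) (\<lambda>t. burgers (?u t))"
      unfolding bochner_integrable_in_def using bochner[of T] T by auto
    fix t assume t: "t \<in> {0..<T}"
    show "\<exists>I. has_bochner_integral_in (vhs_space (p - 1)) (vhs_norm (p - 1)) (restrict_space lborel {0..<t}) (\<lambda>s. burgers (?u s)) I \<and>
        (AE x in lborel. ?u t x = u\<^sub>0 x + I x)"
      using bochner[of t "p - 1"] t by (intro exI[of _ "\<lambda>x. ?u t x - u\<^sub>0 x"]) auto
    show "((\<lambda>s. vhs_norm p (?u s - ?u t)) \<longlongrightarrow> 0) (at t within {0..<T})"
      unfolding tendsto_iff
    proof (intro allI impI)
      fix e :: real assume e: "e > 0"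
      obtain C where C: "C \<ge> 0" "\<And>(u :: real^'n \<Rightarrow> real^'n) (f :: 'n \<Rightarrow> real^'n \<Rightarrow> real) e.
        (\<And>k. f k \<in> schwartz \<and> (AE x in lborel. u x $ k = f k x) \<and> (\<lambda>x. u x $ k) \<in> borel_measurable borel) \<Longrightarrow> 0 \<le> e \<Longrightarrow>
        (\<And>k js x. length js \<le> 2 * p \<Longrightarrow> wt (2 * p + CARD('n)) x * \<bar>pd js (f k) x\<bar> \<le> e) \<Longrightarrow> vhs_norm p u \<le> C * e"
        using vhs_norm_le[where 'n='n, of p] by blast
      have e': "e / (C + 1) > 0" using e C(1) by simp
      obtain \<delta> where \<delta>: "\<delta> > 0" "\<And>k js s r x. length js \<le> 2 * p \<Longrightarrow> s \<in> {0..T} \<Longrightarrow> r \<in> {0..T} \<Longrightarrow> \<bar>s - r\<bar> < \<delta> \<Longrightarrow>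
          wt (2 * p + CARD('n)) x * \<bar>pd js (U k s) x - pd js (U k r) x\<bar> \<le> e / (C + 1)"
        using reg_uniformly_continuous[where F=U, OF U e'] by metis
      have "dist (vhs_norm p (?u s - ?u t)) 0 < e" if s: "s \<in> {0..<T}" "dist s t < \<delta>" for s
      proof -
        have "vhs_norm p (?u s - ?u t) \<le> C * (e / (C + 1))"
        proof (rule C(2)[where f="\<lambda>k x. U k s x - U k t x"])
          show "(\<lambda>x. U k s x - U k t x) \<in> schwartz \<and> (AE x in lborel. (?u s - ?u t) x $ k = U k s x - U k t x) \<and>
              (\<lambda>x. (?u s - ?u t) x $ k) \<in> borel_measurable borel" for k
            using Um[of k s] Um[of k t] by (auto intro: schwartz_diff reg_schwartz U)
          show "wt (2 * p + CARD('n)) x * \<bar>pd js (\<lambda>x. U k s x - U k t x) x\<bar> \<le> e / (C + 1)" if "length js \<le> 2 * p" for k js x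
            using \<delta>(2)[OF that, of s t x k] s t by (simp add: pd_diff reg_smooth U dist_real_def)
        qed (use e' in simp)
        also have "\<dots> < e" using e C(1) by (simp add: field_simps)
        finally show ?thesis using vhs_norm_nonneg[of p "?u s - ?u t"] by (simp add: dist_real_def)
      qed
      then show "\<forall>\<^sub>F s in at t within {0..<T}. dist (vhs_norm p (?u s - ?u t)) 0 < e"
        unfolding eventually_at using \<delta>(1) by blast
    qed
  qed
  then have "schwartz_local_solution u\<^sub>0 ?u T" by (simp add: schwartz_local_solution_def)
  then show ?thesis by blast
qed

end
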